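(* Let $N$ be a positive integer, let $F_{N,a}$, $a_{\min}<a<1$, be the self-affine functions defined in the context, and let $$\mathcal{D}_0^{(N)}(a):=\{x\in(0,1): F_{N,a}'(x)=0\}.$$ Let $a_{\min}$, $a_0^*$, $\tilde a_0$ and the functions $\phi_N$ and $h_N$ be as defined in the context. (i) If $\tilde a_0\le a<a_0^*$, then $\dim_H\mathcal{D}_0^{(N)}(a)=h_N(\phi_N(a))$. (ii) If $a_{\min}<a\le\tilde a_0$, then $\dim_H\big((0,1)\setminus\mathcal{D}_0^{(N)}(a)\big)=h_N(\phi_N(a))$. (iii) The function $a\mapsto h_N(\phi_N(a))$ is concave on $a_{\min}<a<a_0^*$, takes on its maximum value of $1$ at $a=\tilde a_0$, and its limits as $a\downarrow a_{\min}$ and as $a\uparrow a_0^*$ are $\frac{\log(N+1)}{\log(2N+1)}$ and $\frac{\log N}{\log(2N+1)}$, respectively.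
   Context: Construction of $F_{N,a}$. Fix a positive integer $N$ and a real $a$ with $\frac{1}{N+1}<a<1$, and let $b$ be the number with $(N+1)a-Nb=1$ (so $0<b<a$). Let $x_i:=i/(2N+1)$ for $i=0,1,\dots,2N+1$, and for $j=0,1,\dots,N$ put $y_{2j}:=j(a-b)$ and $y_{2j+1}:=(j+1)a-jb$. Set $f_0(x):=x$ on $[0,1]$ and, for $n\ge1$, define $f_n$ recursively on each interval $[x_i,x_{i+1}]$, $i=0,1,\dots,2N$, by $$f_n(x):=y_i+(y_{i+1}-y_i)\,f_{n-1}\big((2N+1)(x-x_i)\big),\qquad x_i\le x\le x_{i+1}.$$ The sequence $(f_n)$ converges uniformly to a continuous function $F_{N,a}:[0,1]\to[0,1]$. Thresholds. $a_{\min}:=\frac{1}{N+1}$; $a_0^*:=\frac{3N+1}{(N+1)(2N+1)}$; and $\tilde a_0$ is the unique root $a$ in $(a_{\min},1)$ of $$(2N+1)^{2N+1}a^{N+1}\big((N+1)a-1\big)^N=N^N.$$ Functions. $$\phi_N(a):=\frac{\log\big((2N+1)a\big)}{\log(Na)-\log\big((N+1)a-1\big)},\qquad a_{\min}<a<1,$$ $$h_N(p):=-\frac{1}{\log(2N+1)}\left[p\log\left(\frac{p}{N}\right)+(1-p)\log\left(\frac{1-p}{N+1}\right)\right],\qquad 0<p<1.$$ $\dim_H$ denotes Hausdorff dimension. *)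

theory Defs
  imports "HOL-Analysis.Analysis"
begin

text \<open>The case \<open>s = 0\<close> is separated because \<open>0 powr 0 = 0\<close> in HOL; with it the zero-dimensional
  measure is counting measure.\<close>

definition hausdorff_weight :: "real \<Rightarrow> 'a::metric_space set \<Rightarrow> ennreal" where
  "hausdorff_weight s U =
     (if U = {} then 0 else if s = 0 then 1 else ennreal (diameter U powr s))"

text \<open>Boundedness of the covering sets is required explicitly since \<open>diameter\<close> is a real number,
  with no meaningful value on unbounded sets.\<close>

definition hausdorff_premeasure :: "real \<Rightarrow> real \<Rightarrow> 'a::metric_space set \<Rightarrow> ennreal" where
  "hausdorff_premeasure s \<delta> S =
     Inf {(\<Sum>i. hausdorff_weight s (U i)) | U :: nat \<Rightarrow> 'a set.
            S \<subseteq> (\<Union>i. U i) \<and> (\<forall>i. bounded (U i) \<and> diameter (U i) \<le> \<delta>)}"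

definition hausdorff_measure :: "real \<Rightarrow> 'a::metric_space set \<Rightarrow> ennreal" where
  "hausdorff_measure s S = (SUP \<delta>\<in>{0<..}. hausdorff_premeasure s \<delta> S)"

definition hausdorff_dim :: "'a::metric_space set \<Rightarrow> ereal" where
  "hausdorff_dim S = Inf {ereal s | s. 0 \<le> s \<and> hausdorff_measure s S = 0}"

definition a_min :: "nat \<Rightarrow> real" where
  "a_min N = 1 / (real N + 1)"

definition b_par :: "nat \<Rightarrow> real \<Rightarrow> real" where
  "b_par N a = ((real N + 1) * a - 1) / real N"

definition xnode :: "nat \<Rightarrow> nat \<Rightarrow> real" where
  "xnode N i = real i / (2 * real N + 1)"

definition ynode :: "nat \<Rightarrow> real \<Rightarrow> nat \<Rightarrow> real" where
  "ynode N a i = (let j = i div 2; b = b_par N a in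
     if even i then real j * (a - b) else (real j + 1) * a - real j * b)"

text \<open>The index of an interval \<open>[xnode N i, xnode N (i + 1)]\<close> containing \<open>x\<close>. At an interior node the
  right-hand interval is chosen; the lemma \<open>approx_Suc\<close> below shows that the choice is irrelevant.\<close>

definition node_index :: "nat \<Rightarrow> real \<Rightarrow> nat" where
  "node_index N x = min (nat \<lfloor>(2 * real N + 1) * x\<rfloor>) (2 * N)"

primrec approx :: "nat \<Rightarrow> real \<Rightarrow> nat \<Rightarrow> real \<Rightarrow> real" where
  "approx N a 0 x = x"
| "approx N a (Suc n) x = (let i = node_index N x in
     ynode N a i + (ynode N a (Suc i) - ynode N a i) *
       approx N a n ((2 * real N + 1) * (x - xnode N i)))"

text \<open>Only the values on \<open>[0, 1]\<close> are meaningful.\<close>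

definition F_fun :: "nat \<Rightarrow> real \<Rightarrow> real \<Rightarrow> real" where
  "F_fun N a x = lim (\<lambda>n. approx N a n x)"

definition D0 :: "nat \<Rightarrow> real \<Rightarrow> real set" where
  "D0 N a = {x \<in> {0<..<1}. (F_fun N a has_real_derivative 0) (at x)}"

definition a0_star :: "nat \<Rightarrow> real" where
  "a0_star N = (3 * real N + 1) / ((real N + 1) * (2 * real N + 1))"

definition is_a0_root :: "nat \<Rightarrow> real \<Rightarrow> bool" where
  "is_a0_root N a \<longleftrightarrow> a_min N < a \<and> a < 1 \<and>
     (2 * real N + 1) ^ (2 * N + 1) * a ^ (N + 1) * ((real N + 1) * a - 1) ^ N = real N ^ N"

definition a0_tilde :: "nat \<Rightarrow> real" where
  "a0_tilde N = (THE a. is_a0_root N a)"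

definition phi :: "nat \<Rightarrow> real \<Rightarrow> real" where
  "phi N a = ln ((2 * real N + 1) * a) / (ln (real N * a) - ln ((real N + 1) * a - 1))"

definition h_fun :: "nat \<Rightarrow> real \<Rightarrow> real" where
  "h_fun N p = - (1 / ln (2 * real N + 1)) *
     (p * ln (p / real N) + (1 - p) * ln ((1 - p) / (real N + 1)))"

lemma b_par_eq: "N \<ge> 1 \<Longrightarrow> (real N + 1) * a - real N * b_par N a = 1"
  by (simp add: b_par_def)

lemma b_par_bounds:
  assumes "N \<ge> 1" "a_min N < a" "a < 1"
  shows "0 < b_par N a" "b_par N a < a"
  using assms by (auto simp: b_par_def a_min_def field_simps)

lemma ynode_0: "ynode N a 0 = 0"
  by (simp add: ynode_def)

lemma ynode_last: "N \<ge> 1 \<Longrightarrow> ynode N a (Suc (2 * N)) = 1"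
  using b_par_eq[of N a] by (simp add: ynode_def)

lemma ynode_diff:
  "ynode N a (Suc i) - ynode N a i = (if even i then a else - b_par N a)"
  by (auto simp: ynode_def Let_def algebra_simps elim!: oddE evenE)

lemma approx_0: "approx N a n 0 = 0"
  by (induction n) (simp_all add: node_index_def xnode_def ynode_0)

lemma approx_1: "N \<ge> 1 \<Longrightarrow> approx N a n 1 = 1"
proof (induction n)
  case (Suc n)
  have "nat \<lfloor>2 * real N + 1\<rfloor> = 2 * N + 1"
    by linarith
  hence "node_index N 1 = 2 * N"
    by (simp add: node_index_def)
  moreover have "(2 * real N + 1) * (1 - xnode N (2 * N)) = 1"
    by (simp add: xnode_def field_simps)
  ultimately show ?case
    using Suc ynode_last[of N a] by simp
qed simp

lemma approx_Suc:
  assumes "N \<ge> 1" "i \<le> 2 * N" "xnode N i \<le> x" "x \<le> xnode N (Suc i)"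
  shows "approx N a (Suc n) x = ynode N a i + (ynode N a (Suc i) - ynode N a i) *
           approx N a n ((2 * real N + 1) * (x - xnode N i))"
proof (cases "x = xnode N (Suc i)")
  case False
  have "real i \<le> (2 * real N + 1) * x" "(2 * real N + 1) * x < real i + 1"
    using assms False by (auto simp: xnode_def field_simps)
  hence "nat \<lfloor>(2 * real N + 1) * x\<rfloor> = i"
    by linarith
  hence "node_index N x = i"
    using assms by (simp add: node_index_def)
  thus ?thesis by simp
next
  case True
  have e: "(2 * real N + 1) * x = real (Suc i)"
    using True by (simp add: xnode_def)
  have r: "(2 * real N + 1) * (x - xnode N i) = 1"
    by (simp add: True xnode_def field_simps)
  show ?thesis
  proof (cases "i = 2 * N")
    case True
    moreover have "nat \<lfloor>real (Suc i)\<rfloor> = Suc i"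
      by (simp only: floor_of_nat nat_int)
    ultimately have "node_index N x = i"
      unfolding node_index_def e by linarith
    thus ?thesis by simp
  next
    case False
    moreover have "nat \<lfloor>real (Suc i)\<rfloor> = Suc i"
      by (simp only: floor_of_nat nat_int)
    ultimately have "node_index N x = Suc i"
      using assms(2) by (simp only: node_index_def e)
    thus ?thesis
      using r approx_0 approx_1[OF assms(1)] \<open>x = xnode N (Suc i)\<close> by simp
  qed
qed

lemma ynode_bounds:
  assumes "N \<ge> 1" "a_min N < a" "a < 1" "i \<le> Suc (2 * N)"
  shows "0 \<le> ynode N a i" "ynode N a i \<le> 1"
proof -
  define b where "b = b_par N a"
  have b: "0 < b" "b < a" "(real N + 1) * a - real N * b = 1"
    using b_par_bounds[OF assms(1-3)] b_par_eq[OF assms(1), of a] by (auto simp: b_def)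
  define j where "j = i div 2"
  have "j \<le> N" using assms(4) by (auto simp: j_def)
  hence "real j * (a - b) \<le> real N * (a - b)" "0 \<le> real j * (a - b)"
    using b by (auto intro: mult_right_mono)
  thus "0 \<le> ynode N a i" "ynode N a i \<le> 1"
    using b assms(3) by (auto simp: ynode_def Let_def b_def[symmetric] j_def[symmetric] algebra_simps)
qed

lemma node_index_rescale:
  assumes "x \<in> {0..1}"
  shows "node_index N x \<le> 2 * N"
    "(2 * real N + 1) * (x - xnode N (node_index N x)) \<in> {0..1}"
proof -
  define t where "t = (2 * real N + 1) * x"
  have t: "0 \<le> t" "t \<le> 2 * real N + 1"
    using assms by (auto simp: t_def mult_le_cancel_left1)
  have e: "(2 * real N + 1) * (x - xnode N (node_index N x)) = t - real (node_index N x)"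
    by (simp add: t_def xnode_def right_diff_distrib)
  show "node_index N x \<le> 2 * N"
    by (simp add: node_index_def)
  show "(2 * real N + 1) * (x - xnode N (node_index N x)) \<in> {0..1}"
    unfolding e
    unfolding node_index_def t_def[symmetric] min_def using t by (auto split: if_splits) linarith+
qed

lemma approx_bounds:
  assumes "N \<ge> 1" "a_min N < a" "a < 1" "x \<in> {0..1}"
  shows "approx N a n x \<in> {0..1}"
  using assms(4)
proof (induction n arbitrary: x)
  case (Suc n)
  define i where "i = node_index N x"
  define t where "t = approx N a n ((2 * real N + 1) * (x - xnode N i))"
  have i: "i \<le> 2 * N" and t: "t \<in> {0..1}"
    using node_index_rescale[OF Suc.prems, of N] Suc.IH by (auto simp: i_def t_def)
  have y: "ynode N a i \<in> {0..1}" "ynode N a (Suc i) \<in> {0..1}"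
    using ynode_bounds[OF assms(1-3)] i by auto
  have "approx N a (Suc n) x = (1 - t) *\<^sub>R ynode N a i + t *\<^sub>R ynode N a (Suc i)"
    by (simp add: i_def t_def Let_def algebra_simps)
  also have "\<dots> \<in> {0..1}"
    using convexD[OF convex_real_interval(5) y, of "1 - t" t] t by auto
  finally show ?case .
qed simp

lemma approx_uniform_limit:
  assumes "N \<ge> 1" "a_min N < a" "a < 1"
  shows "uniform_limit {0..1} (approx N a) (F_fun N a) sequentially"
proof -
  have b: "0 < b_par N a" "b_par N a < a"
    using b_par_bounds[OF assms] by auto
  have step: "norm (approx N a (Suc n) x - approx N a n x) \<le> a ^ n"
    if "x \<in> {0..1}" for n x
    using that
  proof (induction n arbitrary: x)
    case 0
    show ?case
      using approx_bounds[OF assms 0, of 1] 0 by (auto simp del: approx.simps(2))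
  next
    case (Suc n)
    define i where "i = node_index N x"
    define t where "t = (2 * real N + 1) * (x - xnode N i)"
    have "norm (approx N a (Suc n) t - approx N a n t) \<le> a ^ n"
      using Suc.IH node_index_rescale[OF Suc.prems, of N] by (simp only: t_def i_def)
    moreover have "\<bar>ynode N a (Suc i) - ynode N a i\<bar> \<le> a"
      using b by (auto simp: ynode_diff)
    ultimately have "\<bar>ynode N a (Suc i) - ynode N a i\<bar> *
        norm (approx N a (Suc n) t - approx N a n t) \<le> a * a ^ n"
      using b by (intro mult_mono) auto
    moreover have "approx N a (Suc (Suc n)) x - approx N a (Suc n) x =
        (ynode N a (Suc i) - ynode N a i) * (approx N a (Suc n) t - approx N a n t)"
      unfolding approx.simps(2)[of N a "Suc n" x] approx.simps(2)[of N a n x]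
      by (simp only: Let_def i_def[symmetric] t_def[symmetric]) (simp only: algebra_simps)
    ultimately show ?case
      by (simp only: real_norm_def abs_mult power_Suc)
  qed
  define G where "G x = (\<Sum>n. approx N a (Suc n) x - approx N a n x)" for x
  have "uniform_limit {0..1} (\<lambda>n x. \<Sum>i<n. approx N a (Suc i) x - approx N a i x) G sequentially"
    unfolding G_def by (rule Weierstrass_m_test[OF step]) (use b assms in auto)
  hence "uniform_limit {0..1} (\<lambda>n x. x + (approx N a n x - approx N a 0 x)) (\<lambda>x. x + G x) sequentially"
    unfolding sum_lessThan_telescope[of "\<lambda>i. approx N a i x" for x]
    by (rule uniform_limit_add[OF uniform_limit_const[where c = "\<lambda>x. x"]])
  hence lim: "uniform_limit {0..1} (approx N a) (\<lambda>x. x + G x) sequentially"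
    by simp
  have "F_fun N a x = x + G x" if "x \<in> {0..1}" for x
    unfolding F_fun_def using tendsto_uniform_limitI[OF lim that] by (rule limI)
  thus ?thesis
    using lim by (subst uniform_limit_cong'[where g = "approx N a" and i = "\<lambda>x. x + G x"]) auto
qed

lemma is_a0_root_unique:
  assumes "N \<ge> 1"
  shows "\<exists>!a. is_a0_root N a"
proof -
  define g where
    "g a = (2 * real N + 1) ^ (2 * N + 1) * a ^ (N + 1) * ((real N + 1) * a - 1) ^ N" for a
  have pos: "0 < a_min N" "a_min N < 1"
    using assms by (auto simp: a_min_def)
  have mono: "g u < g v" if "a_min N < u" "u < v" for u v
  proof -
    have "0 < u"
      using that pos by linarith
    moreover have "0 < (real N + 1) * u - 1"
      using that by (simp add: a_min_def field_simps)
    ultimately have u: "0 < u" "0 < (real N + 1) * u - 1" .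
    have "u ^ (N + 1) * ((real N + 1) * u - 1) ^ N < v ^ (N + 1) * ((real N + 1) * v - 1) ^ N"
    proof (rule mult_strict_mono)
      show "u ^ (N + 1) < v ^ (N + 1)"
        by (rule power_strict_mono) (use u that in auto)
      show "((real N + 1) * u - 1) ^ N < ((real N + 1) * v - 1) ^ N"
        by (rule power_strict_mono) (use u that assms in auto)
    qed (use u that in auto)
    thus ?thesis by (simp add: g_def mult.assoc)
  qed
  have low: "g (a_min N) = 0"
    using assms by (simp add: g_def a_min_def)
  have high: "real N ^ N < g 1"
  proof -
    have "1 < (2 * real N + 1) ^ (2 * N + 1)"
      using assms by (intro one_less_power) auto
    thus ?thesis using assms by (simp add: g_def)
  qed
  have "continuous_on {a_min N..1} g"
    unfolding g_def by (intro continuous_intros)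
  then obtain a where a: "a_min N \<le> a" "a \<le> 1" "g a = real N ^ N"
    using IVT'[of g "a_min N" "real N ^ N" 1] low high pos by force
  have "a \<noteq> a_min N" "a \<noteq> 1"
    using a low high assms by auto
  hence "is_a0_root N a"
    using a by (auto simp: is_a0_root_def g_def)
  moreover have "u = v" if "is_a0_root N u" "is_a0_root N v" for u v
  proof (rule ccontr)
    assume "u \<noteq> v"
    then consider "u < v" | "v < u" by linarith
    moreover have "a_min N < u" "a_min N < v" "g u = g v"
      using that unfolding is_a0_root_def g_def by auto
    ultimately show False
      using mono[of u v] mono[of v u] by cases auto
  qed
  ultimately show ?thesis by blast
qed

end

theory Submission
  imports Defs "HOL-Real_Asymp.Real_Asymp"
begin

text \<open>
  Put \<open>d = 2N + 1\<close> and \<open>b = b_par N a\<close>. On a \<open>d\<close>-adic interval of order \<open>n\<close> the function \<open>F\<close> is an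
  affine copy of itself, scaled by \<open>\<plusminus>a\<^bsup>n-k\<^esup> b\<^bsup>k\<^esup>\<close>, where \<open>k\<close> counts the odd digits in the address of the
  interval. Adjacent intervals have counts that differ by at most one, because a carry only exchanges
  the even digits \<open>d - 1\<close> and \<open>0\<close>. Hence \<open>F'(x) = 0\<close> exactly if the slopes \<open>d\<^bsup>n\<^esup> a\<^bsup>n-k\<^esup> b\<^bsup>k\<^esup>\<close> of the intervals
  around \<open>x\<close> tend to \<open>0\<close>. Taking logarithms, this says that the number of odd digits among the first \<open>n\<close>
  digits of \<open>x\<close>, minus \<open>n\<close> times \<open>phi N a\<close>, tends to infinity (\<open>D0_iff_odd_excess\<close>). The theorem is
  thus about the dimension of sets of numbers with prescribed frequency of odd digits.

  Upper bounds come from the Bernoulli law in which a digit is odd with probability \<open>p = phi N a\<close> and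
  digits of equal parity are equally likely. An interval of order \<open>n\<close> with exactly \<open>np\<close> odd digits has
  mass \<open>d\<^bsup>-n h(p)\<^esup>\<close>. For \<open>p \<ge> N/d\<close> an excess of odd digits makes an interval heavier, for \<open>p \<le> N/d\<close> a
  deficit does, so in both cases the exceptional set is covered by intervals of essentially this mass,
  and the masses of one order add up to \<open>1\<close> (\<open>hausdorff_measure_eq_0_heavy_cylinders\<close>).

  For lower bounds fix a rational \<open>q = K/L\<close> slightly beyond \<open>phi N a\<close> and use the numbers whose digits
  come in blocks of length \<open>L\<close> with exactly \<open>K\<close> odd digits. If there are \<open>M\<close> such blocks, replacing the
  base-\<open>M\<close> digits of \<open>t\<close> by blocks in increasing order is a map from \<open>[0, 1)\<close> into that set whose
  inverse is Hoelder continuous with exponent \<open>ln M / (L ln d)\<close>; countable subadditivity of Lebesgue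
  measure then bounds the Hausdorff measure from below (\<open>hausdorff_measure_nonzero_if_Hoelder_inverse\<close>).
  Since \<open>M = (L choose K) N\<^bsup>K\<^esup> (N+1)\<^bsup>L-K\<^esup>\<close> and the binomial law with parameter \<open>K/L\<close> peaks at \<open>K\<close>, this
  exponent approaches \<open>h(q)\<close> as the block is lengthened.

  Concavity of \<open>h(phi a)\<close> has a different reason on each side of \<open>a0_tilde\<close>, where \<open>phi = N/d\<close> and \<open>h\<close>
  attains its maximum \<open>1\<close>. To the left, \<open>h(phi a) ln d\<close> is the minimum over \<open>q \<in> [0, 1]\<close> of
  \<open>ln (N (db)\<^bsup>q\<^esup> + (N+1) (da)\<^bsup>q\<^esup>)\<close>, and each of these functions is concave in \<open>a\<close>. To the right, \<open>phi\<close> is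
  convex and \<open>h\<close> is concave and decreasing. Two concave pieces that meet at a common maximum form a
  concave function (\<open>concave_on_glue_at_max\<close>). The hard point is the convexity of \<open>phi\<close>, which comes
  down to the explicit inequality \<open>phi_convexity_inequality\<close>.
\<close>


section \<open>Counting odd digits\<close>

text \<open>The \<open>n\<close> lowest base-\<open>d\<close> digits are inspected, leading zeros included. A number \<open>m < d\<^bsup>n\<^esup>\<close> is the
  address of the interval \<open>[m/d\<^bsup>n\<^esup>, (m+1)/d\<^bsup>n\<^esup>]\<close>.\<close>

primrec odd_digits :: "nat \<Rightarrow> nat \<Rightarrow> nat \<Rightarrow> nat" where
  "odd_digits d 0 m = 0"
| "odd_digits d (Suc n) m = odd_digits d n (m div d) + of_bool (odd (m mod d))"

definition prefix :: "nat \<Rightarrow> nat \<Rightarrow> real \<Rightarrow> nat" where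
  "prefix d n x = nat \<lfloor>real d ^ n * x\<rfloor>"

definition odd_count :: "nat \<Rightarrow> real \<Rightarrow> nat \<Rightarrow> nat" where
  "odd_count d x n = odd_digits d n (prefix d n x)"

lemma odd_digits_le: "odd_digits d n m \<le> n"
  by (induction n arbitrary: m) (auto simp: le_SucI)

text \<open>Without carry only the last digit changes its parity. A carry turns trailing digits \<open>d - 1\<close> into \<open>0\<close>,
  both even as \<open>d\<close> is odd, and then changes one further digit. This is what makes the slopes of \<open>F\<close> on
  adjacent intervals comparable.\<close>

lemma odd_digits_Suc_bounds:
  assumes "odd d" "d > 1"
  shows "odd_digits d n (Suc m) \<le> odd_digits d n m + 1 \<and> odd_digits d n m \<le> odd_digits d n (Suc m) + 1"
proof (induction n arbitrary: m)
  case (Suc n)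
  show ?case
  proof (cases "Suc (m mod d) = d")
    case True
    hence e: "Suc m div d = Suc (m div d)" "Suc m mod d = 0" "even (m mod d)"
      using assms True by (auto simp: div_Suc mod_Suc) (metis even_Suc True)
    show ?thesis using Suc[of "m div d"] e by simp
  next
    case False
    hence e: "Suc m div d = m div d" "Suc m mod d = Suc (m mod d)"
      by (auto simp: div_Suc mod_Suc)
    show ?thesis by (auto simp: e)
  qed
qed simp

lemma prefix_bounds:
  assumes "x \<ge> 0"
  shows "real (prefix d n x) \<le> real d ^ n * x" "real d ^ n * x < real (prefix d n x) + 1"
  using assms by (auto simp: prefix_def)

lemma prefix_eqI:
  assumes "real m \<le> real d ^ n * x" "real d ^ n * x < real m + 1"
  shows "prefix d n x = m"
  unfolding prefix_def using assms by linarith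

lemma prefix_less:
  assumes "0 \<le> x" "x < 1" "d > 0"
  shows "prefix d n x < d ^ n"
proof -
  have "real (prefix d n x) \<le> real d ^ n * x" using prefix_bounds assms by auto
  also have "\<dots> < real d ^ n * 1" using assms by (intro mult_strict_left_mono) auto
  finally show ?thesis by (simp flip: of_nat_power)
qed

lemma prefix_Suc_div:
  assumes "x \<ge> 0" "d > 0"
  shows "prefix d (Suc n) x div d = prefix d n x"
proof -
  have "real (prefix d (Suc n) x) / real d \<le> real d ^ n * x"
    using prefix_bounds(1)[OF assms(1), of d "Suc n"] assms by (simp add: field_simps)
  moreover have "real (prefix d (Suc n) x div d) \<le> real (prefix d (Suc n) x) / real d"
    by (rule of_nat_div_le_of_nat)
  moreover have "real d ^ n * x < real (prefix d (Suc n) x div d) + 1"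
  proof -
    have "prefix d (Suc n) x + 1 \<le> d * (prefix d (Suc n) x div d + 1)"
      using dividend_less_div_times[OF assms(2), of "prefix d (Suc n) x"]
      by (simp add: algebra_simps)
    hence "real (prefix d (Suc n) x) + 1 \<le> real d * (real (prefix d (Suc n) x div d) + 1)"
      by (metis of_nat_1 of_nat_add of_nat_le_iff of_nat_mult)
    hence "real d * (real d ^ n * x) < real d * (real (prefix d (Suc n) x div d) + 1)"
      using prefix_bounds(2)[OF assms(1), of d "Suc n"] by (simp add: mult.assoc)
    thus ?thesis using assms by (simp)
  qed
  ultimately show ?thesis using prefix_eqI[of "prefix d (Suc n) x div d" d n x] by linarith
qed

lemma odd_count_Suc:
  assumes "x \<ge> 0" "d > 0"
  shows "odd_count d x (Suc n) = odd_count d x n + of_bool (odd (prefix d (Suc n) x mod d))"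
  by (simp add: odd_count_def prefix_Suc_div[OF assms])

lemma ex_power_matching_scale:
  fixes r D :: real
  assumes "0 < r" "r < 1" "D > 1"
  obtains n where "D ^ n * r \<le> 1" "1 < D ^ Suc n * r"
proof -
  define P where "P k \<longleftrightarrow> 1 < D ^ k * r" for k
  obtain k where "1 / r < D ^ k" using real_arch_pow[OF assms(3)] by meson
  hence "P k" using assms(1) by (simp add: P_def field_simps)
  moreover have "\<not> P 0" using assms(2) by (simp add: P_def)
  ultimately obtain n where "\<not> P n" "P (Suc n)"
    using ex_least_nat_less[of P k] by auto
  thus ?thesis using that[of n] by (simp add: P_def)
qed

lemma sum_lessThan_mult_div_mod:
  fixes f :: "nat \<Rightarrow> nat \<Rightarrow> 'a::comm_monoid_add"
  assumes "d > 0"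
  shows "(\<Sum>m<k * d. f (m div d) (m mod d)) = (\<Sum>q<k. \<Sum>r<d. f q r)"
proof -
  have "(\<Sum>m<k * d. f (m div d) (m mod d)) = (\<Sum>(q, r)\<in>{..<k} \<times> {..<d}. f q r)"
  proof (rule sum.reindex_bij_witness[where i = "\<lambda>(q, r). q * d + r" and j = "\<lambda>m. (m div d, m mod d)"])
    fix z assume "z \<in> {..<k} \<times> {..<d}"
    then obtain q r where z: "z = (q, r)" "q < k" "r < d" by auto
    have "q * d + r < Suc q * d" using z by simp
    also have "\<dots> \<le> k * d" using z by (intro mult_right_mono) auto
    finally show "(case z of (q, r) \<Rightarrow> q * d + r) \<in> {..<k * d}" using z by simp
  qed (use assms in \<open>auto simp: less_mult_imp_div_less\<close>)
  thus ?thesis by (simp add: sum.cartesian_product)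
qed

lemma sum_digits_by_parity:
  fixes g :: "bool \<Rightarrow> 'a::comm_semiring_1"
  shows "(\<Sum>r<2 * N + 1. g (odd r)) = of_nat N * g True + (of_nat N + 1) * g False"
proof (induction N)
  case (Suc N)
  have "(\<Sum>r<2 * Suc N + 1. g (odd r)) = (\<Sum>r<2 * N + 1. g (odd r)) + g (odd (2 * N + 1)) + g (odd (2 * N + 2))"
    by (simp add: numeral_2_eq_2)
  also have "(\<Sum>r<2 * N + 1. g (odd r)) = of_nat N * g True + (of_nat N + 1) * g False"
    by (rule Suc.IH)
  finally show ?case by (simp add: algebra_simps)
qed simp

text \<open>The total mass of the intervals of order \<open>n\<close> under the product law that gives weight \<open>u\<close> to each of the
  \<open>N\<close> odd digits and weight \<open>v\<close> to each of the \<open>N + 1\<close> even ones.\<close>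

lemma sum_cylinder_masses:
  fixes u v :: real
  shows "(\<Sum>m<(2 * N + 1) ^ n. u ^ odd_digits (2 * N + 1) n m * v ^ (n - odd_digits (2 * N + 1) n m)) = 
    (real N * u + (real N + 1) * v) ^ n"
proof (induction n)
  case (Suc n)
  define d where "d = 2 * N + 1"
  define w where "w n m = u ^ odd_digits d n m * v ^ (n - odd_digits d n m)" for n m
  define w1 where "w1 r = u ^ of_bool (odd r) * v ^ (1 - of_bool (odd r))" for r :: nat
  have w: "w (Suc n) m = w n (m div d) * w1 (m mod d)" for m
    using odd_digits_le[of d n "m div d"] by (auto simp: w_def w1_def Suc_diff_le)
  have "(\<Sum>m<d ^ Suc n. w (Suc n) m) = (\<Sum>m<d ^ n * d. w n (m div d) * w1 (m mod d))"
    by (simp add: w mult.commute)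
  also have "\<dots> = (\<Sum>q<d ^ n. \<Sum>r<d. w n q * w1 r)"
    by (rule sum_lessThan_mult_div_mod) (simp add: d_def)
  also have "\<dots> = (\<Sum>q<d ^ n. w n q) * (\<Sum>r<d. w1 r)"
    by (simp add: sum_product)
  also have "(\<Sum>r<d. w1 r) = real N * u + (real N + 1) * v"
    unfolding w1_def d_def using sum_digits_by_parity[of "\<lambda>b. u ^ of_bool b * v ^ (1 - of_bool b)" N] by simp
  also have "(\<Sum>q<d ^ n. w n q) = (real N * u + (real N + 1) * v) ^ n"
    unfolding w_def d_def by (rule Suc.IH)
  finally show ?case unfolding w_def d_def power_Suc2[of "real N * u + (real N + 1) * v"] .
qed simp

section \<open>Vanishing derivative and the slopes on the grid intervals\<close>

text \<open>The absolute value of the slope of the chord of \<open>F\<close> over an interval of order \<open>n\<close> whose address has \<open>k\<close>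
  odd digits.\<close>

definition level_slope :: "nat \<Rightarrow> real \<Rightarrow> nat \<Rightarrow> nat \<Rightarrow> real" where
  "level_slope N a n k = (2 * real N + 1) ^ n * (a ^ (n - k) * b_par N a ^ k)"

lemma F_fun_rec:
  assumes "N \<ge> 1" "a_min N < a" "a < 1" "i \<le> 2 * N" "t \<in> {0..1}"
  shows "F_fun N a ((real i + t) / (2 * real N + 1)) =
           ynode N a i + (ynode N a (Suc i) - ynode N a i) * F_fun N a t"
proof -
  define x where "x = (real i + t) / (2 * real N + 1)"
  have x: "xnode N i \<le> x" "x \<le> xnode N (Suc i)" "(2 * real N + 1) * (x - xnode N i) = t"
    using assms(4,5) by (auto simp: x_def xnode_def divide_right_mono right_diff_distrib)
  have "real i + t \<le> 2 * real N + 1" using assms(4,5) by auto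
  hence "x \<in> {0..1}"
    using assms(5) by (auto simp: x_def)
  note lim = tendsto_uniform_limitI[OF approx_uniform_limit[OF assms(1-3)]]
  have "(\<lambda>n. approx N a (Suc n) x) \<longlonglongrightarrow> F_fun N a x"
    by (rule LIMSEQ_Suc[OF lim[OF \<open>x \<in> {0..1}\<close>]])
  moreover have "(\<lambda>n. approx N a (Suc n) x) \<longlonglongrightarrow> 
      ynode N a i + (ynode N a (Suc i) - ynode N a i) * F_fun N a t"
    unfolding approx_Suc[OF assms(1,4) x(1,2)] x(3)
    by (intro tendsto_intros lim assms)
  ultimately show ?thesis unfolding x_def[symmetric] by (rule LIMSEQ_unique)
qed

lemma F_fun_bounds:
  assumes "N \<ge> 1" "a_min N < a" "a < 1" "t \<in> {0..1}"
  shows "F_fun N a t \<in> {0..1}"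
  using Lim_in_closed_set[OF closed_atLeastAtMost _ _ 
     tendsto_uniform_limitI[OF approx_uniform_limit[OF assms(1-3)] assms(4)], of 0 1]
    approx_bounds[OF assms] by auto

lemma F_fun_endpoints:
  assumes "N \<ge> 1"
  shows "F_fun N a 0 = 0" "F_fun N a 1 = 1"
  using assms by (auto simp: F_fun_def approx_0 approx_1)

text \<open>Self-affinity, iterated: refining the address by one digit composes the affine map of the coarser
  interval with one of the \<open>2N + 1\<close> maps of the functional equation, whose factor is \<open>a\<close> for an even and
  \<open>-b\<close> for an odd digit.\<close>

lemma F_fun_level:
  assumes "N \<ge> 1" "a_min N < a" "a < 1" "m < (2 * N + 1) ^ n"
  obtains Y S where
    "\<bar>S\<bar> = level_slope N a n (odd_digits (2 * N + 1) n m) / (2 * real N + 1) ^ n"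
    "\<And>t. t \<in> {0..1} \<Longrightarrow> F_fun N a ((real m + t) / (2 * real N + 1) ^ n) = Y + S * F_fun N a t"
proof -
  have b: "0 < b_par N a" "b_par N a < a" using b_par_bounds assms by auto
  have "\<exists>Y S. \<bar>S\<bar> = a ^ (n - odd_digits (2 * N + 1) n m) * b_par N a ^ odd_digits (2 * N + 1) n m \<and>
    (\<forall>t\<in>{0..1}. F_fun N a ((real m + t) / (2 * real N + 1) ^ n) = Y + S * F_fun N a t)"
    using assms(4)
  proof (induction n arbitrary: m)
    case 0
    hence "m = 0" by simp
    thus ?case by (intro exI[of _ 0] exI[of _ 1]) auto
  next
    case (Suc n)
    define q r where "q = m div (2 * N + 1)" and "r = m mod (2 * N + 1)"
    have "q < (2 * N + 1) ^ n" using Suc.prems 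
      by (simp add: q_def less_mult_imp_div_less mult.commute)
    then obtain Y S where YS:
      "\<bar>S\<bar> = a ^ (n - odd_digits (2 * N + 1) n q) * b_par N a ^ odd_digits (2 * N + 1) n q"
      "\<And>t. t \<in> {0..1} \<Longrightarrow> F_fun N a ((real q + t) / (2 * real N + 1) ^ n) = Y + S * F_fun N a t"
      using Suc.IH by blast
    have r: "r \<le> 2 * N" using mod_less_divisor[of "2*N+1" m] unfolding r_def by linarith
    have "m = q * (2 * N + 1) + r" by (simp only: q_def r_def div_mult_mod_eq)
    hence "real m = real (q * (2 * N + 1) + r)" by (rule arg_cong)
    hence mr: "real m = real q * (2 * real N + 1) + real r"
      by (simp only: of_nat_1 of_nat_add of_nat_mult of_nat_numeral)
    define D where "D = 2 * real N + 1"
    have D: "D > 0" by (simp add: D_def)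
    have "F_fun N a ((real m + t) / (2 * real N + 1) ^ Suc n) = 
        (Y + S * ynode N a r) + (S * (ynode N a (Suc r) - ynode N a r)) * F_fun N a t" 
      if t: "t \<in> {0..1}" for t
    proof -
      have "(real m + t) / (2 * real N + 1) ^ Suc n = 
          (real q + (real r + t) / (2 * real N + 1)) / (2 * real N + 1) ^ n"
        unfolding mr power_Suc D_def[symmetric] using D by (simp add: field_simps)
      also have "F_fun N a \<dots> = Y + S * F_fun N a ((real r + t) / (2 * real N + 1))"
      proof (rule YS(2))
        have "real r + t \<le> 2 * real N + 1" using r t by auto
        thus "(real r + t) / (2 * real N + 1) \<in> {0..1}" using t by simp
      qed
      also have "F_fun N a ((real r + t) / (2 * real N + 1)) = 
         ynode N a r + (ynode N a (Suc r) - ynode N a r) * F_fun N a t"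
        by (rule F_fun_rec) (use assms r t in auto)
      finally show ?thesis by (simp add: algebra_simps)
    qed
    moreover have "\<bar>S * (ynode N a (Suc r) - ynode N a r)\<bar> = 
      a ^ (Suc n - odd_digits (2 * N + 1) (Suc n) m) * b_par N a ^ odd_digits (2 * N + 1) (Suc n) m"
    proof -
      define k where "k = odd_digits (2 * N + 1) n q"
      have k: "k \<le> n" unfolding k_def by (rule odd_digits_le)
      have "odd_digits (2 * N + 1) (Suc n) m = k + of_bool (odd r)"
        by (simp only: odd_digits.simps q_def r_def k_def)
      thus ?thesis unfolding abs_mult YS(1) k_def[symmetric] ynode_diff 
        using b k by (auto simp: Suc_diff_le)
    qed
    ultimately show ?case by blast
  qed
  thus ?thesis using that by (auto simp: level_slope_def)
qed

lemma level_slope_pos: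
  assumes "N \<ge> 1" "a_min N < a" "a < 1"
  shows "level_slope N a n k > 0"
  using b_par_bounds[OF assms] by (auto simp: level_slope_def)

lemma level_slope_neighbour:
  assumes "N \<ge> 1" "a_min N < a" "a < 1" "k \<le> Suc l" "l \<le> Suc k" "k \<le> n" "l \<le> n"
  shows "level_slope N a n k \<le> a / b_par N a * level_slope N a n l"
proof -
  have b: "0 < b_par N a" "b_par N a < a" using b_par_bounds assms by auto
  consider "k = l" | "k = Suc l" | "l = Suc k" using assms by linarith
  thus ?thesis
  proof cases
    case 1
    have "1 \<le> a / b_par N a" using b by simp
    from mult_right_mono[OF this, of "level_slope N a n l"] show ?thesis 
      using 1 level_slope_pos[OF assms(1-3), of n l] by simp
  next
    case 2
    have "n - l = Suc (n - k)" using 2 assms by simp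
    hence "level_slope N a n k = b_par N a / a * level_slope N a n l" 
      using b 2 by (simp add: level_slope_def)
    also have "\<dots> \<le> a / b_par N a * level_slope N a n l"
    proof (rule mult_right_mono)
      have "b_par N a / a \<le> 1" "1 \<le> a / b_par N a" using b by auto
      thus "b_par N a / a \<le> a / b_par N a" by linarith
    qed (use level_slope_pos[OF assms(1-3), of n l] in auto)
    finally show ?thesis .
  next
    case 3
    have "n - k = Suc (n - l)" using 3 assms by simp
    thus ?thesis using 3 b by (simp add: level_slope_def)
  qed
qed

lemma F_fun_diff_same_interval:
  assumes "N \<ge> 1" "a_min N < a" "a < 1" "m < (2 * N + 1) ^ n" 
    "real m \<le> (2 * real N + 1) ^ n * x" "(2 * real N + 1) ^ n * x \<le> real m + 1"
    "real m \<le> (2 * real N + 1) ^ n * y" "(2 * real N + 1) ^ n * y \<le> real m + 1"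
  shows "\<bar>F_fun N a y - F_fun N a x\<bar> \<le>
    level_slope N a n (odd_digits (2 * N + 1) n m) / (2 * real N + 1) ^ n"
proof -
  obtain Y S where YS:
    "\<bar>S\<bar> = level_slope N a n (odd_digits (2 * N + 1) n m) / (2 * real N + 1) ^ n"
    "\<And>t. t \<in> {0..1} \<Longrightarrow> F_fun N a ((real m + t) / (2 * real N + 1) ^ n) = Y + S * F_fun N a t"
    using F_fun_level[OF assms(1-4)] by metis
  have val: "F_fun N a z = Y + S * F_fun N a ((2 * real N + 1) ^ n * z - real m)
      \<and> F_fun N a ((2 * real N + 1) ^ n * z - real m) \<in> {0..1}"
    if "real m \<le> (2 * real N + 1) ^ n * z" "(2 * real N + 1) ^ n * z \<le> real m + 1" for z
  proof
    have "z = (real m + ((2 * real N + 1) ^ n * z - real m)) / (2 * real N + 1) ^ n"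
      by simp
    thus "F_fun N a z = Y + S * F_fun N a ((2 * real N + 1) ^ n * z - real m)"
      using YS(2)[of "(2 * real N + 1) ^ n * z - real m"] that by simp
  qed (rule F_fun_bounds[OF assms(1-3)], use that in auto)
  have "\<bar>F_fun N a y - F_fun N a x\<bar> = \<bar>S\<bar> * \<bar>F_fun N a ((2 * real N + 1) ^ n * y - real m) - 
      F_fun N a ((2 * real N + 1) ^ n * x - real m)\<bar>"
    using val[OF assms(5,6)] val[OF assms(7,8)] by (simp add: abs_mult[symmetric] algebra_simps)
  also have "\<dots> \<le> \<bar>S\<bar> * 1"
    using val[OF assms(5,6)] val[OF assms(7,8)] by (intro mult_left_mono) auto
  finally show ?thesis using YS(1) by simp
qed

text \<open>At distance at most \<open>(2N+1)\<^bsup>-n\<^esup>\<close> from \<open>x\<close> one is still in the interval of order \<open>n\<close> around \<open>x\<close> or in an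
  adjacent one. In the latter case the estimate passes through the common endpoint, and the adjacent slope
  exceeds the slope at \<open>x\<close> by at most the factor \<open>a / b\<close>.\<close>

lemma F_fun_diff_adjacent:
  fixes x y :: real
  assumes "N \<ge> 1" "a_min N < a" "a < 1" "0 \<le> x" "x < 1" "0 \<le> y" "y < 1" 
    "(2 * real N + 1) ^ n * \<bar>y - x\<bar> \<le> 1"
  shows "\<bar>F_fun N a y - F_fun N a x\<bar> \<le>
    (1 + a / b_par N a) * level_slope N a n (odd_count (2 * N + 1) x n) / (2 * real N + 1) ^ n"
proof -
  define d where "d = 2 * N + 1"
  have d: "real d = 2 * real N + 1" "odd d" "d > 1" using assms(1) by (auto simp: d_def)
  have b: "0 < b_par N a" "b_par N a < a" using b_par_bounds[OF assms(1-3)] by simp_all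
  define m where "m = prefix d n x"
  define l where "l = prefix d n y"
  have m: "real m \<le> real d ^ n * x" "real d ^ n * x < real m + 1" "m < d ^ n"
    unfolding m_def using prefix_bounds[of x d n] prefix_less[of x d n] assms(4,5) d(3) by simp_all
  have l: "real l \<le> real d ^ n * y" "real d ^ n * y < real l + 1" "l < d ^ n"
    unfolding l_def using prefix_bounds[of y d n] prefix_less[of y d n] assms(6,7) d(3) by simp_all
  define sl where "sl m = level_slope N a n (odd_digits d n m)" for m
  have dn: "real d ^ n > 0" using d by auto
  have slp: "sl m > 0" for m using level_slope_pos[OF assms(1-3)] by (simp add: sl_def)
  have same: "\<bar>F_fun N a y - F_fun N a x\<bar> \<le> sl m / real d ^ n" if "m < d ^ n"
    "real m \<le> real d ^ n * x" "real d ^ n * x \<le> real m + 1"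
    "real m \<le> real d ^ n * y" "real d ^ n * y \<le> real m + 1" for m x y
    using F_fun_diff_same_interval[OF assms(1-3), of m n x y, folded d_def d(1)] that 
    unfolding sl_def by blast
  have nb: "sl l \<le> a / b_par N a * sl m" if "l = Suc m \<or> m = Suc l"
    unfolding sl_def using odd_digits_Suc_bounds[OF d(2,3), of n m] 
      odd_digits_Suc_bounds[OF d(2,3), of n l] that
    by (intro level_slope_neighbour[OF assms(1-3)] odd_digits_le) auto
  have "\<bar>real d ^ n * y - real d ^ n * x\<bar> \<le> 1"
    using assms(8) dn d(1) by (simp add: right_diff_distrib[symmetric] abs_mult)
  hence "\<bar>int m - int l\<bar> \<le> 1" using m l by linarith
  then consider "l = m" | "l = Suc m" | "m = Suc l" by linarith
  hence "\<bar>F_fun N a y - F_fun N a x\<bar> \<le> (1 + a / b_par N a) * sl m / real d ^ n"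
  proof cases
    case 1
    have "\<bar>F_fun N a y - F_fun N a x\<bar> \<le> 1 * sl m / real d ^ n" using same[of m x y] m l 1 by simp
    also have "\<dots> \<le> (1 + a / b_par N a) * sl m / real d ^ n"
      using b dn slp[of m] by (intro divide_right_mono mult_right_mono) auto
    finally show ?thesis .
  next
    case 2
    define z where "z = real l / real d ^ n"
    have z: "real d ^ n * z = real l" using dn by (simp add: z_def)
    have "\<bar>F_fun N a z - F_fun N a x\<bar> \<le> sl m / real d ^ n"
      by (rule same) (use m z 2 in auto)
    moreover have "\<bar>F_fun N a y - F_fun N a z\<bar> \<le> sl l / real d ^ n"
      by (rule same) (use l z 2 in auto)
    moreover have "sl l / real d ^ n \<le> a / b_par N a * sl m / real d ^ n"
      using nb 2 dn by (intro divide_right_mono) auto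
    ultimately show ?thesis by (simp add: algebra_simps add_divide_distrib)
  next
    case 3
    define z where "z = real m / real d ^ n"
    have z: "real d ^ n * z = real m" using dn by (simp add: z_def)
    have "\<bar>F_fun N a z - F_fun N a x\<bar> \<le> sl m / real d ^ n"
      by (rule same) (use m z 3 in auto)
    moreover have "\<bar>F_fun N a y - F_fun N a z\<bar> \<le> sl l / real d ^ n"
      by (rule same) (use l z 3 in auto)
    moreover have "sl l / real d ^ n \<le> a / b_par N a * sl m / real d ^ n"
      using nb 3 dn by (intro divide_right_mono) auto
    ultimately show ?thesis by (simp add: algebra_simps add_divide_distrib)
  qed
  thus ?thesis unfolding odd_count_def d_def[symmetric] d(1)[symmetric] by (simp only: sl_def m_def)
qed

text \<open>If \<open>F'(x) = 0\<close>, then the increment of \<open>F\<close> over a small interval containing \<open>x\<close> is small compared with the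
  length of that interval, and the quotient is its slope. Conversely, a point \<open>y\<close> near \<open>x\<close> is compared with
  the intervals of the order \<open>n\<close> for which \<open>d\<^bsup>-n\<^esup>\<close> matches the distance of \<open>y\<close> from \<open>x\<close>.\<close>

lemma D0_iff_slopes_tendsto_0:
  assumes "N \<ge> 1" "a_min N < a" "a < 1" "0 < x" "x < 1"
  shows "x \<in> D0 N a \<longleftrightarrow> (\<lambda>n. level_slope N a n (odd_count (2 * N + 1) x n)) \<longlonglongrightarrow> 0"
proof -
  define d where "d = 2 * N + 1"
  have d: "real d = 2 * real N + 1" "odd d" "d > 1" using assms(1) by (auto simp: d_def)
  have b: "0 < b_par N a" "b_par N a < a" using b_par_bounds[OF assms(1-3)] by simp_all
  define sl where "sl n = level_slope N a n (odd_count (2 * N + 1) x n)" for n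
  have slp: "sl m > 0" for m using level_slope_pos[OF assms(1-3)] by (simp add: sl_def)
  have pow0: "(\<lambda>n. (1 / real d) ^ n) \<longlonglongrightarrow> 0" using d by (intro LIMSEQ_power_zero) auto
  have fwd: "sl \<longlonglongrightarrow> 0" if "x \<in> D0 N a"
  proof -
    from that have "(F_fun N a has_real_derivative 0) (at x)" by (simp add: D0_def)
    hence der: "((\<lambda>y. (F_fun N a y - F_fun N a x) / (y - x)) \<longlongrightarrow> 0) (at x)"
      by (simp add: has_field_derivative_iff)
    show ?thesis
    proof (rule LIMSEQ_I)
      fix e :: real assume "e > 0"
      hence "\<forall>\<^sub>F y in at x. \<bar>(F_fun N a y - F_fun N a x) / (y - x)\<bar> < e / 2"
        using tendstoD[OF der, of "e/2"] by (simp add: dist_real_def)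
      then obtain r where r: "r > 0" and 
        rr: "\<And>y. y \<noteq> x \<Longrightarrow> \<bar>y - x\<bar> < r \<Longrightarrow> \<bar>(F_fun N a y - F_fun N a x) / (y - x)\<bar> < e / 2"
        unfolding eventually_at by (auto simp: dist_real_def)
      have rr': "\<bar>F_fun N a y - F_fun N a x\<bar> \<le> e / 2 * \<bar>y - x\<bar>" if "\<bar>y - x\<bar> < r" for y
        using rr[of y] that by (cases "y = x") (auto simp: field_simps)
      obtain n0 where n0: "\<And>n. n \<ge> n0 \<Longrightarrow> (1 / real d) ^ n < r"
        using LIMSEQ_D[OF pow0 r] by (auto simp: power_one_over)
      have "norm (sl n - 0) < e" if "n \<ge> n0" for n
      proof -
        have dn: "real d ^ n > 0" using d by auto
        define m where "m = prefix d n x"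
        have m: "real m \<le> real d ^ n * x" "real d ^ n * x < real m + 1" "m < d ^ n"
          unfolding m_def using prefix_bounds[of x d n] prefix_less[of x d n] assms(4,5) d(3) by simp_all
        define u v where "u = real m / real d ^ n" and "v = (real m + 1) / real d ^ n"
        have uv: "u \<le> x" "x \<le> v" "v - u = (1 / real d) ^ n" using m dn 
          by (auto simp: u_def v_def field_simps power_one_over)
        obtain Y S where YS: "\<bar>S\<bar> = sl n / (2 * real N + 1) ^ n"
          "\<And>t. t \<in> {0..1} \<Longrightarrow> F_fun N a ((real m + t) / (2 * real N + 1) ^ n) = Y + S * F_fun N a t"
          using F_fun_level[OF assms(1-3), of m n] m(3) 
          unfolding m_def d_def sl_def odd_count_def by metis
        have "F_fun N a v - F_fun N a u = S" 
          using YS(2)[of 0] YS(2)[of 1] F_fun_endpoints[OF assms(1), of a] by (simp add: u_def v_def d)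
        hence "\<bar>S\<bar> \<le> \<bar>F_fun N a v - F_fun N a x\<bar> + \<bar>F_fun N a u - F_fun N a x\<bar>" by linarith
        also have "\<dots> \<le> e / 2 * \<bar>v - x\<bar> + e / 2 * \<bar>u - x\<bar>"
          using uv n0[OF that] by (intro add_mono rr') auto
        also have "\<bar>v - x\<bar> = v - x" using uv by simp
        also have "\<bar>u - x\<bar> = x - u" using uv by simp
        also have "e / 2 * (v - x) + e / 2 * (x - u) = e / 2 * (v - u)" by (simp only: distrib_left[symmetric]) simp
        finally have "sl n / real d ^ n \<le> e / 2 / real d ^ n"
          using YS(1) uv(3) d by (simp add: power_one_over)
        hence "sl n \<le> e / 2" using dn by (meson divide_le_cancel order_less_asym)
        thus ?thesis using slp[of n] \<open>e > 0\<close> by simp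
      qed
      thus "\<exists>no. \<forall>n\<ge>no. norm (sl n - 0) < e" by blast
    qed
  qed
  have bwd: "x \<in> D0 N a" if lim: "sl \<longlonglongrightarrow> 0"
  proof -
    define C where "C = (1 + a / b_par N a) * real d"
    have C: "C > 0" using b d unfolding C_def by (intro mult_pos_pos add_pos_pos) auto
    have "((\<lambda>y. (F_fun N a y - F_fun N a x) / (y - x)) \<longlongrightarrow> 0) (at x)"
    proof (rule tendstoI)
      fix e :: real assume "e > 0"
      hence "e / C > 0" using C by simp
      then obtain n0 where n0: "\<And>n. n \<ge> n0 \<Longrightarrow> sl n < e / C"
        using LIMSEQ_D[OF lim \<open>e / C > 0\<close>] slp by (auto simp: abs_of_pos)
      define r where "r = min (min x (1 - x)) ((1 / real d) ^ n0)"
      have r: "r > 0" using assms d by (auto simp: r_def)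
      have "\<bar>(F_fun N a y - F_fun N a x) / (y - x)\<bar> < e" if y: "y \<noteq> x" "\<bar>y - x\<bar> < r" for y
      proof -
        have y01: "0 \<le> y" "y < 1" using y by (auto simp: r_def)
        have yr: "0 < \<bar>y - x\<bar>" "\<bar>y - x\<bar> < 1" using y assms(4,5) y01 by auto
        have "real d > 1" using d by auto
        then obtain n where n: "real d ^ n * \<bar>y - x\<bar> \<le> 1" "1 < real d ^ Suc n * \<bar>y - x\<bar>"
          using ex_power_matching_scale[OF yr] by metis
        have "n \<ge> n0"
        proof (rule ccontr)
          assume "\<not> n \<ge> n0"
          hence "Suc n \<le> n0" by simp
          hence "real d ^ Suc n * \<bar>y - x\<bar> \<le> real d ^ n0 * \<bar>y - x\<bar>"
            using d by (intro mult_right_mono power_increasing) auto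
          also have "\<dots> \<le> real d ^ n0 * (1 / real d) ^ n0"
            using y by (intro mult_left_mono) (auto simp: r_def)
          also have "\<dots> = 1" using d by (simp add: power_one_over)
          finally show False using n by simp
        qed
        have dn: "real d ^ n > 0" using d by auto
        have "\<bar>F_fun N a y - F_fun N a x\<bar> \<le> (1 + a / b_par N a) * sl n / real d ^ n"
          using F_fun_diff_adjacent[OF assms(1-3), of x y n] assms y01 n d by (simp add: sl_def)
        also have "\<dots> = (1 + a / b_par N a) * sl n * (1 / real d ^ n)" by simp
        also have "\<dots> \<le> (1 + a / b_par N a) * sl n * (real d * \<bar>y - x\<bar>)"
          using n(2) dn slp[of n] b by (intro mult_left_mono) (auto simp: field_simps)
        also have "\<dots> = C * sl n * \<bar>y - x\<bar>" by (simp add: C_def)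
        finally have "\<bar>F_fun N a y - F_fun N a x\<bar> / \<bar>y - x\<bar> \<le> C * sl n" 
          using yr by (simp add: field_simps)
        also have "\<dots> < e" using n0[OF \<open>n \<ge> n0\<close>] C by (simp add: field_simps)
        finally show ?thesis by simp
      qed
      thus "\<forall>\<^sub>F y in at x. dist ((F_fun N a y - F_fun N a x) / (y - x)) 0 < e"
        unfolding eventually_at using r by (auto simp: dist_real_def)
    qed
    thus ?thesis using assms by (simp add: D0_def has_field_derivative_iff)
  qed
  show ?thesis using fwd bwd unfolding sl_def by blast
qed

section \<open>Hausdorff measure: upper bounds by coverings\<close>

lemma diameter_Icc_real: "u \<le> v \<Longrightarrow> diameter {u..v :: real} = v - u"
  using diameter_closed_interval by simp

lemma hausdorff_measure_eq_0I:
  fixes S :: "'a::metric_space set"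
  assumes "\<And>\<delta> \<epsilon>. \<delta> > 0 \<Longrightarrow> \<epsilon> > 0 \<Longrightarrow> \<exists>U :: nat \<Rightarrow> 'a set. S \<subseteq> (\<Union>i. U i) \<and> 
     (\<forall>i. bounded (U i) \<and> diameter (U i) \<le> \<delta>) \<and> (\<Sum>i. hausdorff_weight s (U i)) \<le> ennreal \<epsilon>"
  shows "hausdorff_measure s S = 0"
proof -
  have "hausdorff_premeasure s \<delta> S = 0" if "\<delta> > 0" for \<delta>
  proof -
    have "hausdorff_premeasure s \<delta> S \<le> 0 + ennreal \<epsilon>" if e: "\<epsilon> > 0" for \<epsilon>
    proof -
      obtain U :: "nat \<Rightarrow> 'a set" where U: "S \<subseteq> (\<Union>i. U i)" "\<forall>i. bounded (U i) \<and> diameter (U i) \<le> \<delta>"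
        "(\<Sum>i. hausdorff_weight s (U i)) \<le> ennreal \<epsilon>"
        using assms[OF \<open>\<delta> > 0\<close> e] by blast
      have "hausdorff_premeasure s \<delta> S \<le> (\<Sum>i. hausdorff_weight s (U i))"
        unfolding hausdorff_premeasure_def by (rule Inf_lower) (use U in blast)
      thus ?thesis using U(3) by simp
    qed
    hence "hausdorff_premeasure s \<delta> S \<le> 0" by (rule ennreal_le_epsilon)
    thus ?thesis by simp
  qed
  hence "hausdorff_measure s S \<le> 0" unfolding hausdorff_measure_def by (intro SUP_least) auto
  thus ?thesis by simp
qed

text \<open>An interval of order \<open>n\<close> is heavy if its mass is at least \<open>d\<^bsup>-nt\<^esup>\<close>. Every point of \<open>S\<close> lies in heavy
  intervals of arbitrarily large order. A heavy interval contributes \<open>d\<^bsup>-ns\<^esup>\<close>, at most its mass times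
  \<open>r\<^bsup>n\<^esup>\<close> with \<open>r = d\<^bsup>t-s\<^esup> < 1\<close>. As the masses of one order sum to \<open>1\<close>, all heavy intervals of order at
  least \<open>n0\<close> together contribute at most the geometric tail \<open>r\<^bsup>n0\<^esup> / (1 - r)\<close>.\<close>

lemma hausdorff_measure_eq_0_heavy_cylinders:
  fixes N :: nat and u v s t :: real and S :: "real set"
  assumes N: "N \<ge> 1" and "u \<ge> 0" "v \<ge> 0" "real N * u + (real N + 1) * v = 1" "0 < s" "t < s"
  assumes S: "\<And>x. x \<in> S \<Longrightarrow> 0 \<le> x \<and> x < 1"
  assumes freq: "\<And>x. x \<in> S \<Longrightarrow> \<exists>\<^sub>F n in sequentially. 
     (2 * real N + 1) powr (- real n * t) \<le> u ^ odd_count (2 * N + 1) x n * v ^ (n - odd_count (2 * N + 1) x n)"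
  shows "hausdorff_measure s S = 0"
proof (rule hausdorff_measure_eq_0I)
  fix \<delta> \<epsilon> :: real assume "\<delta> > 0" "\<epsilon> > 0"
  define d where "d = 2 * N + 1"
  have d: "real d = 2 * real N + 1" "real d > 1" "d > 0" using N by (auto simp: d_def)
  define mass where "mass n m = u ^ odd_digits d n m * v ^ (n - odd_digits d n m)" for n m
  have mass0: "mass n m \<ge> 0" for n m using assms by (simp add: mass_def)
  define heavy where "heavy n m \<longleftrightarrow> real d powr (- real n * t) \<le> mass n m" for n m
  define r where "r = real d powr (t - s)"
  have r: "0 < r" "r < 1" using d assms by (auto simp: r_def powr_less_one)
  obtain n0 where n0: "(1 / real d) ^ n0 \<le> \<delta>" "r ^ n0 / (1 - r) \<le> \<epsilon>"
  proof -
    have "(\<lambda>n. (1 / real d) ^ n) \<longlonglongrightarrow> 0" using d by (intro LIMSEQ_power_zero) auto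
    hence 1: "\<forall>\<^sub>F n in sequentially. (1 / real d) ^ n < \<delta>" using \<open>\<delta> > 0\<close> by (rule order_tendstoD)
    have "(\<lambda>n. r ^ n / (1 - r)) \<longlonglongrightarrow> 0 / (1 - r)" using r by (intro tendsto_divide LIMSEQ_power_zero tendsto_const) auto
    hence "(\<lambda>n. r ^ n / (1 - r)) \<longlonglongrightarrow> 0" by simp
    hence 2: "\<forall>\<^sub>F n in sequentially. r ^ n / (1 - r) < \<epsilon>" using \<open>\<epsilon> > 0\<close> by (rule order_tendstoD)
    have "\<forall>\<^sub>F n in sequentially. (1 / real d) ^ n < \<delta> \<and> r ^ n / (1 - r) < \<epsilon>"
      using 1 2 by eventually_elim auto
    then obtain n where "(1 / real d) ^ n < \<delta>" "r ^ n / (1 - r) < \<epsilon>" 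
      unfolding eventually_sequentially by auto
    thus ?thesis using that[of n] by auto
  qed
  define V where "V n m = (if n \<ge> n0 \<and> m < d ^ n \<and> heavy n m 
     then {real m / real d ^ n..(real m + 1) / real d ^ n} else {})" for n m
  define U where "U i = (case prod_decode i of (n, m) \<Rightarrow> V n m)" for i
  have diamV: "diameter (V n m) = (if V n m = {} then 0 else (1 / real d) ^ n)" for n m
  proof (cases "V n m = {}")
    case False
    hence "V n m = {real m / real d ^ n..(real m + 1) / real d ^ n}" by (auto simp: V_def split: if_splits)
    moreover have "diameter {real m / real d ^ n..(real m + 1) / real d ^ n} = (1 / real d) ^ n"
      using d by (subst diameter_Icc_real) (auto simp: divide_right_mono diff_divide_distrib[symmetric] power_one_over)
    ultimately show ?thesis using False by simp
  qed simp
  show "\<exists>U :: nat \<Rightarrow> real set. S \<subseteq> (\<Union>i. U i) \<and> 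
     (\<forall>i. bounded (U i) \<and> diameter (U i) \<le> \<delta>) \<and> (\<Sum>i. hausdorff_weight s (U i)) \<le> ennreal \<epsilon>"
  proof (rule exI[of _ U], intro conjI allI)
    show "S \<subseteq> (\<Union>i. U i)"
    proof
      fix x assume x: "x \<in> S"
      have "\<exists>\<^sub>F n in sequentially. real d powr (- real n * t) \<le> u ^ odd_count d x n * v ^ (n - odd_count d x n)"
        using freq[OF x, folded d_def, folded d(1)] .
      then obtain n where n: "n \<ge> n0" "real d powr (- real n * t) \<le> u ^ odd_count d x n * v ^ (n - odd_count d x n)"
        unfolding frequently_sequentially by meson
      define m where "m = prefix d n x"
      have x01: "0 \<le> x" "x < 1" using S[OF x] by auto
      have dn: "real d ^ n > 0" using d by auto
      have "m < d ^ n" unfolding m_def by (rule prefix_less[OF x01 d(3)])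
      moreover have "heavy n m" using n(2) by (simp add: heavy_def mass_def m_def odd_count_def)
      moreover have "real m / real d ^ n \<le> x" "x \<le> (real m + 1) / real d ^ n"
        using prefix_bounds[OF x01(1), of d n] dn 
        by (simp_all add: m_def pos_divide_le_eq pos_le_divide_eq mult.commute)
      ultimately have "x \<in> V n m" using n(1) by (simp add: V_def)
      hence "x \<in> U (prod_encode (n, m))" by (simp add: U_def)
      thus "x \<in> (\<Union>i. U i)" by blast
    qed
    show "bounded (U i)" for i by (auto simp: U_def V_def split: prod.splits)
    show "diameter (U i) \<le> \<delta>" for i
    proof -
      obtain n m where nm: "prod_decode i = (n, m)" by (cases "prod_decode i")
      have "diameter (V n m) \<le> \<delta>"
      proof (cases "V n m = {}")
        case False
        hence "n \<ge> n0" by (auto simp: V_def split: if_splits)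
        hence "(1 / real d) ^ n \<le> (1 / real d) ^ n0" using d by (intro power_decreasing) auto
        thus ?thesis using n0 False by (simp add: diamV)
      qed (use \<open>\<delta> > 0\<close> in \<open>simp add: diamV\<close>)
      thus ?thesis by (simp add: U_def nm)
    qed
    define f where "f = (\<lambda>(n, m). hausdorff_weight s (V n m))"
    define h where "h n = (if n \<ge> n0 then r ^ n else 0)" for n
    have wV: "hausdorff_weight s (V n m) \<le> ennreal (mass n m * h n)" for n m
    proof (cases "V n m = {}")
      case True
      thus ?thesis by (simp add: hausdorff_weight_def)
    next
      case False
      hence nm: "n \<ge> n0" "m < d ^ n" "heavy n m" by (auto simp: V_def split: if_splits)
      have "((1 / real d) ^ n) powr s = real d powr (- real n * s)"
        using d by (simp add: power_one_over powr_divide powr_realpow[symmetric] powr_powr powr_minus_divide)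
      also have "\<dots> = real d powr (- real n * t) * real d powr (real n * (t - s))"
        by (simp add: powr_add[symmetric] algebra_simps)
      also have "real d powr (real n * (t - s)) = r ^ n"
        using d by (simp add: r_def powr_powr powr_realpow[symmetric] mult.commute)
      also have "real d powr (- real n * t) * r ^ n \<le> mass n m * r ^ n"
        using nm r by (intro mult_right_mono) (auto simp: heavy_def)
      finally have "((1 / real d) ^ n) powr s \<le> mass n m * r ^ n" .
      thus ?thesis using False nm assms(5) by (simp add: hausdorff_weight_def diamV h_def ennreal_leI)
    qed
    have inner: "(\<Sum>m. f (n, m)) \<le> ennreal (h n)" for n
    proof -
      have h0: "h n \<ge> 0" using r by (simp add: h_def)
      have "(\<Sum>m. f (n, m)) = (\<Sum>m<d ^ n. f (n, m))"
        by (rule suminf_finite) (auto simp: f_def V_def hausdorff_weight_def)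
      also have "\<dots> \<le> (\<Sum>m<d ^ n. ennreal (mass n m * h n))"
        unfolding f_def prod.case by (intro sum_mono wV)
      also have "\<dots> = ennreal (\<Sum>m<d ^ n. mass n m * h n)"
        using mass0 h0 by (intro sum_ennreal) auto
      also have "(\<Sum>m<d ^ n. mass n m * h n) = (\<Sum>m<d ^ n. mass n m) * h n"
        by (simp add: sum_distrib_right)
      also have "(\<Sum>m<d ^ n. mass n m) = 1"
        unfolding mass_def d_def sum_cylinder_masses assms(4) by simp
      finally show ?thesis by simp
    qed
    have hs: "h sums (r ^ n0 / (1 - r))"
    proof -
      have "(\<lambda>n. r ^ n0 * r ^ n) sums (r ^ n0 * (1 / (1 - r)))"
        using r by (intro sums_mult geometric_sums) auto
      hence "(\<lambda>n. h (n + n0)) sums (r ^ n0 / (1 - r))" by (simp add: h_def power_add mult.commute)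
      moreover have "(\<Sum>i<n0. h i) = 0" by (intro sum.neutral) (auto simp: h_def)
      ultimately show ?thesis using sums_iff_shift'[of h n0 "r ^ n0 / (1 - r)"] by simp
    qed
    have "(\<Sum>i. hausdorff_weight s (U i)) = (\<Sum>i. f (prod_decode i))"
      by (simp add: f_def U_def split_beta)
    also have "\<dots> = (\<Sum>n. \<Sum>m. f (n, m))"
      by (rule suminf_ennreal_2dimen) simp
    also have "\<dots> \<le> (\<Sum>n. ennreal (h n))"
      by (intro suminf_le inner) auto
    also have "\<dots> = ennreal (r ^ n0 / (1 - r))"
      using hs r by (subst suminf_ennreal2) (auto simp: sums_iff h_def)
    also have "\<dots> \<le> ennreal \<epsilon>" using n0 by (intro ennreal_leI)
    finally show "(\<Sum>i. hausdorff_weight s (U i)) \<le> ennreal \<epsilon>" .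
  qed
qed

section \<open>Hausdorff measure: lower bounds by self-similar digit sets\<close>

text \<open>The separation hypothesis is Hoelder continuity of the inverse of \<open>\<gamma>\<close>, with any exponent \<open>s\<close> such that
  \<open>D\<^bsup>s\<^esup> \<le> M\<close>, expressed on the scales \<open>D\<^bsup>-k\<^esup>\<close>. The constant \<open>4 D\<^bsup>s\<^esup>\<close> accounts for
  the two sides of the interval, the \<open>2\<close> in the hypothesis, and the rounding of the diameter to a scale.\<close>

lemma Hoelder_preimage_in_interval:
  fixes \<gamma> :: "real \<Rightarrow> real" and D M s :: real and U :: "real set"
  assumes D: "D > 1" and s: "s \<ge> 0" and DM: "D powr s \<le> M"
    and sep: "\<And>k t t'. t \<in> {0..<1} \<Longrightarrow> t' \<in> {0..<1} \<Longrightarrow> D ^ k * \<bar>\<gamma> t - \<gamma> t'\<bar> \<le> 1 \<Longrightarrow> \<bar>t - t'\<bar> \<le> 2 / M ^ k"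
    and U: "bounded U" "diameter U \<le> 1 / 2"
  obtains c r where "r \<ge> 0" "{t \<in> {0..<1}. \<gamma> t \<in> U} \<subseteq> {c - r..c + r}" 
    "ennreal (2 * r) \<le> ennreal (4 * D powr s) * hausdorff_weight s U"
proof (cases "{t \<in> {0..<1}. \<gamma> t \<in> U} = {}")
  case True
  show ?thesis
  proof (rule that[of 0 0])
    show "{t \<in> {0..<1}. \<gamma> t \<in> U} \<subseteq> {0 - 0..0 + 0}" unfolding True by simp
  qed simp_all
next
  case False
  then obtain c where c: "c \<in> {0..<1}" "\<gamma> c \<in> U" by blast
  hence Un: "U \<noteq> {}" by blast
  have Ds: "D powr s \<ge> 1" using D s by (intro ge_one_powr_ge_zero) auto
  define \<rho> where "\<rho> = diameter U"
  have \<rho>0: "\<rho> \<ge> 0" unfolding \<rho>_def using diameter_ge_0[OF U(1)] .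
  have close: "\<bar>\<gamma> t - \<gamma> c\<bar> \<le> \<rho>" if "\<gamma> t \<in> U" for t
    using diameter_bounded_bound[OF U(1) that c(2)] by (simp add: dist_real_def \<rho>_def)
  consider "s = 0" | "s > 0" "\<rho> = 0" | "s > 0" "\<rho> > 0" using s \<rho>0 by linarith
  thus ?thesis
  proof cases
    case 1
    show ?thesis
    proof (rule that[of 1 c])
      show "{t \<in> {0..<1}. \<gamma> t \<in> U} \<subseteq> {c - 1..c + 1}" using c by auto
      show "ennreal (2 * 1) \<le> ennreal (4 * D powr s) * hausdorff_weight s U"
        using 1 Un D by (simp add: hausdorff_weight_def)
    qed simp
  next
    case 2
    have "M > 1" using 2 D DM by (smt (verit) gr_one_powr)
    show ?thesis
    proof (rule that[of 0 c])
      show "{t \<in> {0..<1}. \<gamma> t \<in> U} \<subseteq> {c - 0..c + 0}"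
      proof
        fix t assume t: "t \<in> {t \<in> {0..<1}. \<gamma> t \<in> U}"
        hence "\<gamma> t = \<gamma> c" using close[of t] 2 by auto
        hence "\<bar>t - c\<bar> \<le> 2 / M ^ k" for k using sep[of t c k] t c by simp
        moreover have "(\<lambda>k. 2 * (1 / M) ^ k) \<longlonglongrightarrow> 2 * 0" 
          using \<open>M > 1\<close> by (intro tendsto_intros LIMSEQ_power_zero) auto
        hence "(\<lambda>k. 2 / M ^ k) \<longlonglongrightarrow> 0" by (simp add: power_one_over)
        ultimately have "\<bar>t - c\<bar> \<le> 0" by (intro LIMSEQ_le_const) auto
        thus "t \<in> {c - 0..c + 0}" by simp
      qed
    qed simp_all
  next
    case 3
    have "\<rho> < 1" using U(2) by (simp add: \<rho>_def)
    then obtain k where k: "D ^ k * \<rho> \<le> 1" "1 < D ^ Suc k * \<rho>"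
      using ex_power_matching_scale[OF 3(2) _ D] by metis
    have M: "M \<ge> 1" using DM Ds by linarith
    show ?thesis
    proof (rule that[of "2 / M ^ k" c])
      show "2 / M ^ k \<ge> 0" using M by simp
      show "{t \<in> {0..<1}. \<gamma> t \<in> U} \<subseteq> {c - 2 / M ^ k..c + 2 / M ^ k}"
      proof
        fix t assume t: "t \<in> {t \<in> {0..<1}. \<gamma> t \<in> U}"
        have "D ^ k * \<bar>\<gamma> t - \<gamma> c\<bar> \<le> D ^ k * \<rho>" using close[of t] t D by (intro mult_left_mono) auto
        hence "\<bar>t - c\<bar> \<le> 2 / M ^ k" using k t c by (intro sep) auto
        thus "t \<in> {c - 2 / M ^ k..c + 2 / M ^ k}" by auto
      qed
      have "D ^ k > 0" using D by simp
      have "1 / D ^ k \<le> D * \<rho>" using k(2) D by (simp add: field_simps)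
      hence "(1 / D ^ k) powr s \<le> (D * \<rho>) powr s" using s D by (intro powr_mono2) auto
      also have "\<dots> = D powr s * \<rho> powr s" using D 3 by (intro powr_mult) 
      finally have *: "(1 / D ^ k) powr s \<le> D powr s * \<rho> powr s" .
      have "(D ^ k) powr s = (D powr s) ^ k"
        using D by (simp add: powr_realpow[symmetric] powr_powr mult.commute powr_power)
      also have "\<dots> \<le> M ^ k" using DM by (intro power_mono) auto
      finally have "1 / M ^ k \<le> 1 / (D ^ k) powr s" using M D by (intro divide_left_mono mult_pos_pos) auto
      also have "\<dots> = (1 / D ^ k) powr s" using D by (simp add: powr_divide)
      also note *
      finally have "2 * (2 / M ^ k) \<le> 4 * D powr s * \<rho> powr s" by simp
      hence "ennreal (2 * (2 / M ^ k)) \<le> ennreal (4 * D powr s * \<rho> powr s)" by (rule ennreal_leI)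
      also have "\<dots> = ennreal (4 * D powr s) * ennreal (\<rho> powr s)" by (rule ennreal_mult) auto
      finally show "ennreal (2 * (2 / M ^ k)) \<le> ennreal (4 * D powr s) * hausdorff_weight s U"
        using 3 Un by (simp add: hausdorff_weight_def \<rho>_def)
    qed
  qed
qed

text \<open>A covering of \<open>S\<close> pulls back along \<open>\<gamma>\<close> to a covering of \<open>[0, 1)\<close> by sets inside intervals of length at
  most a constant times the weights, and the lengths of these intervals add up to at least \<open>1\<close>.\<close>

lemma hausdorff_measure_nonzero_if_Hoelder_inverse:
  fixes \<gamma> :: "real \<Rightarrow> real" and D M s :: real and S :: "real set"
  assumes D: "D > 1" and s: "s \<ge> 0" and DM: "D powr s \<le> M"
    and sep: "\<And>k t t'. t \<in> {0..<1} \<Longrightarrow> t' \<in> {0..<1} \<Longrightarrow> D ^ k * \<bar>\<gamma> t - \<gamma> t'\<bar> \<le> 1 \<Longrightarrow> \<bar>t - t'\<bar> \<le> 2 / M ^ k"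
    and S: "\<And>t. t \<in> {0..<1} \<Longrightarrow> \<gamma> t \<in> S"
  shows "hausdorff_measure s S \<noteq> 0"
proof -
  define C where "C = 4 * D powr s"
  have C: "C > 0" using D by (simp add: C_def)
  have "ennreal (1 / C) \<le> hausdorff_premeasure s (1/2) S"
    unfolding hausdorff_premeasure_def
  proof (rule Inf_greatest, clarify)
    fix U :: "nat \<Rightarrow> real set"
    assume U: "S \<subseteq> (\<Union>i. U i)" "\<forall>i. bounded (U i) \<and> diameter (U i) \<le> 1 / 2"
    define P where "P i c r \<longleftrightarrow> r \<ge> 0 \<and> {t \<in> {0..<1}. \<gamma> t \<in> U i} \<subseteq> {c - r..c + r} \<and>
      ennreal (2 * r) \<le> ennreal C * hausdorff_weight s (U i)" for i c r
    have "\<exists>c r. P i c r" for i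
    proof -
      have Ui: "bounded (U i)" "diameter (U i) \<le> 1 / 2" using U(2) by auto
      show ?thesis
      proof (rule Hoelder_preimage_in_interval[where \<gamma> = \<gamma> and U = "U i", OF D s DM _ Ui])
        show "\<bar>t - t'\<bar> \<le> 2 / M ^ k" if "t \<in> {0..<1}" "t' \<in> {0..<1}" "D ^ k * \<bar>\<gamma> t - \<gamma> t'\<bar> \<le> 1" for t t' k
          using sep that by blast
        show "\<exists>c r. P i c r" if "0 \<le> r" "{t \<in> {0..<1}. \<gamma> t \<in> U i} \<subseteq> {c - r..c + r}"
            "ennreal (2 * r) \<le> ennreal (4 * D powr s) * hausdorff_weight s (U i)" for c r
          using that unfolding P_def C_def by blast
      qed
    qed
    then obtain c r where "\<And>i. P i (c i) (r i)" by metis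
    hence cr: "\<And>i. r i \<ge> 0" "\<And>i. {t \<in> {0..<1}. \<gamma> t \<in> U i} \<subseteq> {c i - r i..c i + r i}"
      "\<And>i. ennreal (2 * r i) \<le> ennreal C * hausdorff_weight s (U i)"
      unfolding P_def by blast+
    \<comment> \<open>The intervals around the preimages cover \<open>[0, 1)\<close>.\<close>
    have "1 = emeasure lborel {0..<1::real}" by simp
    also have "\<dots> \<le> emeasure lborel (\<Union>i. {c i - r i..c i + r i})"
    proof (rule emeasure_mono)
      show "{0..<1} \<subseteq> (\<Union>i. {c i - r i..c i + r i})"
      proof
        fix t :: real assume t: "t \<in> {0..<1}"
        then obtain i where "\<gamma> t \<in> U i" using S U(1) by blast
        thus "t \<in> (\<Union>i. {c i - r i..c i + r i})" using cr(2)[of i] t by blast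
      qed
    qed auto
    also have "\<dots> \<le> (\<Sum>i. emeasure lborel {c i - r i..c i + r i})"
      by (rule emeasure_subadditive_countably) auto
    also have "\<dots> \<le> (\<Sum>i. ennreal C * hausdorff_weight s (U i))"
      using cr(1,3) by (intro suminf_le) auto
    also have "\<dots> = ennreal C * (\<Sum>i. hausdorff_weight s (U i))"
      by (rule ennreal_suminf_cmult)
    finally have "ennreal (1 / C) * 1 \<le> ennreal (1 / C) * (ennreal C * (\<Sum>i. hausdorff_weight s (U i)))"
      by (intro mult_left_mono) auto
    also have "\<dots> = (\<Sum>i. hausdorff_weight s (U i))"
      using C by (simp add: mult.assoc[symmetric] ennreal_mult[symmetric])
    finally show "ennreal (1 / C) \<le> (\<Sum>i. hausdorff_weight s (U i))" by simp
  qed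
  also have "\<dots> \<le> hausdorff_measure s S"
    unfolding hausdorff_measure_def by (rule SUP_upper) simp
  finally have "ennreal (1 / C) \<le> hausdorff_measure s S" .
  moreover have "ennreal (1 / C) > 0" using C by simp
  ultimately show ?thesis by auto
qed

lemma odd_digits_append:
  assumes "e < d ^ L"
  shows "odd_digits d (n + L) (x * d ^ L + e) = odd_digits d n x + odd_digits d L e"
  using assms
proof (induction L arbitrary: e)
  case (Suc L)
  have d: "d > 0" using Suc.prems by (cases "d = 0") auto
  have "e div d < d ^ L" using Suc.prems by (simp add: less_mult_imp_div_less mult.commute)
  moreover have "(x * d ^ Suc L + e) div d = x * d ^ L + e div d"
  proof -
    have "x * d ^ Suc L + e = e + (x * d ^ L) * d" by simp
    thus ?thesis using d by (simp only: div_mult_self1 neq0_conv)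
  qed
  moreover have "(x * d ^ Suc L + e) mod d = e mod d"
  proof -
    have "x * d ^ Suc L + e = e + (x * d ^ L) * d" by simp
    thus ?thesis by (simp only: mod_mult_self1)
  qed
  ultimately show ?case using Suc.IH[of "e div d"]
    by (simp only: add_Suc_right odd_digits.simps add.assoc)
qed simp

text \<open>The lowest \<open>k\<close> base-\<open>M\<close> digits of \<open>m\<close> are replaced, via \<open>e\<close>, by base-\<open>D\<close> digits. For \<open>k = 0\<close> the value is
  \<open>m\<close> and not \<open>0\<close>; this keeps the code strictly increasing on all of \<open>nat\<close>, also across multiples of \<open>M\<^bsup>k\<^esup>\<close>,
  while for \<open>m < M\<^bsup>k\<^esup>\<close> the recursion ends in the value \<open>0\<close>.\<close>

primrec block_code :: "nat \<Rightarrow> nat \<Rightarrow> (nat \<Rightarrow> nat) \<Rightarrow> nat \<Rightarrow> nat \<Rightarrow> nat" where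
  "block_code D M e 0 m = m"
| "block_code D M e (Suc k) m = D * block_code D M e k (m div M) + e (m mod M)"

lemma block_code_strict_mono:
  assumes "M > 0" "strict_mono_on {..<M} e" "\<And>i. i < M \<Longrightarrow> e i < D" "m < m'"
  shows "block_code D M e k m < block_code D M e k m'"
  using assms(4)
proof (induction k arbitrary: m m')
  case (Suc k)
  show ?case
  proof (cases "m div M = m' div M")
    case True
    have "m mod M < m' mod M" using Suc.prems True by (metis add_less_cancel_left div_mult_mod_eq)
    hence "e (m mod M) < e (m' mod M)" using assms(1,2) by (auto simp: strict_mono_on_def)
    thus ?thesis using True by simp
  next
    case False
    have "m div M < m' div M" using False div_le_mono[of m m' M] Suc.prems by auto
    hence "block_code D M e k (m div M) + 1 \<le> block_code D M e k (m' div M)" using Suc.IH by fastforce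
    hence "D * (block_code D M e k (m div M) + 1) \<le> D * block_code D M e k (m' div M)" by (rule mult_left_mono) simp
    moreover have "e (m mod M) < D" using assms by simp
    ultimately show ?thesis by simp
  qed
qed simp

lemma block_code_odd_digits:
  assumes "M > 0" "\<And>i. i < M \<Longrightarrow> e i < d ^ L" "\<And>i. i < M \<Longrightarrow> odd_digits d L (e i) = K"
  shows "odd_digits d (L * k) (block_code (d ^ L) M e k m) = K * k"
proof (induction k arbitrary: m)
  case (Suc k)
  have "odd_digits d (L * k + L) (block_code (d ^ L) M e k (m div M) * d ^ L + e (m mod M)) = K * k + K"
    using assms by (subst odd_digits_append) (auto simp: Suc.IH)
  thus ?case by (simp add: mult.commute add.commute)
qed simp

text \<open>The point \<open>\<gamma> t\<close> has the base-\<open>D\<close> digits \<open>e\<close> applied to the base-\<open>M\<close> digits of \<open>t\<close>. Since \<open>e\<close> avoids the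
  largest digit \<open>D - 1\<close>, the expansion never ends in \<open>D - 1\<close> repeated, so these are the digits found by
  \<open>prefix\<close>. If \<open>\<gamma> t\<close> and \<open>\<gamma> t'\<close> are within \<open>D\<^bsup>-k\<^esup>\<close>, their codes of length \<open>k\<close> are equal or consecutive
  integers; the code being strictly increasing, the prefixes of \<open>t\<close> and \<open>t'\<close> then differ by at most one.\<close>

lemma block_curve:
  assumes M: "M > 0" and mono: "strict_mono_on {..<M} e" and e: "\<And>i. i < M \<Longrightarrow> 0 < e i \<and> e i + 1 < D"
  obtains \<gamma> :: "real \<Rightarrow> real" where
    "\<And>t. t \<in> {0..<1} \<Longrightarrow> 0 < \<gamma> t \<and> \<gamma> t < 1"
    "\<And>t k. t \<in> {0..<1} \<Longrightarrow> prefix D k (\<gamma> t) = block_code D M e k (prefix M k t)"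
    "\<And>k t t'. t \<in> {0..<1} \<Longrightarrow> t' \<in> {0..<1} \<Longrightarrow> real D ^ k * \<bar>\<gamma> t - \<gamma> t'\<bar> \<le> 1 \<Longrightarrow> \<bar>t - t'\<bar> \<le> 2 / real M ^ k"
proof -
  have D: "D > 1" using e[of 0] M by auto
  have eD: "i < M \<Longrightarrow> e i < D" for i using e[of i] by simp
  define G where "G t k = real (block_code D M e k (prefix M k t)) / real D ^ k" for t k
  define H where "H t k = G t k + 1 / real D ^ k" for t k
  have step: "G t (Suc k) = G t k + real (e (prefix M (Suc k) t mod M)) / real D ^ Suc k" if "t \<in> {0..<1}" for t k
    using that D prefix_Suc_div[of t M k] M by (simp add: G_def field_simps)
  have Dk: "real D ^ k > 0" for k using D by simp
  have G_inc: "G t k \<le> G t (Suc k)" and H_dec: "H t (Suc k) < H t k" if t: "t \<in> {0..<1}" for t k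
  proof -
    define i where "i = prefix M (Suc k) t mod M"
    have i: "i < M" using M by (simp add: i_def)
    show "G t k \<le> G t (Suc k)" using step[OF t, of k] by simp
    have "real (e i) + 1 < real D" using e[OF i] by linarith
    hence "(real (e i) + 1) / real D ^ Suc k < real D / real D ^ Suc k"
      using D by (intro divide_strict_right_mono) auto
    also have "\<dots> = 1 / real D ^ k" using D by simp
    finally show "H t (Suc k) < H t k" unfolding H_def step[OF t] i_def[symmetric] by (simp add: add_divide_distrib)
  qed
  define \<gamma> where "\<gamma> t = (SUP k. G t k)" for t
  have GH: "G t j \<le> H t k" if t: "t \<in> {0..<1}" for t j k
  proof -
    have "incseq (G t)" using G_inc[OF t] by (rule incseq_SucI)
    moreover have "decseq (H t)" using H_dec[OF t] by (intro decseq_SucI) (rule less_imp_le)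
    ultimately have "G t j \<le> G t (max j k)" "H t (max j k) \<le> H t k"
      by (auto simp: incseq_def decseq_def)
    moreover have "G t (max j k) \<le> H t (max j k)" using Dk[of "max j k"] by (simp add: H_def)
    ultimately show ?thesis by linarith
  qed
  have G_le: "G t k \<le> \<gamma> t" if t: "t \<in> {0..<1}" for t k
    unfolding \<gamma>_def by (rule cSUP_upper) (auto intro!: bdd_aboveI[of _ "H t 0"] GH[OF t])
  have less_H: "\<gamma> t < H t k" if t: "t \<in> {0..<1}" for t k
  proof -
    have "\<gamma> t \<le> H t (Suc k)" unfolding \<gamma>_def by (rule cSUP_least) (auto intro: GH[OF t])
    thus ?thesis using H_dec[OF t, of k] by simp
  qed
  have pre: "prefix D k (\<gamma> t) = block_code D M e k (prefix M k t)" if t: "t \<in> {0..<1}" for t k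
  proof (rule prefix_eqI)
    show "real (block_code D M e k (prefix M k t)) \<le> real D ^ k * \<gamma> t"
      using G_le[OF t, of k] Dk[of k] by (simp add: G_def pos_divide_le_eq mult.commute)
    have "\<gamma> t < (real (block_code D M e k (prefix M k t)) + 1) / real D ^ k"
      using less_H[OF t, of k] by (simp add: H_def G_def add_divide_distrib)
    thus "real D ^ k * \<gamma> t < real (block_code D M e k (prefix M k t)) + 1"
      using Dk[of k] by (simp add: pos_less_divide_eq mult.commute)
  qed
  have pos: "0 < \<gamma> t \<and> \<gamma> t < 1" if t: "t \<in> {0..<1}" for t
  proof
    have p0: "prefix M 0 t = 0" using t prefix_less[of t M 0] M by simp
    have "G t 1 = real (e (prefix M (Suc 0) t mod M)) / real D" using step[OF t, of 0] by (simp add: G_def p0)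
    also have "\<dots> > 0" using e[of "prefix M (Suc 0) t mod M"] M D by simp
    finally show "0 < \<gamma> t" using G_le[OF t, of 1] by linarith
    show "\<gamma> t < 1" using less_H[OF t, of 0] by (simp add: H_def G_def p0)
  qed
  have sep: "\<bar>t - t'\<bar> \<le> 2 / real M ^ k" if t: "t \<in> {0..<1}" "t' \<in> {0..<1}" and c: "real D ^ k * \<bar>\<gamma> t - \<gamma> t'\<bar> \<le> 1" for k t t'
  proof -
    define m m' where "m = prefix M k t" and "m' = prefix M k t'"
    define B where "B = block_code D M e k"
    have mono_B: "B x < B y" if "x < y" for x y
      unfolding B_def using block_code_strict_mono[OF M mono eD that] .
    have g: "real (B m) \<le> real D ^ k * \<gamma> t" "real D ^ k * \<gamma> t < real (B m) + 1"
      using prefix_bounds[of "\<gamma> t" D k] pre[OF t(1), of k] pos[OF t(1)] by (auto simp: B_def m_def)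
    have g': "real (B m') \<le> real D ^ k * \<gamma> t'" "real D ^ k * \<gamma> t' < real (B m') + 1"
      using prefix_bounds[of "\<gamma> t'" D k] pre[OF t(2), of k] pos[OF t(2)] by (auto simp: B_def m'_def)
    have "\<bar>real D ^ k * \<gamma> t - real D ^ k * \<gamma> t'\<bar> \<le> 1"
      using c Dk[of k] by (simp add: right_diff_distrib[symmetric] abs_mult)
    hence BB: "\<bar>real (B m) - real (B m')\<bar> < 2" using g g' by linarith
    have "m' \<le> m + 1"
    proof (rule ccontr)
      assume "\<not> m' \<le> m + 1"
      hence "B m < B (m + 1)" "B (m + 1) < B m'" by (auto intro: mono_B)
      thus False using BB by linarith
    qed
    moreover have "m \<le> m' + 1"
    proof (rule ccontr)
      assume "\<not> m \<le> m' + 1"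
      hence "B m' < B (m' + 1)" "B (m' + 1) < B m" by (auto intro: mono_B)
      thus False using BB by linarith
    qed
    moreover have "real m \<le> real M ^ k * t" "real M ^ k * t < real m + 1"
      "real m' \<le> real M ^ k * t'" "real M ^ k * t' < real m' + 1"
      using prefix_bounds[of t M k] prefix_bounds[of t' M k] t by (auto simp: m_def m'_def)
    ultimately have "\<bar>real M ^ k * t - real M ^ k * t'\<bar> \<le> 2" by linarith
    hence "real M ^ k * \<bar>t - t'\<bar> \<le> 2" using M by (simp add: right_diff_distrib[symmetric] abs_mult)
    thus ?thesis using M by (simp add: pos_le_divide_eq mult.commute)
  qed
  show ?thesis by (rule that[OF pos pre sep])
qed

lemma odd_count_mono:
  assumes "x \<ge> 0" "d > 0" "n \<le> n'"
  shows "odd_count d x n \<le> odd_count d x n'"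
  using assms(3)
proof (induction n' rule: dec_induct)
  case (step n')
  thus ?case by (simp add: odd_count_Suc[OF assms(1,2)])
qed simp

text \<open>The set \<open>E\<close> of admissible blocks contains neither the block of zeros nor the block of digits \<open>d - 1\<close>,
  since both consist of even digits and \<open>K > 0\<close>; hence \<open>block_curve\<close> applies with \<open>D = d\<^bsup>L\<^esup>\<close>. At the end of
  each block the number of odd digits is exactly proportional to the position, and in between it is off
  by at most \<open>K\<close>.\<close>

lemma hausdorff_measure_block_set_nonzero:
  fixes S :: "real set"
  assumes d: "odd d" and KL: "0 < K" "K \<le> L" and s: "s \<ge> 0"
    and M: "real (d ^ L) powr s \<le> real (card {m. m < d ^ L \<and> odd_digits d L m = K})"
    and S: "\<And>x. 0 < x \<Longrightarrow> x < 1 \<Longrightarrow> (\<And>n. \<bar>real (odd_count d x n) - real n * (real K / real L)\<bar> \<le> real K) \<Longrightarrow> x \<in> S"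
  shows "hausdorff_measure s S \<noteq> 0"
proof -
  define E where "E = {m. m < d ^ L \<and> odd_digits d L m = K}"
  define M where "M = card E"
  have d0: "d > 0" using d by (auto intro: Nat.gr0I)
  have "finite E" by (simp add: E_def)
  then obtain e where e: "bij_betw e {..<M} E" "strict_mono_on {..<M} e"
    unfolding M_def using ex_bij_betw_strict_mono_card by blast
  have "0 < real (d ^ L) powr s" using d0 by simp
  also note M
  finally have M0: "M > 0" by (simp add: M_def E_def)
  have eE: "e i \<in> E" if "i < M" for i using e(1) that by (auto simp: bij_betw_def)
  have od0: "odd_digits d n 0 = 0" for n by (induction n) auto
  have od_max: "odd_digits d n (d ^ n - 1) = 0" for n
  proof (induction n)
    case (Suc n)
    have "d ^ Suc n - 1 = (d - 1) + (d ^ n - 1) * d"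
      using d0 by (simp add: algebra_simps diff_mult_distrib)
    moreover have "(f + c * d) div d = c \<and> (f + c * d) mod d = f" if "f < d" for f c
      using that by simp
    ultimately have "(d ^ Suc n - 1) div d = d ^ n - 1" "(d ^ Suc n - 1) mod d = d - 1"
      using d0 by (metis diff_less zero_less_one)+
    thus ?case using Suc d by (simp del: power_Suc)
  qed simp
  have ebounds: "0 < e i \<and> e i + 1 < d ^ L" if "i < M" for i
  proof -
    have "odd_digits d L (e i) = K" "e i < d ^ L" using eE[OF that] by (auto simp: E_def)
    moreover have "e i \<noteq> 0"
    proof
      assume "e i = 0"
      thus False using calculation(1) KL(1) od0[of L] by simp
    qed
    moreover have "e i \<noteq> d ^ L - 1"
    proof
      assume *: "e i = d ^ L - 1"
      show False using calculation(1) KL(1) od_max[of L] unfolding * by simp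
    qed
    ultimately show ?thesis by linarith
  qed
  obtain \<gamma> :: "real \<Rightarrow> real" where \<gamma>:
    "\<And>t. t \<in> {0..<1} \<Longrightarrow> 0 < \<gamma> t \<and> \<gamma> t < 1"
    "\<And>t k. t \<in> {0..<1} \<Longrightarrow> prefix (d ^ L) k (\<gamma> t) = block_code (d ^ L) M e k (prefix M k t)"
    "\<And>k t t'. t \<in> {0..<1} \<Longrightarrow> t' \<in> {0..<1} \<Longrightarrow> real (d ^ L) ^ k * \<bar>\<gamma> t - \<gamma> t'\<bar> \<le> 1 \<Longrightarrow> \<bar>t - t'\<bar> \<le> 2 / real M ^ k"
    using block_curve[OF M0 e(2) ebounds] by metis
  have D1: "real (d ^ L) > 1" using ebounds[OF M0] by linarith
  show ?thesis
  proof (rule hausdorff_measure_nonzero_if_Hoelder_inverse[OF D1 s _ \<gamma>(3)])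
    show "real (d ^ L) powr s \<le> real M" using M by (simp add: M_def E_def)
    fix t :: real assume t: "t \<in> {0..<1}"
    show "\<gamma> t \<in> S"
    proof (rule S)
      show g01: "0 < \<gamma> t" "\<gamma> t < 1" using \<gamma>(1)[OF t] by auto
      have blk: "odd_count d (\<gamma> t) (L * k) = K * k" for k
      proof -
        have "prefix d (L * k) (\<gamma> t) = prefix (d ^ L) k (\<gamma> t)"
          by (simp add: prefix_def power_mult)
        thus ?thesis unfolding odd_count_def using \<gamma>(2)[OF t] eE
          by (simp add: block_code_odd_digits[OF M0] E_def)
      qed
      fix n
      define q where "q = n div L"
      have L0: "L > 0" using KL by simp
      have n: "L * q \<le> n" "n \<le> L * (q + 1)"
        unfolding q_def using dividend_less_div_times[OF L0, of n] by (auto simp: algebra_simps)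
      have "K * q \<le> odd_count d (\<gamma> t) n" "odd_count d (\<gamma> t) n \<le> K * (q + 1)"
        using odd_count_mono[OF _ d0 n(1), of "\<gamma> t"] odd_count_mono[OF _ d0 n(2), of "\<gamma> t"] g01
        unfolding blk by auto
      hence c: "real K * real q \<le> real (odd_count d (\<gamma> t) n)" "real (odd_count d (\<gamma> t) n) \<le> real K * real q + real K"
        by (simp_all flip: of_nat_mult of_nat_add)
      have "real L * real q \<le> real n" "real n \<le> real L * real q + real L"
        using n by (simp_all flip: of_nat_mult of_nat_add)
      hence "real L * real q * (real K / real L) \<le> real n * (real K / real L)"
         "real n * (real K / real L) \<le> (real L * real q + real L) * (real K / real L)"
        by (blast intro: mult_right_mono divide_nonneg_nonneg of_nat_0_le_iff)+
      moreover have "real L * real q * (real K / real L) = real K * real q" 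
        "(real L * real q + real L) * (real K / real L) = real K * real q + real K"
        using L0 by (simp_all add: field_simps)
      ultimately show "\<bar>real (odd_count d (\<gamma> t) n) - real n * (real K / real L)\<bar> \<le> real K"
        using c by linarith
    qed
  qed
qed

section \<open>Entropy, slopes and thresholds\<close>

text \<open>The entropy of the law of a digit that is odd with probability \<open>p\<close> and uniformly distributed within each
  parity; it is \<open>h_fun\<close> freed from its normalization.\<close>

definition entropy :: "nat \<Rightarrow> real \<Rightarrow> real" where
  "entropy N p = - (p * ln (p / real N) + (1 - p) * ln ((1 - p) / (real N + 1)))"

lemma h_fun_eq_entropy: "h_fun N p = entropy N p / ln (2 * real N + 1)"
proof -
  have "- (1 / L) * X = - X / L" for X L :: real by simp
  thus ?thesis unfolding h_fun_def entropy_def .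
qed

text \<open>Gibbs' inequality, from \<open>ln y \<le> y - 1\<close>. Equality holds for \<open>u = p/N\<close> and \<open>v = (1-p)/(N+1)\<close>, so the
  entropy is an infimum of affine functions of \<open>p\<close>.\<close>

lemma entropy_le:
  assumes "N \<ge> 1" "0 < p" "p < 1" "u > 0" "v > 0" "real N * u + (real N + 1) * v = 1"
  shows "entropy N p \<le> - p * ln u - (1 - p) * ln v"
proof -
  have "p * ln (real N * u / p) \<le> p * (real N * u / p - 1)"
    using assms by (intro mult_left_mono ln_le_minus_one) auto
  moreover have "(1 - p) * ln ((real N + 1) * v / (1 - p)) \<le> (1 - p) * ((real N + 1) * v / (1 - p) - 1)"
    using assms by (intro mult_left_mono ln_le_minus_one) auto
  moreover have "p * (real N * u / p - 1) + (1 - p) * ((real N + 1) * v / (1 - p) - 1) = 0"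
  proof -
    have "p * (real N * u / p - 1) = real N * u - p" 
      "(1 - p) * ((real N + 1) * v / (1 - p) - 1) = (real N + 1) * v - (1 - p)"
      using assms by (simp_all add: right_diff_distrib)
    thus ?thesis using assms(6) by simp
  qed
  moreover have "ln (real N * u / p) = ln u - ln (p / real N)"
    "ln ((real N + 1) * v / (1 - p)) = ln v - ln ((1 - p) / (real N + 1))"
    using assms by (simp_all add: ln_div ln_mult)
  ultimately have "p * (ln u - ln (p / real N)) + (1 - p) * (ln v - ln ((1 - p) / (real N + 1))) \<le> 0"
    by (simp only:)
  thus ?thesis unfolding entropy_def by (simp only: right_diff_distrib)
qed

lemma entropy_le_ln_base:
  assumes "N \<ge> 1" "0 < p" "p < 1"
  shows "entropy N p \<le> ln (2 * real N + 1)"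
proof -
  have "entropy N p \<le> - p * ln (1 / (2 * real N + 1)) - (1 - p) * ln (1 / (2 * real N + 1))"
  proof (rule entropy_le[OF assms])
    have "real N * (1 / D) + (real N + 1) * (1 / D) = (2 * real N + 1) / D" for D :: real
      by (simp add: add_divide_distrib[symmetric])
    thus "real N * (1 / (2 * real N + 1)) + (real N + 1) * (1 / (2 * real N + 1)) = 1"
      by (simp add: add_nonneg_eq_0_iff)
  qed auto
  thus ?thesis using assms by (simp add: ln_div algebra_simps)
qed

lemma entropy_pos:
  assumes "N \<ge> 1" "0 < p" "p < 1"
  shows "entropy N p > 0"
proof -
  have "p * ln (p / real N) < 0" "(1 - p) * ln ((1 - p) / (real N + 1)) < 0"
    using assms by (auto intro!: mult_pos_neg ln_less_zero simp: field_simps)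
  thus ?thesis by (simp add: entropy_def)
qed

definition up_slope :: "nat \<Rightarrow> real \<Rightarrow> real" where
  "up_slope N a = (2 * real N + 1) * a"

definition down_slope :: "nat \<Rightarrow> real \<Rightarrow> real" where
  "down_slope N a = (2 * real N + 1) * b_par N a"

lemma slope_relation:
  "N \<ge> 1 \<Longrightarrow> (real N + 1) * up_slope N a - real N * down_slope N a = 2 * real N + 1"
  using b_par_eq[of N a] unfolding up_slope_def down_slope_def by algebra

lemma slope_bounds:
  assumes "N \<ge> 1" "a_min N < a"
  shows "1 < up_slope N a" "0 < down_slope N a"
proof -
  have gt: "1 < (real N + 1) * a" using assms(2) by (simp add: a_min_def field_simps)
  moreover have "0 < a" using assms by (auto simp: a_min_def intro: less_trans[rotated])
  hence "(real N + 1) * a \<le> (2 * real N + 1) * a" by (intro mult_right_mono) auto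
  ultimately show "1 < up_slope N a" by (simp add: up_slope_def)
  show "0 < down_slope N a"
    unfolding down_slope_def b_par_def using gt assms(1)
    by (intro mult_pos_pos divide_pos_pos) auto
qed

lemma down_slope_less_1:
  assumes "N \<ge> 1" "a < a0_star N"
  shows "down_slope N a < 1"
proof -
  have "(2 * real N + 1) * ((real N + 1) * a) < 3 * real N + 1"
  proof -
    have "(real N + 1) * (2 * real N + 1) > 0" by (intro mult_pos_pos) auto
    thus ?thesis using assms(2) unfolding a0_star_def by (simp add: pos_less_divide_eq mult_ac)
  qed
  thus ?thesis using assms by (simp add: down_slope_def b_par_def field_simps)
qed

lemma phi_eq:
  assumes "N \<ge> 1" "a_min N < a"
  shows "phi N a = ln (up_slope N a) / (ln (up_slope N a) - ln (down_slope N a))"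
proof -
  have "real N \<ge> 1" "0 < a" using assms by (auto simp: a_min_def intro: less_trans[rotated])
  moreover have "(real N + 1) * a - 1 > 0" using assms by (simp add: a_min_def field_simps)
  ultimately show ?thesis
    by (simp add: phi_def up_slope_def down_slope_def b_par_def ln_mult ln_div)
qed

lemma a0_star_less_1: "N \<ge> 1 \<Longrightarrow> a0_star N < 1"
proof -
  assume N: "N \<ge> 1"
  have "3 * real N + 1 < (real N + 1) * (2 * real N + 1)" using N by (simp add: algebra_simps)
  thus ?thesis unfolding a0_star_def by (subst divide_less_eq_1_pos) auto
qed

lemma phi_bounds:
  assumes "N \<ge> 1" "a_min N < a" "a < a0_star N"
  shows "0 < phi N a" "phi N a < 1"
proof -
  have "ln (up_slope N a) > 0" "ln (down_slope N a) < 0"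
    using slope_bounds[OF assms(1,2)] down_slope_less_1[OF assms(1,3)] by auto
  thus "0 < phi N a" "phi N a < 1" unfolding phi_eq[OF assms(1,2)] by (auto simp: field_simps)
qed

text \<open>The frequency \<open>phi\<close> of odd digits is the one for which slopes neither grow nor decay exponentially.\<close>

lemma phi_balance:
  assumes "N \<ge> 1" "a_min N < a" "a < a0_star N"
  shows "phi N a * ln (down_slope N a) + (1 - phi N a) * ln (up_slope N a) = 0"
proof -
  have "ln (up_slope N a) > 0" "ln (down_slope N a) < 0"
    using slope_bounds[OF assms(1,2)] down_slope_less_1[OF assms(1,3)] by auto
  thus ?thesis unfolding phi_eq[OF assms(1,2)] by (simp add: field_simps)
qed

text \<open>The sum of the logarithms of the \<open>2N + 1\<close> absolute slopes of the generating polygon. It vanishes exactly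
  at \<open>a0_tilde\<close>, and its sign tells on which side of \<open>a0_tilde\<close> the parameter lies.\<close>

definition log_balance :: "nat \<Rightarrow> real \<Rightarrow> real" where
  "log_balance N a = (real N + 1) * ln (up_slope N a) + real N * ln (down_slope N a)"

lemma log_balance_strict_mono:
  assumes "N \<ge> 1" "a_min N < a" "a < a'"
  shows "log_balance N a < log_balance N a'"
proof -
  have "up_slope N a < up_slope N a'" using assms by (simp add: up_slope_def)
  moreover have "down_slope N a < down_slope N a'" using assms 
    by (simp add: down_slope_def b_par_def divide_strict_right_mono)
  ultimately show ?thesis unfolding log_balance_def
    using slope_bounds[OF assms(1,2)] assms(1) by (intro add_strict_mono mult_strict_left_mono) auto
qed

lemma log_balance_eq_0_iff:
  assumes "N \<ge> 1" "a_min N < a" "a < 1"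
  shows "log_balance N a = 0 \<longleftrightarrow> is_a0_root N a"
proof -
  define c where "c = (real N + 1) * a - 1"
  define D where "D = 2 * real N + 1"
  define \<alpha> \<beta> where "\<alpha> = up_slope N a" and "\<beta> = down_slope N a"
  have ab: "1 < \<alpha>" "0 < \<beta>" using slope_bounds[OF assms(1,2)] by (auto simp: \<alpha>_def \<beta>_def)
  have N: "real N > 0" using assms by simp
  have "log_balance N a = ln (\<alpha> ^ (N + 1)) + ln (\<beta> ^ N)"
    using ab unfolding log_balance_def \<alpha>_def[symmetric] \<beta>_def[symmetric]
    by (simp only: ln_realpow of_nat_add of_nat_1)
  also have "\<dots> = ln (\<alpha> ^ (N + 1) * \<beta> ^ N)"
    using ab by (intro ln_mult_pos[symmetric]) auto
  finally have "log_balance N a = 0 \<longleftrightarrow> \<alpha> ^ (N + 1) * \<beta> ^ N = 1"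
    using ab by (simp add: ln_eq_zero_iff)
  also have "\<alpha> ^ (N + 1) * \<beta> ^ N = (D ^ (N + 1) * D ^ N) * a ^ (N + 1) * c ^ N / real N ^ N"
    unfolding \<alpha>_def \<beta>_def up_slope_def down_slope_def b_par_def c_def[symmetric] D_def[symmetric]
    by (simp only: power_mult_distrib power_divide times_divide_eq_right mult_ac)
  also have "D ^ (N + 1) * D ^ N = D ^ (2 * N + 1)"
    by (simp only: power_add[symmetric]) (simp add: mult_2)
  also have "D ^ (2 * N + 1) * a ^ (N + 1) * c ^ N / real N ^ N = 1 \<longleftrightarrow> is_a0_root N a"
    using assms(2,3) N by (auto simp: is_a0_root_def c_def D_def)
  finally show ?thesis .
qed

lemma a0_tilde_root:
  assumes "N \<ge> 1"
  shows "is_a0_root N (a0_tilde N)"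
  unfolding a0_tilde_def by (rule theI'[OF is_a0_root_unique[OF assms]])

lemma log_balance_a0_tilde:
  assumes "N \<ge> 1"
  shows "log_balance N (a0_tilde N) = 0"
  using a0_tilde_root[OF assms] log_balance_eq_0_iff[OF assms] by (auto simp: is_a0_root_def)

lemma a_min_less_a0_star: "N \<ge> 1 \<Longrightarrow> a_min N < a0_star N"
proof -
  assume N: "N \<ge> 1"
  have "1 / (real N + 1) = (2 * real N + 1) / ((real N + 1) * (2 * real N + 1))"
    by (simp add: add_nonneg_eq_0_iff)
  also have "\<dots> < (3 * real N + 1) / ((real N + 1) * (2 * real N + 1))"
    using N by (intro divide_strict_right_mono mult_pos_pos) auto
  finally show ?thesis by (simp add: a_min_def a0_star_def)
qed

lemma a0_tilde_bounds:
  assumes "N \<ge> 1"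
  shows "a_min N < a0_tilde N" "a0_tilde N < a0_star N"
proof -
  show "a_min N < a0_tilde N" using a0_tilde_root[OF assms] by (simp add: is_a0_root_def)
  show "a0_tilde N < a0_star N"
  proof (rule ccontr)
    assume "\<not> a0_tilde N < a0_star N"
    hence "log_balance N (a0_star N) \<le> log_balance N (a0_tilde N)"
      using log_balance_strict_mono[OF assms a_min_less_a0_star[OF assms], of "a0_tilde N"] 
      by (cases "a0_tilde N = a0_star N") auto
    moreover have "down_slope N (a0_star N) = 1"
    proof -
      have "(real N + 1) * a0_star N = (3 * real N + 1) / (2 * real N + 1)"
        using add_nonneg_eq_0_iff[of "real N" 1] by (simp add: a0_star_def)
      hence "down_slope N (a0_star N) = ((3 * real N + 1) - (2 * real N + 1)) / real N"
        unfolding down_slope_def b_par_def using add_nonneg_eq_0_iff[of "2 * real N" 1]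
        by (simp add: right_diff_distrib)
      thus ?thesis using assms by simp
    qed
    hence "log_balance N (a0_star N) > 0"
      using slope_bounds[OF assms a_min_less_a0_star[OF assms]] by (simp add: log_balance_def)
    ultimately show False using log_balance_a0_tilde[OF assms] by simp
  qed
qed

lemma phi_ge_iff:
  assumes "N \<ge> 1" "a_min N < a" "a < a0_star N"
  shows "real N / (2 * real N + 1) \<le> phi N a \<longleftrightarrow> log_balance N a \<ge> 0"
    "phi N a \<le> real N / (2 * real N + 1) \<longleftrightarrow> log_balance N a \<le> 0"
proof -
  have "ln (up_slope N a) > 0" "ln (down_slope N a) < 0"
    using slope_bounds[OF assms(1,2)] down_slope_less_1[OF assms(1,3)] by auto
  thus "real N / (2 * real N + 1) \<le> phi N a \<longleftrightarrow> log_balance N a \<ge> 0"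
    "phi N a \<le> real N / (2 * real N + 1) \<longleftrightarrow> log_balance N a \<le> 0"
    unfolding phi_eq[OF assms(1,2)] log_balance_def by (auto simp: field_simps)
qed

lemma phi_a0_tilde:
  assumes "N \<ge> 1"
  shows "phi N (a0_tilde N) = real N / (2 * real N + 1)"
  using phi_ge_iff[OF assms a0_tilde_bounds[OF assms]] log_balance_a0_tilde[OF assms] by (intro antisym) auto

lemma phi_ge:
  assumes "N \<ge> 1" "a0_tilde N \<le> a" "a < a0_star N"
  shows "real N / (2 * real N + 1) \<le> phi N a" "log_balance N a \<ge> 0"
proof -
  have a: "a_min N < a" using a0_tilde_bounds[OF assms(1)] assms(2) by linarith
  show *: "log_balance N a \<ge> 0"
  proof (cases "a = a0_tilde N")
    case False
    hence "log_balance N (a0_tilde N) < log_balance N a"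
      using assms by (intro log_balance_strict_mono a0_tilde_bounds) auto
    thus ?thesis using log_balance_a0_tilde[OF assms(1)] by simp
  qed (simp add: log_balance_a0_tilde[OF assms(1)])
  show "real N / (2 * real N + 1) \<le> phi N a" 
    using phi_ge_iff(1)[OF assms(1) a assms(3)] * by blast
qed

lemma phi_le:
  assumes "N \<ge> 1" "a_min N < a" "a \<le> a0_tilde N"
  shows "phi N a \<le> real N / (2 * real N + 1)" "log_balance N a \<le> 0"
proof -
  have a: "a < a0_star N" using a0_tilde_bounds[OF assms(1)] assms(3) by linarith
  show *: "log_balance N a \<le> 0"
  proof (cases "a = a0_tilde N")
    case False
    hence "log_balance N a < log_balance N (a0_tilde N)"
      using assms by (intro log_balance_strict_mono) auto
    thus ?thesis using log_balance_a0_tilde[OF assms(1)] by simp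
  qed (simp add: log_balance_a0_tilde[OF assms(1)])
  show "phi N a \<le> real N / (2 * real N + 1)" 
    using phi_ge_iff(2)[OF assms(1,2) a] * by blast
qed

lemma entropy_critical:
  assumes "N \<ge> 1"
  shows "entropy N (real N / (2 * real N + 1)) = ln (2 * real N + 1)"
proof -
  define D where "D = 2 * real N + 1"
  have D: "D > 0" "real N > 0" using assms by (auto simp: D_def)
  have e: "1 - real N / D = (real N + 1) / D" using D(1) by (simp add: diff_divide_eq_iff) (simp add: D_def)
  have "real N / D / real N = 1 / D" "(real N + 1) / D / (real N + 1) = 1 / D"
    using D by (simp_all add: add_nonneg_eq_0_iff)
  hence "entropy N (real N / D) = - (real N / D * ln (1 / D) + (real N + 1) / D * ln (1 / D))"
    unfolding entropy_def e by simp
  also have "\<dots> = ((real N + (real N + 1)) / D) * ln D" 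
    using D by (simp add: ln_div add_divide_distrib distrib_right)
  also have "real N + (real N + 1) = D" by (simp add: D_def)
  finally show ?thesis using D by (simp add: D_def)
qed

section \<open>Concavity below the critical parameter\<close>

text \<open>The pressure of the absolute slopes, as a function of the inverse temperature \<open>q\<close>.\<close>

definition log_partition :: "nat \<Rightarrow> real \<Rightarrow> real \<Rightarrow> real" where
  "log_partition N q a = ln (real N * down_slope N a powr q + (real N + 1) * up_slope N a powr q)"

text \<open>Gibbs' inequality for the weights proportional to the \<open>q\<close>-th powers of the slopes: the terms with \<open>q\<close>
  cancel by \<open>phi_balance\<close> and only the logarithm of the normalization remains.\<close>

lemma entropy_phi_le_log_partition:
  assumes "N \<ge> 1" "a_min N < a" "a < a0_star N"
  shows "entropy N (phi N a) \<le> log_partition N q a"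
proof -
  define Z where "Z = real N * down_slope N a powr q + (real N + 1) * up_slope N a powr q"
  have s: "1 < up_slope N a" "0 < down_slope N a" using slope_bounds[OF assms(1,2)] .
  have Z: "Z > 0" unfolding Z_def using s by (intro add_nonneg_pos mult_pos_pos) auto
  define u v where "u = down_slope N a powr q / Z" and "v = up_slope N a powr q / Z"
  define p where "p = phi N a"
  have "entropy N p \<le> - p * ln u - (1 - p) * ln v"
    unfolding p_def
  proof (rule entropy_le[OF assms(1) phi_bounds[OF assms]])
    show "u > 0" "v > 0" using s Z by (auto simp: u_def v_def)
    have "real N * u + (real N + 1) * v = Z / Z"
      unfolding u_def v_def times_divide_eq_right add_divide_distrib[symmetric] Z_def ..
    thus "real N * u + (real N + 1) * v = 1" using Z by simp
  qed
  also have "ln u = q * ln (down_slope N a) - ln Z"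
    using s Z by (simp add: u_def ln_div ln_powr)
  also have "ln v = q * ln (up_slope N a) - ln Z"
    using s Z by (simp add: v_def ln_div ln_powr)
  also have "- p * (q * ln (down_slope N a) - ln Z) - (1 - p) * (q * ln (up_slope N a) - ln Z)
     = ln Z - q * (p * ln (down_slope N a) + (1 - p) * ln (up_slope N a))" by algebra
  also have "\<dots> = ln Z" using phi_balance[OF assms] by (simp add: p_def)
  finally show ?thesis by (simp add: p_def log_partition_def Z_def)
qed

text \<open>The minimizing \<open>q\<close> is the one for which the weights proportional to the \<open>q\<close>-th powers of the slopes give
  the odd digits total weight \<open>phi N a\<close>. Left of \<open>a0_tilde\<close> it is nonnegative because the sum of the
  logarithms of the slopes is at most \<open>0\<close>, and it never exceeds \<open>1\<close>.\<close>

lemma entropy_phi_eq_log_partition: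
  assumes "N \<ge> 1" "a_min N < a" "a \<le> a0_tilde N"
  obtains q where "0 \<le> q" "q \<le> 1" "entropy N (phi N a) = log_partition N q a"
proof -
  have a: "a < a0_star N" using a0_tilde_bounds[OF assms(1)] assms by linarith
  define \<alpha> \<beta> where "\<alpha> = up_slope N a" and "\<beta> = down_slope N a"
  define A B where "A = ln \<alpha>" and "B = - ln \<beta>"
  have s: "1 < \<alpha>" "0 < \<beta>" "\<beta> < 1"
    using slope_bounds[OF assms(1,2)] down_slope_less_1[OF assms(1) a] by (auto simp: \<alpha>_def \<beta>_def)
  have AB: "A > 0" "B > 0" using s by (auto simp: A_def B_def)
  have N: "real N > 0" using assms by simp
  define R where "R = real N * B / ((real N + 1) * A)"
  \<comment> \<open>This \<open>q\<close> solves \<open>N B \<beta>\<^bsup>q\<^esup> = (N+1) A \<alpha>\<^bsup>q\<^esup>\<close>, the vanishing of the derivative in \<open>q\<close>.\<close>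
  define q where "q = ln R / (A + B)"
  have R: "R > 0" using AB N by (auto simp: R_def intro!: divide_pos_pos mult_pos_pos)
  have "(real N + 1) * A \<le> real N * B"
    using phi_le(2)[OF assms] by (simp add: log_balance_def A_def B_def \<alpha>_def \<beta>_def)
  hence "R \<ge> 1" unfolding R_def using AB N by (subst le_divide_eq_1_pos) (auto intro!: mult_pos_pos)
  hence q0: "q \<ge> 0" using AB by (simp add: q_def)
  \<comment> \<open>\<open>q \<le> 1\<close> says \<open>N \<beta> B \<le> (N+1) \<alpha> A\<close>; this follows from \<open>x ln x \<ge> x - 1\<close> at \<open>x = \<alpha>\<close> and \<open>x = \<beta>\<close>.\<close>
  have "\<alpha> * A \<ge> \<alpha> - 1" "\<beta> * (- B) \<ge> \<beta> - 1"
  proof -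
    have xlnx: "x * ln x \<ge> x - 1" if "x > 0" for x :: real
    proof -
      have "ln (1 / x) \<le> 1 / x - 1" using that by (intro ln_le_minus_one) auto
      hence "x * (- ln x) \<le> x * (1 / x - 1)" using that by (intro mult_left_mono) (auto simp: ln_div)
      thus ?thesis using that by (simp add: right_diff_distrib)
    qed
    show "\<alpha> * A \<ge> \<alpha> - 1" "\<beta> * (- B) \<ge> \<beta> - 1" using xlnx[of \<alpha>] xlnx[of \<beta>] s by (auto simp: A_def B_def)
  qed
  hence "(real N + 1) * (\<alpha> * A) + real N * (\<beta> * (- B)) \<ge> (real N + 1) * (\<alpha> - 1) + real N * (\<beta> - 1)"
    using N by (intro add_mono mult_left_mono) auto
  also have "(real N + 1) * (\<alpha> - 1) + real N * (\<beta> - 1) = 2 * (real N * \<beta>)"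
    using slope_relation[OF assms(1), of a] unfolding \<alpha>_def[symmetric] \<beta>_def[symmetric]
    by (simp add: algebra_simps)
  finally have "2 * (real N * \<beta>) \<le> (real N + 1) * (\<alpha> * A) + real N * (\<beta> * (- B))" .
  moreover have "real N * (\<beta> * (- B)) = - (real N * B * \<beta>)" "(real N + 1) * (\<alpha> * A) = (real N + 1) * A * \<alpha>"
    by simp_all
  moreover have "0 \<le> real N * \<beta>" using s by simp
  ultimately have "real N * B * \<beta> \<le> (real N + 1) * A * \<alpha>" by linarith
  moreover have frac: "K / M \<le> \<alpha> / \<beta>" if "K * \<beta> \<le> M * \<alpha>" "M > 0" for K M
    using that s by (simp add: field_simps)
  ultimately have "R \<le> \<alpha> / \<beta>"
    unfolding R_def using AB N by (intro frac mult_pos_pos) auto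
  hence "ln R \<le> ln (\<alpha> / \<beta>)" using R s by (subst ln_le_cancel_iff) auto
  hence q1: "q \<le> 1" using AB s by (simp add: q_def A_def B_def ln_div)
  define X Y where "X = real N * \<beta> powr q" and "Y = (real N + 1) * \<alpha> powr q"
  have XY: "X > 0" "Y > 0" using s N by (auto simp: X_def Y_def)
  have "ln (X * B) = ln (Y * A)"
  proof -
    have "q * (A + B) = ln R" using AB by (simp add: q_def)
    also have "\<dots> = ln (real N) + ln B - ln (real N + 1) - ln A"
      using AB N by (simp add: R_def ln_div ln_mult)
    finally have "q * (A + B) = \<dots>" .
    moreover have lnb: "ln \<beta> = - B" by (simp add: B_def)
    have "ln (X * B) = ln (real N) + q * (- B) + ln B"
      using AB N s by (simp add: X_def ln_mult ln_powr lnb)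
    moreover have "ln (Y * A) = ln (real N + 1) + q * A + ln A"
      using AB N s by (simp add: Y_def ln_mult ln_powr A_def[symmetric])
    ultimately show ?thesis by (simp add: algebra_simps)
  qed
  hence eq: "X * B = Y * A" using XY AB by (subst (asm) ln_inj_iff) auto
  have p: "phi N a = A / (A + B)" unfolding phi_eq[OF assms(1,2)] by (simp add: A_def B_def \<alpha>_def \<beta>_def)
  have pX: "phi N a = X / (X + Y)" unfolding p using XY AB eq by (simp add: field_simps)
  have pY: "1 - phi N a = Y / (X + Y)" unfolding pX using XY by (simp add: field_simps)
  have "entropy N (phi N a) = - (phi N a * (q * ln \<beta> - ln (X + Y)) + (1 - phi N a) * (q * ln \<alpha> - ln (X + Y)))"
  proof -
    have "ln (X / (X + Y) / real N) = q * ln \<beta> - ln (X + Y)" 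
      "ln (Y / (X + Y) / (real N + 1)) = q * ln \<alpha> - ln (X + Y)"
    proof -
      have "ln X = ln (real N) + q * ln \<beta>" "ln Y = ln (real N + 1) + q * ln \<alpha>"
        using N s by (simp_all add: X_def Y_def ln_mult ln_powr)
      moreover have "X + Y > 0" using XY by simp
      ultimately show "ln (X / (X + Y) / real N) = q * ln \<beta> - ln (X + Y)" 
        "ln (Y / (X + Y) / (real N + 1)) = q * ln \<alpha> - ln (X + Y)"
        using N XY by (simp_all add: ln_div ln_mult)
    qed
    thus ?thesis unfolding entropy_def pX[symmetric] pY[symmetric] by simp
  qed
  also have "\<dots> = ln (X + Y) - q * (phi N a * ln \<beta> + (1 - phi N a) * ln \<alpha>)" by algebra
  also have "\<dots> = log_partition N q a"
    using phi_balance[OF assms(1,2) a] by (simp add: log_partition_def X_def Y_def \<alpha>_def \<beta>_def)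
  finally show ?thesis using that q0 q1 by blast
qed

lemma powr_concave:
  fixes q :: real
  assumes "0 \<le> q" "q \<le> 1"
  shows "concave_on {0<..} (\<lambda>x. x powr q)"
proof (rule f''_le0_imp_concave)
  fix x :: real assume x: "x \<in> {0<..}"
  show "((\<lambda>x. x powr q) has_real_derivative q * x powr (q - 1)) (at x)"
    using x by (auto intro!: derivative_eq_intros)
  show "((\<lambda>x. q * x powr (q - 1)) has_real_derivative q * ((q - 1) * x powr (q - 1 - 1))) (at x)"
    using x by (auto intro!: derivative_eq_intros)
  show "q * ((q - 1) * x powr (q - 1 - 1)) \<le> 0"
    using assms by (intro mult_nonneg_nonpos mult_nonpos_nonneg) auto
qed auto

text \<open>Both slopes depend affinely on \<open>a\<close>, the power \<open>q\<close> with \<open>0 \<le> q \<le> 1\<close> is concave, and \<open>ln\<close> is concave and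
  increasing.\<close>

lemma log_partition_concave:
  assumes "N \<ge> 1" "0 \<le> q" "q \<le> 1"
  shows "concave_on {a_min N<..} (log_partition N q)"
  unfolding concave_on_iff
proof (intro conjI ballI allI impI)
  fix x y u v :: real
  assume x: "x \<in> {a_min N<..}" and y: "y \<in> {a_min N<..}" and uv: "0 \<le> u" "0 \<le> v" "u + v = 1"
  define z where "z = u * x + v * y"
  have sx: "1 < up_slope N x" "0 < down_slope N x" using slope_bounds[OF assms(1)] x by auto
  have sy: "1 < up_slope N y" "0 < down_slope N y" using slope_bounds[OF assms(1)] y by auto
  define Z where "Z a = real N * down_slope N a powr q + (real N + 1) * up_slope N a powr q" for a
  have Z: "Z x > 0" "Z y > 0" unfolding Z_def using sx sy by (auto intro!: add_nonneg_pos mult_pos_pos)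
  have up: "up_slope N z = u * up_slope N x + v * up_slope N y"
    by (simp add: up_slope_def z_def algebra_simps)
  have dn: "down_slope N z = u * down_slope N x + v * down_slope N y"
  proof -
    have "u * (((real N + 1) * x - 1) / real N) + v * (((real N + 1) * y - 1) / real N) =
        ((real N + 1) * (u * x + v * y) - (u + v)) / real N"
      using assms(1) by (simp add: field_simps)
    hence "b_par N z = u * b_par N x + v * b_par N y"
      unfolding uv(3) b_par_def z_def by simp
    thus ?thesis by (simp add: down_slope_def algebra_simps)
  qed
  have conc: "u * c powr q + v * d powr q \<le> (u * c + v * d) powr q" if "c > 0" "d > 0" for c d
    using concave_on_iff[THEN iffD1, OF powr_concave[OF assms(2,3)], THEN conjunct2, rule_format,
      of c d u v] that uv by simp
  have "u * Z x + v * Z y = real N * (u * down_slope N x powr q + v * down_slope N y powr q)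
      + (real N + 1) * (u * up_slope N x powr q + v * up_slope N y powr q)"
    unfolding Z_def by algebra
  also have "\<dots> \<le> Z z"
    unfolding Z_def up dn using sx sy uv by (intro add_mono mult_left_mono conc) auto
  finally have Zz: "u * Z x + v * Z y \<le> Z z" .
  have "u * ln (Z x) + v * ln (Z y) \<le> ln (u * Z x + v * Z y)"
    using concave_on_iff[THEN iffD1, OF ln_concave, THEN conjunct2, rule_format, of "Z x" "Z y" u v] Z uv
    by simp
  also have "\<dots> \<le> ln (Z z)"
  proof -
    have "0 < u * Z x + v * Z y" using Z uv
      by (cases "u = 0") (auto intro!: add_pos_nonneg mult_pos_pos)
    thus ?thesis using Zz by (subst ln_le_cancel_iff) auto
  qed
  finally show "u * log_partition N q x + v * log_partition N q y \<le> log_partition N q (u *\<^sub>R x + v *\<^sub>R y)"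
    by (simp add: log_partition_def Z_def z_def)
qed auto

text \<open>A pointwise minimum of concave functions is concave.\<close>

lemma entropy_phi_concave_left:
  assumes "N \<ge> 1"
  shows "concave_on {a_min N<..a0_tilde N} (\<lambda>a. entropy N (phi N a))"
  unfolding concave_on_iff
proof (intro conjI ballI allI impI)
  fix x y u v :: real
  assume x: "x \<in> {a_min N<..a0_tilde N}" and y: "y \<in> {a_min N<..a0_tilde N}" 
    and uv: "0 \<le> u" "0 \<le> v" "u + v = 1"
  have at: "a0_tilde N < a0_star N" using a0_tilde_bounds[OF assms] by simp
  define z where "z = u * x + v * y"
  have "z \<in> {a_min N<..a0_tilde N}"
    using convexD[OF _ x y uv] by (simp add: z_def)
  then obtain q where q: "0 \<le> q" "q \<le> 1" "entropy N (phi N z) = log_partition N q z"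
    using entropy_phi_eq_log_partition[OF assms, of z] by auto
  have "u * entropy N (phi N x) + v * entropy N (phi N y) \<le> u * log_partition N q x + v * log_partition N q y"
    using x y uv at by (intro add_mono mult_left_mono entropy_phi_le_log_partition assms) auto
  also have "\<dots> \<le> log_partition N q z"
    using concave_on_iff[THEN iffD1, OF log_partition_concave[OF assms q(1,2)], THEN conjunct2, rule_format, of x y u v]
     x y uv by (simp add: z_def)
  finally show "u * entropy N (phi N x) + v * entropy N (phi N y) \<le> entropy N (phi N (u *\<^sub>R x + v *\<^sub>R y))"
    using q by (simp add: z_def)
qed auto

section \<open>Concavity above the critical parameter\<close>

text \<open>The line \<open>y = x/e\<close> touches the graph of \<open>ln\<close> at \<open>e\<close>, and \<open>46/125\<close> is barely larger than \<open>1/e\<close>. This bound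
  is sharp enough below because in the tightest cases the arguments are close to \<open>e\<close>.\<close>

lemma ln_le_mult:
  fixes x :: real
  assumes "x > 0"
  shows "ln x \<le> 46 / 125 * x"
proof -
  have "exp 1 \<ge> (2718 / 1000 :: real)"
    using e_approx_32 unfolding abs_le_iff by simp
  hence e: "1 / exp 1 \<le> (46 / 125 :: real)"
    by (simp add: field_simps)
  have "ln (x / exp 1) \<le> x / exp 1 - 1"
    using assms by (intro ln_le_minus_one) auto
  hence "ln x \<le> (1 / exp 1) * x"
    using assms by (simp add: ln_div)
  also have "\<dots> \<le> 46 / 125 * x"
    using assms by (intro mult_right_mono e) auto
  finally show ?thesis .
qed

lemma concave_quadratic_nonneg:
  fixes c0 c1 c2 :: real
  assumes "c2 \<ge> 0" "u \<le> t" "t \<le> v"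
    "c0 + c1 * u - c2 * u\<^sup>2 \<ge> 0" "c0 + c1 * v - c2 * v\<^sup>2 \<ge> 0"
  shows "c0 + c1 * t - c2 * t\<^sup>2 \<ge> 0"
proof (cases "u = v")
  case False
  hence uv: "u < v" using assms by simp
  have "(v - u) * (c0 + c1 * t - c2 * t\<^sup>2) = (v - t) * (c0 + c1 * u - c2 * u\<^sup>2) + 
     (t - u) * (c0 + c1 * v - c2 * v\<^sup>2) + c2 * ((v - u) * ((t - u) * (v - t)))"
    by algebra
  also have "\<dots> \<ge> 0"
    using assms uv by (intro add_nonneg_nonneg mult_nonneg_nonneg) auto
  finally show ?thesis using uv by (simp add: zero_le_mult_iff)
qed (use assms in auto)

text \<open>The polynomial is, up to a positive factor, the difference of the two sides of
  \<open>phi_convexity_inequality\<close> with \<open>A\<close> and \<open>B\<close> replaced by \<open>46\<gamma>/(125k)\<close> and \<open>46/(125\<beta>)\<close>. The variable \<open>w\<close>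
  is the distance of \<open>\<beta>\<close> from the line \<open>2/5 - x/10\<close>, below which \<open>\<beta>\<gamma> < 1\<close>. The upper bound
  for \<open>w\<close> says \<open>\<beta> \<le> 4/5\<close>. In these coordinates the negative terms are absorbed by positive ones through
  \<open>w\<^sup>2 \<le> 2w/5 + xw/10\<close>, \<open>w \<le> 1/2\<close> and \<open>x \<le> 1\<close>.\<close>

lemma corner_poly_small:
  fixes x w :: real
  assumes "0 \<le> x" "x \<le> 1" "0 \<le> w" "w \<le> 2/5 + x / 10"
  defines "k \<equiv> 1 + x" and "\<beta> \<equiv> 2/5 - x / 10 + w"
  defines "\<gamma> \<equiv> \<beta> + k + 1"
  shows "2 * (k + 1) * (k * \<beta> * (k + \<gamma>\<^sup>2)) - 46/125 * ((\<gamma> * \<beta> + k) * (k * \<beta> + \<gamma>^3)) \<ge> 0"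
proof -
  have eq: "2 * (k + 1) * (k * \<beta> * (k + \<gamma>\<^sup>2)) - 46/125 * ((\<gamma> * \<beta> + k) * (k * \<beta> + \<gamma>^3)) =
    217388/390625 + 107478/15625*w - 26448/3125*w^2 - 6792/625*w^3 - 92/25*w^4 - 46/125*w^5
    + 369977/78125*x + 22622/625*(x*w) + 23392/3125*(x*w^2) - 2782/625*(x*w^3) - 161/125*(x*w^4)
    + 241497/78125*x^2 + 558842/15625*(x^2*w) + 34383/3125*(x^2*w^2) + 43/125*(x^2*w^3)
    - 16114/15625*x^3 + 372567/31250*(x^3*w) + 15661/6250*(x^3*w^2)
    - 79111/78125*x^4 + 140733/125000*(x^4*w) - 861597/6250000*x^5"
    unfolding k_def \<beta>_def \<gamma>_def by (simp add: field_simps eval_nat_numeral)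
  have w: "w \<le> 1/2" using assms by simp
  have nn: "0 \<le> x * w" "0 \<le> x*w^2" "0 \<le> x^2*w" "0 \<le> x^2*w^2" "0 \<le> x^2*w^3" "0 \<le> x^3*w" "0 \<le> x^3*w^2" 
    "0 \<le> x^4*w" "0 \<le> x^2" "0 \<le> w^2"
    using assms by auto
  have w2: "w^2 \<le> 2/5 * w + 1/10 * (x * w)"
    using mult_right_mono[OF assms(4,3)] by (simp add: power2_eq_square algebra_simps)
  have w3: "w^3 \<le> 1/2 * w^2"
    using mult_right_mono[OF w, of "w^2"] by (simp add: eval_nat_numeral)
  have w4: "w^4 \<le> 1/2 * w^3"
    using mult_right_mono[OF w, of "w^3"] assms(3) by (simp add: eval_nat_numeral)
  have w5: "w^5 \<le> 1/2 * w^4"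
    using mult_right_mono[OF w, of "w^4"] assms(3) by (simp add: eval_nat_numeral)
  have xw3: "x*w^3 \<le> 1/2 * (x*w^2)" using mult_left_mono[OF w3 assms(1)] by simp
  have xw4: "x*w^4 \<le> 1/2 * (x*w^3)" using mult_left_mono[OF w4 assms(1)] by simp
  have x3: "x^3 \<le> x^2" "x^4 \<le> x^2" "x^5 \<le> x^2"
    using assms by (auto intro!: power_decreasing)
  show ?thesis unfolding eq using nn w2 w3 w4 w5 xw3 xw4 x3 assms(1,3) by linarith
qed

text \<open>The same difference for \<open>B\<close> replaced by \<open>1/4\<close>, used for \<open>\<beta>\<close> close to \<open>1\<close>; here \<open>184/125 = 4 \<cdot> 46/125\<close>.\<close>

lemma corner_poly_large:
  fixes x w :: real
  assumes "0 \<le> x" "x \<le> 1" "0 \<le> w" "w \<le> 1/5"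
  defines "k \<equiv> 1 + x" and "\<beta> \<equiv> 1 - w"
  defines "\<gamma> \<equiv> \<beta> + k + 1"
  shows "8 * (k + 1) * (k * (k * \<beta> + 184/125 * \<gamma>\<^sup>2)) - 
     (184/125 * \<gamma> + k) * (k * \<beta>\<^sup>2 + 184/125 * \<gamma>^3) \<ge> 0"
proof -
  have eq: "8 * (k + 1) * (k * (k * \<beta> + 184/125 * \<gamma>\<^sup>2)) - 
     (184/125 * \<gamma> + k) * (k * \<beta>\<^sup>2 + 184/125 * \<gamma>^3) =
    114039/15625 + 2011698/15625*w - 1797849/15625*w^2 + 452272/15625*w^3 - 33856/15625*w^4
    + 2779302/15625*x + 287948/15625*(x*w) - 1112066/15625*(x*w^2) + 181424/15625*(x*w^3)
    + 3141151/15625*x^2 - 928934/15625*(x^2*w) - 126761/15625*(x^2*w^2)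
    + 1144728/15625*x^3 - 288576/15625*(x^3*w) + 127144/15625*x^4"
    unfolding k_def \<beta>_def \<gamma>_def by (simp add: field_simps eval_nat_numeral)
  have w2: "w^2 \<le> 1/5 * w" using mult_right_mono[OF assms(4,3)] by (simp add: power2_eq_square)
  have w4: "w^4 \<le> w^3" using assms by (auto intro!: power_decreasing)
  have xw2: "x*w^2 \<le> 1/5 * (x * w)" using mult_left_mono[OF w2 assms(1)] by simp
  have "w^2 \<le> (1/5)^2" using assms by (intro power_mono) auto
  hence x2w: "x^2*w \<le> 1/5 * x^2" "x^2*w^2 \<le> 1/25 * x^2" "x^3*w \<le> 1/5 * x^3" "x*w \<le> 1/5*x"
    using mult_left_mono[OF assms(4), of "x^2"] mult_left_mono[OF assms(4), of "x^3"]
      mult_left_mono[OF assms(4), of "x"] mult_left_mono[of "w^2" "1/25" "x^2"] assms(1) 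
    by (auto simp: power2_eq_square)
  have "0 \<le> x*w" "0 \<le> x*w^3" "0 \<le> w^3" "0 \<le> x^2" "0 \<le> x^3" "0 \<le> x^4" using assms by auto
  thus ?thesis unfolding eq using w2 w4 xw2 x2w assms(1,3) by linarith
qed

lemma corner_linear_bound:
  fixes k \<beta> :: real
  assumes k: "1 \<le> k" "k \<le> 2" and \<beta>: "1/4 \<le> \<beta>"
  shows "46/125 * (\<beta> + 2 + (k + 1) * (\<beta> + k + 1)) \<le> 2 * k * (1 + \<beta>)"
proof -
  have "0 \<le> (\<beta> - 1/4) * (2 * k - 46/125 * (k + 2))" 
    using k \<beta> by (intro mult_nonneg_nonneg) auto
  moreover have "0 \<le> (k - 1) * (2 - k)" using k by auto
  ultimately show ?thesis using k by (simp add: field_simps)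
qed

text \<open>This says that the second derivative of \<open>phi\<close> is nonnegative: \<open>A\<close> and \<open>-B\<close> are the logarithms of the two
  slopes \<open>\<gamma>/k\<close> and \<open>\<beta>\<close>, \<open>k\<close> stands for \<open>(N+1)/N\<close>, and \<open>B \<le> kA\<close> means that the parameter is not left of
  \<open>a0_tilde\<close>. Regarded as a function of independent \<open>A\<close> and \<open>B\<close>, the difference \<open>P\<close> of the two sides is a
  concave quadratic in each variable separately. So it suffices to know its sign at the ends of suitable
  segments parallel to the axes. These ends lie on the lines \<open>B = 0\<close> and \<open>B = kA\<close> or are given by rational
  upper bounds for the logarithms, and the sign there is a matter of polynomial inequalities in \<open>k\<close> and \<open>\<beta>\<close>.\<close>

lemma phi_convexity_inequality:
  fixes k \<beta> \<gamma> A B :: real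
  assumes k: "1 \<le> k" "k \<le> 2" and \<beta>: "0 < \<beta>" "\<beta> < 1"
  defines "\<gamma> \<equiv> \<beta> + k + 1"
  defines "A \<equiv> ln (\<gamma> / k)" and "B \<equiv> - ln \<beta>"
  assumes BA: "B \<le> k * A"
  shows "(A + B) * (\<beta>\<^sup>2 * B + \<gamma>\<^sup>2 * A) \<le> 2 * (k + 1) * (\<beta> * B + \<gamma> * A)"
proof -
  define r :: real where "r = 46/125"
  define P where "P A B = 2 * (k + 1) * (\<beta> * B + \<gamma> * A) - (A + B) * (\<beta>\<^sup>2 * B + \<gamma>\<^sup>2 * A)" for A B
  define C where "C = r * \<gamma> / k"
  have r: "r > 0" by (simp add: r_def)
  have \<gamma>: "\<gamma> > 0" "\<gamma> \<le> k + 2" "\<gamma> \<ge> k" using k \<beta> by (auto simp: \<gamma>_def)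
  have B: "B > 0" using \<beta> by (simp add: B_def)
  have A: "A \<ge> 0" unfolding A_def using \<gamma> k by (intro ln_ge_zero) auto
  have AC: "A \<le> C"
    using ln_le_mult[of "\<gamma> / k"] \<gamma> k by (simp add: A_def C_def r_def)
  have C: "C > 0" using r \<gamma> k by (simp add: C_def)
  have conc_B: "P a b \<ge> 0" if "u \<le> b" "b \<le> v" "P a u \<ge> 0" "P a v \<ge> 0" for a b u v
  proof -
    have e: "P a b = (2*(k+1)*\<gamma>*a - \<gamma>\<^sup>2*a\<^sup>2) + (2*(k+1)*\<beta> - (\<beta>\<^sup>2+\<gamma>\<^sup>2)*a) * b - \<beta>\<^sup>2 * b\<^sup>2" for b
      unfolding P_def by algebra
    show ?thesis unfolding e by (rule concave_quadratic_nonneg[OF _ that(1,2)]) (use that e in auto)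
  qed
  have conc_A: "P a b \<ge> 0" if "u \<le> a" "a \<le> v" "P u b \<ge> 0" "P v b \<ge> 0" for a b u v
  proof -
    have e: "P a b = (2*(k+1)*\<beta>*b - \<beta>\<^sup>2*b\<^sup>2) + (2*(k+1)*\<gamma> - (\<beta>\<^sup>2+\<gamma>\<^sup>2)*b) * a - \<gamma>\<^sup>2 * a\<^sup>2" for a
      unfolding P_def by algebra
    show ?thesis unfolding e by (rule concave_quadratic_nonneg[OF _ that(1,2)]) (use that e in auto)
  qed
  have P_B0: "P a 0 \<ge> 0" if "0 \<le> a" "a \<le> C" for a
  proof -
    have "r * \<gamma>\<^sup>2 \<le> r * (k + 2)\<^sup>2" using \<gamma> r by (intro mult_left_mono power_mono) auto
    also have "\<dots> \<le> 2 * k * (k + 1)"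
    proof -
      have "0 \<le> (k - 1) * (k - 1)" by simp
      hence "k * k \<ge> 2 * k - 1" by (simp add: algebra_simps)
      moreover have "2 * k * (k + 1) - r * (k + 2)\<^sup>2 = 204/125 * (k*k) + 66/125 * k - 184/125"
        by (simp add: r_def power2_eq_square field_simps)
      ultimately show ?thesis using k by linarith
    qed
    finally have "\<gamma> * C \<le> 2 * (k + 1)" using k by (simp add: C_def field_simps power2_eq_square)
    moreover have "\<gamma> * a \<le> \<gamma> * C" using that \<gamma> by simp
    ultimately have "\<gamma> * a \<le> 2 * (k + 1)" by linarith
    hence "0 \<le> (\<gamma> * a) * (2 * (k + 1) - \<gamma> * a)"
      using that \<gamma> by (intro mult_nonneg_nonneg) auto
    thus ?thesis unfolding P_def by (simp add: power2_eq_square algebra_simps)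
  qed
  have P_diag: "P a (k * a) \<ge> 0" if "0 \<le> a" "a * (\<beta>\<^sup>2 + 2 * \<beta> + k + 1) \<le> 2 * (1 + \<beta>)" for a
  proof -
    have "P a (k * a) = (k + 1)\<^sup>2 * a * (2 * (1 + \<beta>) - a * (\<beta>\<^sup>2 + 2 * \<beta> + k + 1))"
      unfolding P_def \<gamma>_def by algebra
    thus ?thesis using that by simp
  qed
  \<comment> \<open>For smaller \<open>\<beta>\<close>, \<open>-ln \<beta>\<close> would exceed the bound \<open>46\<gamma>/125\<close> for \<open>kA\<close>.\<close>
  have \<beta>4: "\<beta> \<ge> 1/4"
  proof (rule ccontr)
    assume *: "\<not> \<beta> \<ge> 1/4"
    have "k * A \<le> r * \<gamma>" using AC k by (simp add: C_def field_simps)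
    also have "\<dots> \<le> r * (13/4)" using * k r by (intro mult_left_mono) (auto simp: \<gamma>_def)
    finally have "B \<le> r * (13/4)" using BA by simp
    moreover have "ln (1/4) \<ge> ln \<beta>" using * \<beta> by simp
    moreover have "ln (1/4 :: real) = - (2 * ln 2)"
      using ln_realpow[of "2::real" 2] by (simp add: ln_div)
    ultimately show False using ln2_ge_two_thirds by (simp add: B_def r_def)
  qed
  have key: "r * (\<beta> + 2 + (k + 1) * \<gamma>) \<le> 2 * k * (1 + \<beta>)"
    using corner_linear_bound[OF k \<beta>4] by (simp add: r_def \<gamma>_def add.assoc)
  have \<gamma>e: "\<gamma> * (\<beta>\<^sup>2 + 2 * \<beta> + k + 1) = (\<beta> * \<gamma>) * (\<beta> + 2) + (k + 1) * \<gamma>" by algebra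
  have "P A B \<ge> 0"
  proof (cases "\<beta> * \<gamma> < 1")
    case True
    have "C * (\<beta>\<^sup>2 + 2 * \<beta> + k + 1) = r * (\<gamma> * (\<beta>\<^sup>2 + 2 * \<beta> + k + 1)) / k"
      by (simp add: C_def)
    also have "\<dots> \<le> r * (1 * (\<beta> + 2) + (k + 1) * \<gamma>) / k"
      unfolding \<gamma>e using True r k \<beta> by (intro divide_right_mono mult_left_mono add_right_mono mult_right_mono) auto
    also have "\<dots> \<le> 2 * (1 + \<beta>)" using key k by (simp add: field_simps)
    finally have *: "C * (\<beta>\<^sup>2 + 2 * \<beta> + k + 1) \<le> 2 * (1 + \<beta>)" .
    have "A * (\<beta>\<^sup>2 + 2 * \<beta> + k + 1) \<le> C * (\<beta>\<^sup>2 + 2 * \<beta> + k + 1)"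
      using AC k \<beta> by (intro mult_right_mono) auto
    hence "P A (k * A) \<ge> 0" using * A by (intro P_diag) auto
    moreover have "P A 0 \<ge> 0" by (rule P_B0) (use A AC in auto)
    ultimately show ?thesis using B BA by (intro conc_B[of 0 B "k * A"]) auto
  next
    case False
    \<comment> \<open>\<open>D\<close> bounds \<open>B = -ln \<beta>\<close>: a multiple of \<open>1/\<beta>\<close> is nearly sharp around \<open>\<beta> = 1/e\<close> but too large for \<open>\<beta>\<close> near \<open>1\<close>.\<close>
    obtain D where D: "B \<le> D" "D * (\<beta>\<^sup>2 + 2 * \<beta> + k + 1) \<le> 2 * k * (1 + \<beta>)" "P C D \<ge> 0"
    proof (cases "\<beta> \<le> 4/5")
      case True
      have "B \<le> r / \<beta>" using ln_le_mult[of "1 / \<beta>"] \<beta> by (simp add: B_def r_def ln_div)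
      moreover have "r / \<beta> * (\<beta>\<^sup>2 + 2 * \<beta> + k + 1) \<le> 2 * k * (1 + \<beta>)"
      proof -
        have "(k + 1) * 1 \<le> (k + 1) * (\<beta> * \<gamma>)" using False k by (intro mult_left_mono) auto
        hence "\<beta>\<^sup>2 + 2 * \<beta> + k + 1 \<le> \<beta> * (\<beta> + 2 + (k + 1) * \<gamma>)"
          by (simp add: algebra_simps power2_eq_square)
        hence "r / \<beta> * (\<beta>\<^sup>2 + 2 * \<beta> + k + 1) \<le> r / \<beta> * (\<beta> * (\<beta> + 2 + (k + 1) * \<gamma>))"
          using r \<beta> by (intro mult_left_mono) auto
        also have "\<dots> = r * (\<beta> + 2 + (k + 1) * \<gamma>)" using \<beta> by simp
        finally show ?thesis using key by simp
      qed
      moreover have "P C (r / \<beta>) \<ge> 0"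
      proof -
        define x where "x = k - 1"
        define w where "w = \<beta> - (2/5 - x / 10)"
        have "w \<ge> 0"
        proof (rule ccontr)
          assume "\<not> w \<ge> 0"
          hence l: "\<beta> < 2/5 - x / 10" by (simp add: w_def)
          hence "\<beta> * \<gamma> < (2/5 - x / 10) * (2/5 - x / 10 + x + 2)"
            unfolding \<gamma>_def x_def using \<beta> k by (intro mult_strict_mono) auto
          \<comment> \<open>The line \<open>2/5 - x/10\<close> is tangent to the curve \<open>\<beta>\<gamma> = 1\<close> at \<open>x = 2/3\<close>.\<close>
          also have "\<dots> = 1 - (1/5 - 3/10 * x)\<^sup>2" by (simp add: power2_eq_square field_simps)
          finally show False using False by (smt (verit) zero_le_power2)
        qed
        hence "2 * (k + 1) * (k * \<beta> * (k + \<gamma>\<^sup>2)) - 46/125 * ((\<gamma> * \<beta> + k) * (k * \<beta> + \<gamma>^3)) \<ge> 0"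
          using corner_poly_small[of x w] k True by (simp add: x_def w_def \<gamma>_def)
        hence "r / (k\<^sup>2 * \<beta>) * (2 * (k + 1) * (k * \<beta> * (k + \<gamma>\<^sup>2)) - r * ((\<gamma> * \<beta> + k) * (k * \<beta> + \<gamma>^3))) \<ge> 0"
          using r k \<beta> by (intro mult_nonneg_nonneg) (auto simp: r_def)
        also have "\<dots> = P C (r / \<beta>)"
          using k \<beta> unfolding P_def C_def by (simp add: field_simps eval_nat_numeral)
        finally show ?thesis .
      qed
      ultimately show thesis using that by blast
    next
      case False
      have "ln (1 / \<beta>) \<le> 1 / \<beta> - 1" using \<beta> by (intro ln_le_minus_one) auto
      hence "B \<le> 1 / \<beta> - 1" using \<beta> by (simp add: B_def ln_div)
      also have "\<dots> \<le> 1/4" using False \<beta> by (simp add: field_simps)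
      finally have "B \<le> 1/4" .
      moreover have "1/4 * (\<beta>\<^sup>2 + 2 * \<beta> + k + 1) \<le> 2 * k * (1 + \<beta>)"
      proof -
        have "\<beta>\<^sup>2 \<le> 1" using \<beta> by (simp add: power_le_one)
        hence "1/4 * (\<beta>\<^sup>2 + 2 * \<beta> + k + 1) \<le> 2 * k * 1" using k \<beta> by simp
        also have "\<dots> \<le> 2 * k * (1 + \<beta>)" using k \<beta> by (intro mult_left_mono) auto
        finally show ?thesis .
      qed
      moreover have "P C (1/4) \<ge> 0"
      proof -
        define x w where "x = k - 1" and "w = 1 - \<beta>"
        have "8 * (k + 1) * (k * (k * \<beta> + 184/125 * \<gamma>\<^sup>2)) - 
           (184/125 * \<gamma> + k) * (k * \<beta>\<^sup>2 + 184/125 * \<gamma>^3) \<ge> 0"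
          using corner_poly_large[of x w] k False \<beta> by (simp add: x_def w_def \<gamma>_def)
        hence "1 / (16 * k\<^sup>2) * (8 * (k + 1) * (k * (k * \<beta> + 4 * r * \<gamma>\<^sup>2)) - 
           (4 * r * \<gamma> + k) * (k * \<beta>\<^sup>2 + 4 * r * \<gamma>^3)) \<ge> 0"
          using k by (intro mult_nonneg_nonneg) (auto simp: r_def)
        also have "\<dots> = P C (1/4)"
          using k unfolding P_def C_def by (simp add: field_simps eval_nat_numeral)
        finally show ?thesis .
      qed
      ultimately show thesis using that by blast
    qed
    have "P C 0 \<ge> 0" by (rule P_B0) (use C in auto)
    hence "P C B \<ge> 0" using B D by (intro conc_B[of 0 B D]) auto
    moreover have "P (B / k) B \<ge> 0"
    proof -
      have "B * (\<beta>\<^sup>2 + 2 * \<beta> + k + 1) \<le> D * (\<beta>\<^sup>2 + 2 * \<beta> + k + 1)"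
        using D k \<beta> by (intro mult_right_mono) auto
      hence "B / k * (\<beta>\<^sup>2 + 2 * \<beta> + k + 1) \<le> 2 * (1 + \<beta>)"
        using D(2) k by (simp add: field_simps)
      thus ?thesis using P_diag[of "B / k"] B k by simp
    qed
    moreover have "B / k \<le> A" using BA k by (simp add: field_simps)
    ultimately show ?thesis using AC by (intro conc_A[of "B / k" A C]) auto
  qed
  thus ?thesis by (simp add: P_def)
qed

text \<open>With \<open>c a = (N+1) a - 1\<close>, one has \<open>phi = A / S\<close> where \<open>A\<close> is the logarithm of the larger slope and \<open>S\<close> the
  logarithm of the quotient of the slopes. In \<open>phi_convexity_inequality\<close> take \<open>k = (N+1)/N\<close> and
  \<open>\<beta> = (k+1) c a\<close>; then \<open>\<beta> + k + 1 = (k+1) (c a + 1)\<close>, and the common factor \<open>(k+1)\<^sup>2\<close> cancels.\<close>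

lemma phi_convex_right:
  assumes N: "N \<ge> 1"
  shows "convex_on {a0_tilde N..<a0_star N} (phi N)"
proof -
  define c where "c a = (real N + 1) * a - 1" for a
  define A where "A a = ln ((2 * real N + 1) * a)" for a
  define S where "S a = ln (real N * a) - ln (c a)" for a
  have phi_AS: "phi N = (\<lambda>a. A a / S a)" by (simp add: fun_eq_iff phi_def A_def S_def c_def)
  define f' where "f' a = (S a + A a / c a) / (a * (S a)\<^sup>2)" for a
  define f'' where "f'' a = (- A a * (real N + 1) / (c a)\<^sup>2 * (a * (S a)\<^sup>2) - 
     (S a + A a / c a) * ((S a)\<^sup>2 - 2 * S a / c a)) / (a * (S a)\<^sup>2)\<^sup>2" for a
  have facts: "a > 0" "c a > 0" "S a > 0" "A a > 0" "a_min N < a" "c a = (real N + 1) * a - 1"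
    if "a \<in> {a0_tilde N..<a0_star N}" for a
  proof -
    show am: "a_min N < a" using that a0_tilde_bounds[OF N] by auto
    thus "a > 0" by (auto simp: a_min_def intro: less_trans[rotated])
    show "c a > 0" using am by (simp add: c_def a_min_def field_simps)
    have "ln (up_slope N a) > 0" "ln (down_slope N a) < 0"
      using slope_bounds[OF N am] down_slope_less_1[OF N, of a] that by auto
    thus "A a > 0" by (simp add: A_def up_slope_def)
    have "c a / real N < a"
    proof -
      have "b_par N a < a" using b_par_bounds[OF N am] a0_star_less_1[OF N] that by auto
      thus ?thesis by (simp add: b_par_def c_def)
    qed
    hence "c a < real N * a" using N by (simp add: field_simps)
    hence "ln (c a) < ln (real N * a)" using \<open>c a > 0\<close> \<open>a > 0\<close> N by (subst ln_less_cancel_iff) auto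
    thus "S a > 0" by (simp add: S_def)
  qed (simp add: c_def)
  have dA: "(A has_real_derivative 1 / a) (at a)" if "a \<in> {a0_tilde N..<a0_star N}" for a
    unfolding A_def using facts[OF that] 
    by (auto intro!: derivative_eq_intros simp: add_nonneg_eq_0_iff)
  have dc: "(c has_real_derivative real N + 1) (at a)" for a
    unfolding c_def by (auto intro!: derivative_eq_intros)
  have dS: "(S has_real_derivative - 1 / (a * c a)) (at a)" if "a \<in> {a0_tilde N..<a0_star N}" for a
  proof -
    have "(S has_real_derivative 1 / a - (real N + 1) / c a) (at a)"
      unfolding S_def using facts[OF that] N
      by (auto intro!: derivative_eq_intros dc simp: add_nonneg_eq_0_iff)
    also have "1 / a - (real N + 1) / c a = - 1 / (a * c a)"
    proof -
      have "1 / a - (real N + 1) / c a = (c a - (real N + 1) * a) / (a * c a)"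
        using facts(1,2)[OF that] by (simp add: field_simps)
      thus ?thesis by (simp add: c_def)
    qed
    finally show ?thesis .
  qed
  show ?thesis
  proof (rule f''_ge0_imp_convex[where f' = f' and f'' = f''])
    fix a assume a: "a \<in> {a0_tilde N..<a0_star N}"
    note f = facts[OF a]
    show "(phi N has_real_derivative f' a) (at a)"
    proof -
      have "(phi N has_real_derivative (1 / a * S a - A a * (- 1 / (a * c a))) / (S a * S a)) (at a)"
        unfolding phi_AS using f by (intro DERIV_divide dA dS a) auto
      also have "(1 / a * S a - A a * (- 1 / (a * c a))) / (S a * S a) = f' a"
        unfolding f'_def using f(1-3) by (simp add: field_simps power2_eq_square)
      finally show ?thesis .
    qed
    show "(f' has_real_derivative f'' a) (at a)"
    proof -
      have 1: "((\<lambda>a. S a + A a / c a) has_real_derivative - 1 / (a * c a) + (1 / a * c a - A a * (real N + 1)) / (c a * c a)) (at a)"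
        using f by (intro DERIV_add DERIV_divide dA dS dc a) auto
      have 1: "((\<lambda>a. S a + A a / c a) has_real_derivative - A a * (real N + 1) / (c a)\<^sup>2) (at a)"
      proof -
        have "- 1 / (a * c a) + (1 / a * c a - A a * (real N + 1)) / (c a * c a) = - A a * (real N + 1) / (c a)\<^sup>2"
          using f(1,2) by (simp add: field_simps power2_eq_square)
        thus ?thesis using 1 by simp
      qed
      have 2: "((\<lambda>a. a * (S a)\<^sup>2) has_real_derivative (S a)\<^sup>2 - 2 * S a / c a) (at a)"
        by (rule derivative_eq_intros dS a refl)+ (use f(1,2) in \<open>simp add: field_simps power2_eq_square\<close>)
      have "(f' has_real_derivative (- A a * (real N + 1) / (c a)\<^sup>2 * (a * (S a)\<^sup>2) - 
         (S a + A a / c a) * ((S a)\<^sup>2 - 2 * S a / c a)) / (a * (S a)\<^sup>2 * (a * (S a)\<^sup>2))) (at a)"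
        unfolding f'_def using f by (intro DERIV_divide 1 2) auto
      thus ?thesis by (simp only: f''_def power2_eq_square)
    qed
    show "f'' a \<ge> 0"
    proof -
      define k where "k = (real N + 1) / real N"
      define g where "g = k + 1"
      have N0: "real N > 0" "real N \<ge> 1" using N by auto
      have k: "1 \<le> k" "k \<le> 2" using N0 by (auto simp: k_def field_simps)
      have gD: "g = (2 * real N + 1) / real N" using N0 by (simp add: g_def k_def field_simps)
      define \<beta> where "\<beta> = down_slope N a"
      have \<beta>: "0 < \<beta>" "\<beta> < 1" using slope_bounds[OF N f(5)] down_slope_less_1[OF N] a by (auto simp: \<beta>_def)
      have \<beta>g: "\<beta> = g * c a" using N0 by (simp add: \<beta>_def down_slope_def b_par_def gD c_def)
      have \<gamma>: "\<beta> + k + 1 = g * (c a + 1)" by (simp add: \<beta>g g_def algebra_simps)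
      have \<alpha>: "g * (c a + 1) / k = (2 * real N + 1) * a" using N0 by (simp add: gD k_def c_def)
      have A: "A a = ln ((\<beta> + k + 1) / k)" unfolding \<gamma> \<alpha> by (simp add: A_def)
      have bal: "real N * (- ln \<beta>) \<le> (real N + 1) * A a" 
        using phi_ge(2)[OF N, of a] a by (simp add: log_balance_def \<beta>_def A_def up_slope_def)
      hence bal': "- ln \<beta> \<le> k * A a" using N0 by (simp add: k_def field_simps)
      have S: "S a = A a + (- ln \<beta>)"
        using N0 f(1,2) by (simp add: S_def A_def \<beta>_def down_slope_def b_par_def c_def[symmetric] ln_mult ln_div)
      have "(A a + - ln \<beta>) * (\<beta>\<^sup>2 * (- ln \<beta>) + (\<beta> + k + 1)\<^sup>2 * A a) \<le> 2 * (k + 1) * (\<beta> * (- ln \<beta>) + (\<beta> + k + 1) * A a)"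
        using phi_convexity_inequality[OF k \<beta>] bal' unfolding A by simp
      hence "S a * ((g * c a)\<^sup>2 * (S a - A a) + (g * (c a + 1))\<^sup>2 * A a) \<le> 2 * g * (g * c a * (S a - A a) + g * (c a + 1) * A a)"
        unfolding \<gamma> unfolding \<beta>g g_def[symmetric] S by simp
      hence "0 \<le> g\<^sup>2 * (2 * (c a * S a + A a) - S a * ((c a)\<^sup>2 * S a + 2 * c a * A a + A a))"
        by (simp add: power2_eq_square algebra_simps)
      hence "0 \<le> 2 * (c a * S a + A a) - S a * ((c a)\<^sup>2 * S a + 2 * c a * A a + A a)"
        using k by (simp add: zero_le_mult_iff g_def)
      hence "0 \<le> S a / (c a)\<^sup>2 * (2 * (c a * S a + A a) - S a * ((c a)\<^sup>2 * S a + 2 * c a * A a + A a))"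
        using f by (intro mult_nonneg_nonneg) auto
      also have "\<dots> = - A a * (c a + 1) / (c a)\<^sup>2 * (S a)\<^sup>2 - (S a + A a / c a) * ((S a)\<^sup>2 - 2 * S a / c a)"
        using f(2) by (simp add: field_simps power2_eq_square)
      also have "\<dots> = - A a * (real N + 1) / (c a)\<^sup>2 * (a * (S a)\<^sup>2) - (S a + A a / c a) * ((S a)\<^sup>2 - 2 * S a / c a)"
        by (simp add: c_def)
      finally show ?thesis unfolding f''_def by (rule divide_nonneg_nonneg) auto
    qed
  qed auto
qed

text \<open>The tangent \<open>l\<close> to the entropy at \<open>phi N z\<close> lies above the entropy. Its slope \<open>ln v - ln u\<close> is not positive,
  as \<open>phi N z \<ge> N/(2N+1)\<close>; hence it reverses the convexity inequality of \<open>phi\<close>.\<close>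

lemma entropy_phi_concave_right:
  assumes N: "N \<ge> 1"
  shows "concave_on {a0_tilde N..<a0_star N} (\<lambda>a. entropy N (phi N a))"
  unfolding concave_on_iff
proof (intro conjI ballI allI impI)
  fix x y s t :: real
  assume x: "x \<in> {a0_tilde N..<a0_star N}" and y: "y \<in> {a0_tilde N..<a0_star N}" 
    and st: "0 \<le> s" "0 \<le> t" "s + t = 1"
  define z where "z = s * x + t * y"
  have z: "z \<in> {a0_tilde N..<a0_star N}"
    using convexD[OF _ x y st] by (simp add: z_def)
  have am: "a_min N < w" if "w \<in> {a0_tilde N..<a0_star N}" for w
    using that a0_tilde_bounds[OF N] by auto
  define p where "p = phi N z"
  have p01: "0 < p" "p < 1" using phi_bounds[OF N am[OF z]] z by (auto simp: p_def)
  define u v where "u = p / real N" and "v = (1 - p) / (real N + 1)"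
  have uv: "u > 0" "v > 0" "real N * u + (real N + 1) * v = 1"
    using p01 N by (auto simp: u_def v_def)
  define l where "l w = - w * ln u - (1 - w) * ln v" for w
  have "real N / (2 * real N + 1) \<le> p" using phi_ge[OF N, of z] z by (auto simp: p_def)
  hence "v \<le> u" unfolding u_def v_def using N by (simp add: field_simps)
  hence uvln: "ln v \<le> ln u" using uv by simp
  have le: "entropy N (phi N w) \<le> l (phi N w)" if "w \<in> {a0_tilde N..<a0_star N}" for w
    unfolding l_def using that am[OF that] by (intro entropy_le phi_bounds N uv) auto
  have "s * entropy N (phi N x) + t * entropy N (phi N y) \<le> s * l (phi N x) + t * l (phi N y)"
    using le x y st by (intro add_mono mult_left_mono) auto
  also have "\<dots> = l (s * phi N x + t * phi N y) + (s + t - 1) * (- ln v)" unfolding l_def by algebra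
  also have "\<dots> = l (s * phi N x + t * phi N y)" using st by simp
  also have "\<dots> \<le> l p"
  proof -
    have cv: "p \<le> s * phi N x + t * phi N y"
      using phi_convex_right[OF N, unfolded convex_on_def] x y st unfolding p_def z_def by auto
    have "l p - l (s * phi N x + t * phi N y) = (s * phi N x + t * phi N y - p) * (ln u - ln v)"
      unfolding l_def by algebra
    also have "\<dots> \<ge> 0" using cv uvln by (intro mult_nonneg_nonneg) auto
    finally show ?thesis by simp
  qed
  also have "l p = entropy N (phi N z)" by (simp add: l_def entropy_def p_def u_def v_def)
  finally show "s * entropy N (phi N x) + t * entropy N (phi N y) \<le> entropy N (phi N (s *\<^sub>R x + t *\<^sub>R y))"
    by (simp add: z_def)
qed auto

text \<open>If \<open>m\<close> lies between \<open>x\<close> and \<open>y\<close>, say \<open>x < z \<le> m < y\<close>, then raising the value at \<open>y\<close> to \<open>f m\<close> and moving \<open>y\<close>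
  back to \<open>m\<close> only raises the chord at \<open>z\<close>, and the new chord lies below \<open>f\<close>.\<close>

lemma concave_on_glue_at_max:
  fixes f :: "real \<Rightarrow> real"
  assumes "concave_on {l<..m} f" "concave_on {m..<r} f" "l < m" "m < r" "\<And>x. x \<in> {l<..<r} \<Longrightarrow> f x \<le> f m"
  shows "concave_on {l<..<r} f"
proof (rule concave_on_linorderI)
  fix t x y :: real
  assume t: "0 < t" "t < 1" and x: "x \<in> {l<..<r}" and y: "y \<in> {l<..<r}" and "x < y"
  define z where "z = (1 - t) * x + t * y"
  have z: "x < z" "z < y" 
  proof -
    have "t * (y - x) > 0" "(1 - t) * (y - x) > 0" using t \<open>x < y\<close> by auto
    thus "x < z" "z < y" by (simp_all add: z_def algebra_simps)
  qed
  have two: "(1 - s) * f a + s * f b \<le> f ((1 - s) * a + s * b)" 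
    if "a \<in> I" "b \<in> I" "concave_on I f" "0 \<le> s" "s \<le> 1" for a b s I
    using concave_on_iff[THEN iffD1, OF that(3), THEN conjunct2, rule_format, of a b "1 - s" s] that by simp
  have "(1 - t) * f x + t * f y \<le> f z"
  proof (cases "y \<le> m \<or> m \<le> x")
    case True
    thus ?thesis unfolding z_def using two[OF _ _ assms(1), of x y t] two[OF _ _ assms(2), of x y t] x y \<open>x < y\<close> t by auto
  next
    case False
    hence m: "x < m" "m < y" by auto
    show ?thesis
    proof (cases "z \<le> m")
      case True
      define s where "s = (z - x) / (m - x)"
      have s: "0 \<le> s" "s \<le> 1" using z True m by (auto simp: s_def)
      have zs: "z = (1 - s) * x + s * m"
      proof -
        have "s * (m - x) = z - x" using m by (simp add: s_def)
        thus ?thesis by (simp add: algebra_simps)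
      qed
      have "t \<le> s"
      proof -
        have "t * (m - x) \<le> t * (y - x)" using m t by (intro mult_left_mono) auto
        also have "\<dots> = z - x" by (simp add: z_def algebra_simps)
        finally show ?thesis using m by (simp add: s_def field_simps)
      qed
      have "(1 - t) * f x + t * f y \<le> (1 - t) * f x + t * f m"
        using assms(5)[OF y] t by simp
      also have "\<dots> = f x + t * (f m - f x)" by (simp add: algebra_simps)
      also have "\<dots> \<le> f x + s * (f m - f x)"
        using \<open>t \<le> s\<close> assms(5)[OF x] by (intro add_left_mono mult_right_mono) auto
      also have "\<dots> = (1 - s) * f x + s * f m" by (simp add: algebra_simps)
      also have "\<dots> \<le> f z" unfolding zs using x m s assms(3) by (intro two[OF _ _ assms(1)]) auto
      finally show ?thesis .
    next
      case False
      define s where "s = (z - m) / (y - m)"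
      have s: "0 \<le> s" "s \<le> 1" using z False m by (auto simp: s_def)
      have zs: "z = (1 - s) * m + s * y"
      proof -
        have "s * (y - m) = z - m" using m by (simp add: s_def)
        thus ?thesis by (simp add: algebra_simps)
      qed
      have "s \<le> t"
      proof -
        have "(1 - t) * (y - m) \<le> (1 - t) * (y - x)" using m t by (intro mult_left_mono) auto
        also have "\<dots> = y - z" by (simp add: z_def algebra_simps)
        finally have "z - m \<le> t * (y - m)" by (simp add: algebra_simps)
        thus ?thesis using m by (simp add: s_def field_simps)
      qed
      have "(1 - t) * f x + t * f y \<le> (1 - t) * f m + t * f y"
        using assms(5)[OF x] t by simp
      also have "\<dots> = f m - t * (f m - f y)" by (simp add: algebra_simps)
      also have "\<dots> \<le> f m - s * (f m - f y)"
        using \<open>s \<le> t\<close> assms(5)[OF y] by (intro diff_left_mono mult_right_mono) auto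
      also have "\<dots> = (1 - s) * f m + s * f y" by (simp add: algebra_simps)
      also have "\<dots> \<le> f z" unfolding zs using y m s assms(4) by (intro two[OF _ _ assms(2)]) auto
      finally show ?thesis .
    qed
  qed
  thus "(1 - t) * f x + t * f y \<le> f ((1 - t) *\<^sub>R x + t *\<^sub>R y)" by (simp add: z_def)
qed auto

section \<open>Limits and the maximum of the dimension function\<close>

lemma entropy_tendsto_at_0:
  assumes "N \<ge> 1"
  shows "(entropy N \<longlongrightarrow> ln (real N + 1)) (at_right 0)"
proof -
  have "real N > 0" using assms by simp
  hence "(entropy N \<longlongrightarrow> - ln (inverse (real N + 1))) (at_right 0)"
    unfolding entropy_def by real_asymp
  thus ?thesis by (simp add: ln_inverse)
qed

lemma entropy_tendsto_at_1:
  assumes "N \<ge> 1"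
  shows "(entropy N \<longlongrightarrow> ln (real N)) (at_left 1)"
proof -
  have "real N > 0" using assms by simp
  hence "(entropy N \<longlongrightarrow> - ln (inverse (real N))) (at_left 1)"
    unfolding entropy_def by real_asymp
  thus ?thesis using assms by (simp add: ln_inverse)
qed

lemma phi_tendsto_at_a_min:
  assumes N: "N \<ge> 1"
  shows "filterlim (phi N) (at_right 0) (at_right (a_min N))"
  unfolding filterlim_at
proof
  have am: "a_min N > 0" "(real N + 1) * a_min N = 1" by (simp_all add: a_min_def add_nonneg_eq_0_iff)
  show "\<forall>\<^sub>F a in at_right (a_min N). phi N a \<in> {0<..} \<and> phi N a \<noteq> 0"
    using eventually_at_right_real[OF a_min_less_a0_star[OF N]]
  proof eventually_elim
    case (elim a)
    thus ?case using phi_bounds[OF N, of a] by auto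
  qed
  have "filterlim (\<lambda>a. (real N + 1) * a - 1) (at_right 0) (at_right (a_min N))"
    unfolding filterlim_at
  proof
    have "((\<lambda>a. (real N + 1) * a - 1) \<longlongrightarrow> (real N + 1) * a_min N - 1) (at_right (a_min N))"
      by (intro tendsto_intros)
    thus "((\<lambda>a. (real N + 1) * a - 1) \<longlongrightarrow> 0) (at_right (a_min N))" using am by simp
    show "\<forall>\<^sub>F a in at_right (a_min N). (real N + 1) * a - 1 \<in> {0<..} \<and> (real N + 1) * a - 1 \<noteq> 0"
      unfolding eventually_at_right_field
      by (intro exI[of _ "a_min N + 1"]) (auto simp: a_min_def field_simps)
  qed
  hence ln_bot: "filterlim (\<lambda>a. ln ((real N + 1) * a - 1)) at_bot (at_right (a_min N))"
    by (rule filterlim_compose[OF ln_at_0])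
  have "filterlim (\<lambda>a. ln (real N * a) - ln ((real N + 1) * a - 1)) at_top (at_right (a_min N))"
    unfolding diff_conv_add_uminus
    by (rule filterlim_tendsto_add_at_top[where c = "ln (real N * a_min N)"])
       (use am N ln_bot in \<open>auto intro!: tendsto_eq_intros simp: filterlim_uminus_at_bot\<close>)
  moreover have "((\<lambda>a. ln ((2 * real N + 1) * a)) \<longlongrightarrow> ln ((2 * real N + 1) * a_min N)) (at_right (a_min N))"
    using am by (intro tendsto_intros) (auto simp: add_nonneg_eq_0_iff)
  ultimately show "(phi N \<longlongrightarrow> 0) (at_right (a_min N))"
    unfolding phi_def by (intro tendsto_divide_0 filterlim_at_top_imp_at_infinity)
qed

lemma phi_tendsto_at_a0_star:
  assumes N: "N \<ge> 1"
  shows "filterlim (phi N) (at_left 1) (at_left (a0_star N))"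
  unfolding filterlim_at
proof
  define s where "s = a0_star N"
  show "\<forall>\<^sub>F a in at_left (a0_star N). phi N a \<in> {..<1} \<and> phi N a \<noteq> 1"
    using eventually_at_left_real[OF a_min_less_a0_star[OF N]]
  proof eventually_elim
    case (elim a)
    thus ?case using phi_bounds[OF N, of a] by auto
  qed
  have s: "a_min N < s" unfolding s_def by (rule a_min_less_a0_star[OF N])
  have sl: "1 < up_slope N s" using slope_bounds[OF N s] by simp
  have e: "(real N + 1) * s = (3 * real N + 1) / (2 * real N + 1)"
    by (simp add: s_def a0_star_def add_nonneg_eq_0_iff)
  have e2: "(real N + 1) * s - 1 = real N / (2 * real N + 1)"
    unfolding e by (simp add: divide_diff_eq_iff add_nonneg_eq_0_iff)
  have s0: "s > 0" using s by (auto simp: a_min_def intro: less_trans[rotated])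
  have N0: "real N > 0" using N by simp
  have D: "ln (real N * s) - ln ((real N + 1) * s - 1) = ln (up_slope N s)"
    unfolding e2 up_slope_def using N0 s0 by (simp add: ln_mult ln_div)
  have "(phi N \<longlongrightarrow> ln ((2 * real N + 1) * s) / (ln (real N * s) - ln ((real N + 1) * s - 1))) (at_left s)"
    unfolding phi_def using s0 N0 sl D e2
    by (intro tendsto_intros) (auto simp: add_nonneg_eq_0_iff)
  also have "ln ((2 * real N + 1) * s) / (ln (real N * s) - ln ((real N + 1) * s - 1)) = 1"
    unfolding D using sl by (simp add: up_slope_def)
  finally show "(phi N \<longlongrightarrow> 1) (at_left (a0_star N))" by (simp add: s_def)
qed

lemma entropy_phi_max:
  assumes "N \<ge> 1" "a \<in> {a_min N<..<a0_star N}"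
  shows "entropy N (phi N a) \<le> entropy N (phi N (a0_tilde N))"
  unfolding phi_a0_tilde[OF assms(1)] entropy_critical[OF assms(1)]
  using assms by (intro entropy_le_ln_base phi_bounds) auto

lemma dimension_function_shape:
  assumes N: "N \<ge> 1"
  shows "concave_on {a_min N<..<a0_star N} (\<lambda>a. h_fun N (phi N a))"
    "h_fun N (phi N (a0_tilde N)) = 1"
    "\<And>a. a \<in> {a_min N<..<a0_star N} \<Longrightarrow> h_fun N (phi N a) \<le> 1"
    "((\<lambda>a. h_fun N (phi N a)) \<longlongrightarrow> ln (real N + 1) / ln (2 * real N + 1)) (at_right (a_min N))"
    "((\<lambda>a. h_fun N (phi N a)) \<longlongrightarrow> ln (real N) / ln (2 * real N + 1)) (at_left (a0_star N))"
proof -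
  have L: "ln (2 * real N + 1) > 0" using N by simp
  have "concave_on {a_min N<..<a0_star N} (\<lambda>a. entropy N (phi N a))"
    using entropy_phi_max[OF N] a0_tilde_bounds[OF N]
    by (intro concave_on_glue_at_max[OF entropy_phi_concave_left[OF N] entropy_phi_concave_right[OF N]])
  thus "concave_on {a_min N<..<a0_star N} (\<lambda>a. h_fun N (phi N a))"
    unfolding h_fun_eq_entropy using L by (intro concave_on_cdiv) auto
  show "h_fun N (phi N (a0_tilde N)) = 1"
    using L by (simp add: h_fun_eq_entropy phi_a0_tilde[OF N] entropy_critical[OF N])
  show "h_fun N (phi N a) \<le> 1" if "a \<in> {a_min N<..<a0_star N}" for a
    using entropy_le_ln_base[OF N phi_bounds[OF N]] that L by (simp add: h_fun_eq_entropy)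
  show "((\<lambda>a. h_fun N (phi N a)) \<longlongrightarrow> ln (real N + 1) / ln (2 * real N + 1)) (at_right (a_min N))"
    unfolding h_fun_eq_entropy using L
    by (intro tendsto_divide tendsto_const filterlim_compose[OF entropy_tendsto_at_0[OF N] phi_tendsto_at_a_min[OF N]]) auto
  show "((\<lambda>a. h_fun N (phi N a)) \<longlongrightarrow> ln (real N) / ln (2 * real N + 1)) (at_left (a0_star N))"
    unfolding h_fun_eq_entropy using L
    by (intro tendsto_divide tendsto_const filterlim_compose[OF entropy_tendsto_at_1[OF N] phi_tendsto_at_a0_star[OF N]]) auto
qed

section \<open>The dimension of sets of prescribed digit frequency\<close>

lemma card_odd_digits:
  "card {m. m < (2 * N + 1) ^ L \<and> odd_digits (2 * N + 1) L m = K} = (L choose K) * N ^ K * (N + 1) ^ (L - K)"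
proof -
  define d where "d = 2 * N + 1"
  define c where "c L K = (\<Sum>m<d ^ L. of_bool (odd_digits d L m = K) :: nat)" for L K
  have "c L K = (L choose K) * N ^ K * (N + 1) ^ (L - K)"
  proof (induction L arbitrary: K)
    case 0
    show ?case by (cases K) (auto simp: c_def)
  next
    case (Suc L)
    have "c (Suc L) K = (\<Sum>m<d ^ L * d. of_bool (odd_digits d L (m div d) + of_bool (odd (m mod d)) = K))"
      by (simp add: c_def mult.commute)
    also have "\<dots> = (\<Sum>q<d ^ L. \<Sum>r<d. of_bool (odd_digits d L q + of_bool (odd r) = K))"
      by (rule sum_lessThan_mult_div_mod) (simp add: d_def)
    also have "\<dots> = (\<Sum>q<d ^ L. N * of_bool (odd_digits d L q + 1 = K) + (N + 1) * of_bool (odd_digits d L q = K))"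
    proof (rule sum.cong[OF refl])
      fix q
      show "(\<Sum>r<d. of_bool (odd_digits d L q + of_bool (odd r) = K)) =
          N * of_bool (odd_digits d L q + 1 = K) + (N + 1) * of_bool (odd_digits d L q = K)"
        using sum_digits_by_parity[of "\<lambda>b. of_bool (odd_digits d L q + of_bool b = K) :: nat" N]
        unfolding d_def by (simp only: of_nat_id of_bool_eq add_0_right)
    qed
    also have "\<dots> = N * (\<Sum>q<d ^ L. of_bool (odd_digits d L q + 1 = K)) + (N + 1) * c L K"
      unfolding c_def by (simp only: sum.distrib sum_distrib_left)
    finally have rec: "c (Suc L) K = N * (\<Sum>q<d ^ L. of_bool (odd_digits d L q + 1 = K)) + (N + 1) * c L K" .
    show ?case
    proof (cases K)
      case 0
      thus ?thesis using rec Suc.IH[of 0] by simp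
    next
      case (Suc K')
      have "c (Suc L) K = N * c L K' + (N + 1) * c L (Suc K')" using rec Suc by (simp add: c_def)
      also have "\<dots> = N * ((L choose K') * N ^ K' * (N + 1) ^ (L - K')) + 
         (N + 1) * ((L choose Suc K') * N ^ Suc K' * (N + 1) ^ (L - Suc K'))"
        by (simp only: Suc.IH)
      also have "(N + 1) * ((L choose Suc K') * N ^ Suc K' * (N + 1) ^ (L - Suc K')) = 
         (L choose Suc K') * N ^ Suc K' * (N + 1) ^ (L - K')"
      proof (cases "Suc K' \<le> L")
        case True
        hence "L - K' = Suc (L - Suc K')" by simp
        thus ?thesis by (simp only: power_Suc mult_ac)
      qed simp
      also have "N * ((L choose K') * N ^ K' * (N + 1) ^ (L - K')) + (L choose Suc K') * N ^ Suc K' * (N + 1) ^ (L - K')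
         = ((L choose K') + (L choose Suc K')) * N ^ Suc K' * (N + 1) ^ (L - K')"
        by (simp add: algebra_simps)
      finally show ?thesis using Suc by simp
    qed
  qed
  moreover have "c L K = card {m. m < d ^ L \<and> odd_digits d L m = K}"
  proof -
    have "c L K = (\<Sum>m\<in>{m \<in> {..<d ^ L}. odd_digits d L m = K}. 1)"
      unfolding c_def by (simp add: sum.If_cases of_bool_def Int_def)
    thus ?thesis by simp
  qed
  ultimately show ?thesis by (simp add: d_def)
qed

text \<open>Up to the factor \<open>L\<^bsup>L\<^esup>\<close>, the numbers \<open>T j\<close> are the binomial probabilities with parameter \<open>K/L\<close>. They
  increase up to \<open>j = K\<close> and decrease afterwards, so the largest of these \<open>L + 1\<close> numbers is \<open>T K\<close>.\<close>

lemma binomial_mode: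
  assumes "K \<le> L"
  shows "L ^ L \<le> (L + 1) * ((L choose K) * K ^ K * (L - K) ^ (L - K))"
proof (cases "K = L")
  case False
  define Q where "Q = L - K"
  have Q: "Q > 0" "L = K + Q" using assms False by (auto simp: Q_def)
  define T where "T j = (L choose j) * K ^ j * Q ^ (L - j)" for j
  have ratio: "(j + 1) * Q * T (Suc j) = (L - j) * K * T j" if "j < L" for j
  proof -
    have "L - j = Suc (L - Suc j)" using that by simp
    hence 1: "Q ^ (L - j) = Q * Q ^ (L - Suc j)" by (simp only: power_Suc)
    have 2: "(j + 1) * (L choose Suc j) = (L - j) * (L choose j)"
      using binomial_absorb_comp[of L j] binomial_absorption[of j L] by (simp add: algebra_simps)
    have "(j + 1) * Q * T (Suc j) = ((j + 1) * (L choose Suc j)) * (K * K ^ j) * (Q * Q ^ (L - Suc j))"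
      by (simp only: T_def power_Suc mult_ac)
    also have "\<dots> = (L - j) * K * T j"
      unfolding 2 1[symmetric] by (simp only: T_def mult_ac)
    finally show ?thesis .
  qed
  have up: "T j \<le> T (Suc j)" if "j < K" for j
  proof -
    have "(j + 1) * Q * T j \<le> (L - j) * K * T j"
    proof (rule mult_right_mono)
      have "(j + 1) * Q \<le> K * Q" using that by (intro mult_right_mono) auto
      also have "\<dots> \<le> K * (L - j)" using that Q by (intro mult_left_mono) auto
      finally show "(j + 1) * Q \<le> (L - j) * K" by (simp add: mult.commute)
    qed simp
    also have "\<dots> = (j + 1) * Q * T (Suc j)" using that Q by (subst ratio) auto
    finally show ?thesis using Q by simp
  qed
  have down: "T (Suc j) \<le> T j" if "K \<le> j" "j < L" for j
  proof -
    have "(j + 1) * Q * T (Suc j) = (L - j) * K * T j" using that by (intro ratio)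
    also have "\<dots> \<le> (j + 1) * Q * T j"
    proof (rule mult_right_mono)
      have "(L - j) * K \<le> Q * K" using that by (intro mult_right_mono) (auto simp: Q_def)
      also have "\<dots> \<le> Q * (j + 1)" using that by (intro mult_left_mono) auto
      finally show "(L - j) * K \<le> (j + 1) * Q" by (simp add: mult.commute)
    qed simp
    finally show ?thesis using Q by simp
  qed
  have max: "T j \<le> T K" if "j \<le> L" for j
  proof (cases "j \<le> K")
    case True
    thus ?thesis
    proof (induction j rule: inc_induct)
      case (step j)
      thus ?case using up[of j] by simp
    qed simp
  next
    case False
    hence "K \<le> j" by simp
    thus ?thesis using that
    proof (induction j rule: dec_induct)
      case (step j)
      thus ?case using down[of j] by simp
    qed simp
  qed
  have "L ^ L = (\<Sum>j\<le>L. T j)"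
    using binomial[of K Q L] Q by (simp add: T_def)
  also have "\<dots> \<le> (\<Sum>j\<le>L. T K)" by (intro sum_mono max) auto
  also have "\<dots> = (L + 1) * T K" by simp
  finally show ?thesis by (simp only: T_def Q_def)
qed simp

lemma ln_card_odd_digits_ge:
  assumes N: "N \<ge> 1" and KL: "0 < K" "K < L"
  shows "real L * entropy N (real K / real L) - ln (real L + 1) \<le> 
    ln (real (card {m. m < (2 * N + 1) ^ L \<and> odd_digits (2 * N + 1) L m = K}))"
proof -
  define x y l where "x = real K" and "y = real (L - K)" and "l = real L"
  have pos: "x > 0" "y > 0" "l > 0" "l = x + y" using KL by (auto simp: x_def y_def l_def)
  define C where "C = real (L choose K)"
  have C: "C > 0" using KL by (simp add: C_def)
  have n: "real N > 0" using N by simp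
  have "real (L ^ L) \<le> real ((L + 1) * ((L choose K) * K ^ K * (L - K) ^ (L - K)))"
    using binomial_mode[of K L] KL by (subst of_nat_le_iff) auto
  hence "l ^ L \<le> (l + 1) * (C * x ^ K * y ^ (L - K))"
    unfolding x_def y_def l_def C_def by (simp only: of_nat_mult of_nat_power of_nat_add of_nat_1 mult.assoc)
  hence "ln (l ^ L) \<le> ln ((l + 1) * (C * x ^ K * y ^ (L - K)))"
    using pos C by (subst ln_le_cancel_iff) (auto intro!: mult_pos_pos)
  also have "\<dots> = ln (l + 1) + (ln C + x * ln x + y * ln y)"
    using pos C by (simp add: ln_mult ln_realpow x_def[symmetric] y_def[symmetric])
  also have "ln (l ^ L) = l * ln l" using pos by (simp add: ln_realpow l_def)
  finally have main: "l * ln l \<le> ln (l + 1) + (ln C + x * ln x + y * ln y)" .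
  have "ln (real (card {m. m < (2 * N + 1) ^ L \<and> odd_digits (2 * N + 1) L m = K})) = 
     ln (C * real N ^ K * (real N + 1) ^ (L - K))"
    unfolding card_odd_digits by (simp add: C_def add.commute)
  also have "\<dots> = ln C + x * ln (real N) + y * ln (real N + 1)"
    using C n by (simp add: ln_mult ln_realpow x_def[symmetric] y_def[symmetric])
  finally have card: "ln (real (card {m. m < (2 * N + 1) ^ L \<and> odd_digits (2 * N + 1) L m = K})) = 
     ln C + x * ln (real N) + y * ln (real N + 1)" .
  have "1 - x / l = y / l" using pos by (simp add: field_simps)
  hence "l * entropy N (x / l) = - (l * (x / l) * ln (x / l / real N) + l * (y / l) * ln (y / l / (real N + 1)))"
    by (simp only: entropy_def mult_minus_right distrib_left mult.assoc)
  also have "\<dots> = - (x * (ln x - ln l - ln (real N)) + y * (ln y - ln l - ln (real N + 1)))"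
  proof -
    have "ln (x / l / real N) = ln x - ln l - ln (real N)" using pos n by (simp add: ln_div ln_mult)
    moreover have "ln (y / l / (real N + 1)) = ln y - ln l - ln (real N + 1)" using pos n by (simp add: ln_div ln_mult)
    ultimately show ?thesis using pos by simp
  qed
  also have "\<dots> = l * ln l - x * ln x - y * ln y + x * ln (real N) + y * ln (real N + 1)"
    unfolding pos(4) by (simp add: algebra_simps)
  finally show ?thesis using main unfolding card by (simp add: x_def[symmetric] l_def[symmetric])
qed

text \<open>A block length \<open>L\<close> costs \<open>ln (L + 1) / L\<close> in the exponent. Replacing \<open>(K0, L0)\<close> by a large common multiple
  makes this smaller than the given margin without changing the frequency \<open>p\<close>.\<close>

lemma hausdorff_measure_frequency_set_nonzero:
  fixes S :: "real set"
  assumes N: "N \<ge> 1" and p: "p \<in> \<rat>" "0 < p" "p < 1" and s: "s \<ge> 0" "s * ln (2 * real N + 1) < entropy N p"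
    and S: "\<And>x C. 0 < x \<Longrightarrow> x < 1 \<Longrightarrow> (\<And>n. \<bar>real (odd_count (2 * N + 1) x n) - real n * p\<bar> \<le> C) \<Longrightarrow> x \<in> S"
  shows "hausdorff_measure s S \<noteq> 0"
proof -
  obtain K0 L0 :: nat where KL0: "p = real K0 / real L0" "L0 \<noteq> 0"
    using Rats_abs_nat_div_natE[OF p(1)] p(2) by (metis abs_of_pos)
  have K0: "0 < K0" "K0 < L0" using p KL0 by (auto intro!: Nat.gr0I simp: field_simps)
  define c where "c = entropy N p - s * ln (2 * real N + 1)"
  have "c > 0" using s by (simp add: c_def)
  hence "\<forall>\<^sub>F L in sequentially. ln (real L + 1) \<le> c * real L" by real_asymp
  then obtain n0 where n0: "\<And>L. L \<ge> n0 \<Longrightarrow> ln (real L + 1) \<le> c * real L"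
    unfolding eventually_sequentially by blast
  define j where "j = Suc n0"
  define K L where "K = K0 * j" and "L = L0 * j"
  have j: "j > 0" by (simp add: j_def)
  have KL: "0 < K" "K < L" "real K / real L = p" using K0 KL0 j by (auto simp: K_def L_def)
  have "1 * j \<le> L0 * j" using K0 by (intro mult_le_mono1) auto
  hence "L \<ge> n0" by (simp add: L_def j_def)
  define d where "d = 2 * N + 1"
  have d: "real d = 2 * real N + 1" "real d > 0" by (auto simp: d_def)
  define M where "M = card {m. m < d ^ L \<and> odd_digits d L m = K}"
  have M0: "M > 0" unfolding M_def d_def card_odd_digits using KL N by simp
  have "real (d ^ L) powr s = exp (real L * (s * ln (2 * real N + 1)))"
    using d by (simp add: powr_def ln_realpow mult_ac)
  also have "\<dots> \<le> exp (ln (real M))"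
  proof (subst exp_le_cancel_iff)
    have "real L * (s * ln (2 * real N + 1)) = real L * entropy N p - c * real L"
      by (simp add: c_def algebra_simps)
    also have "\<dots> \<le> real L * entropy N p - ln (real L + 1)" using n0[OF \<open>L \<ge> n0\<close>] by simp
    also have "\<dots> \<le> ln (real M)" using ln_card_odd_digits_ge[OF N KL(1,2)] unfolding KL(3) M_def d_def .
    finally show "real L * (s * ln (2 * real N + 1)) \<le> ln (real M)" .
  qed
  also have "\<dots> = real M" using M0 by simp
  finally have le: "real (d ^ L) powr s \<le> real M" .
  show ?thesis
  proof (rule hausdorff_measure_block_set_nonzero[of d K L])
    show "real (d ^ L) powr s \<le> real (card {m. m < d ^ L \<and> odd_digits d L m = K})" using le by (simp add: M_def)
    show "x \<in> S" if "0 < x" "x < 1" "\<And>n. \<bar>real (odd_count d x n) - real n * (real K / real L)\<bar> \<le> real K" for x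
      using S[OF that(1,2), of "real K"] that(3) unfolding KL(3) d_def by blast
  qed (use KL s in \<open>auto simp: d_def\<close>)
qed

section \<open>The Hausdorff dimensions of the two exceptional sets\<close>

lemma hausdorff_dim_eqI:
  assumes h: "h \<ge> 0"
    and upper: "\<And>s. s > h \<Longrightarrow> hausdorff_measure s S = 0"
    and lower: "\<And>s. 0 \<le> s \<Longrightarrow> s < h \<Longrightarrow> hausdorff_measure s S \<noteq> 0"
  shows "hausdorff_dim S = ereal h"
  unfolding hausdorff_dim_def
proof (rule antisym)
  show "ereal h \<le> Inf {ereal s |s. 0 \<le> s \<and> hausdorff_measure s S = 0}"
    using lower by (intro Inf_greatest) (auto, meson not_le)
  show "Inf {ereal s |s. 0 \<le> s \<and> hausdorff_measure s S = 0} \<le> ereal h"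
  proof (rule ereal_le_epsilon2)
    fix e :: real assume "e > 0"
    hence "Inf {ereal s |s. 0 \<le> s \<and> hausdorff_measure s S = 0} \<le> ereal (h + e)"
      using h upper[of "h + e"] by (intro Inf_lower) auto
    thus "Inf {ereal s |s. 0 \<le> s \<and> hausdorff_measure s S = 0} \<le> ereal h + ereal e" by simp
  qed
qed

lemma ln_level_slope:
  assumes "N \<ge> 1" "a_min N < a" "a < a0_star N" "k \<le> n"
  shows "ln (level_slope N a n k) = - (ln (up_slope N a) - ln (down_slope N a)) * (real k - real n * phi N a)"
proof -
  define A B where "A = ln (up_slope N a)" and "B = ln (down_slope N a)"
  have s: "1 < up_slope N a" "0 < down_slope N a" using slope_bounds[OF assms(1,2)] .
  have AB: "A > 0" "B < 0" using s down_slope_less_1[OF assms(1,3)] by (auto simp: A_def B_def)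
  have "(2 * real N + 1) ^ n = (2 * real N + 1) ^ (n - k) * (2 * real N + 1) ^ k"
    using assms(4) by (simp add: power_add[symmetric])
  hence "level_slope N a n k = up_slope N a ^ (n - k) * down_slope N a ^ k"
    unfolding level_slope_def up_slope_def down_slope_def by (simp only: power_mult_distrib mult_ac)
  hence "ln (level_slope N a n k) = real (n - k) * A + real k * B"
    using s by (simp add: ln_mult ln_realpow A_def B_def)
  also have "\<dots> = - (A - B) * (real k - real n * (A / (A - B)))"
    using AB assms(4) by (simp add: of_nat_diff algebra_simps divide_simps)
  finally show ?thesis by (simp add: phi_eq[OF assms(1,2)] A_def B_def)
qed

text \<open>The logarithm of the slope at order \<open>n\<close> is a negative constant times the excess of odd digits over
  \<open>n phi N a\<close>.\<close>

lemma D0_iff_odd_excess: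
  assumes "N \<ge> 1" "a_min N < a" "a < a0_star N" "0 < x" "x < 1"
  shows "x \<in> D0 N a \<longleftrightarrow> filterlim (\<lambda>n. real (odd_count (2 * N + 1) x n) - real n * phi N a) at_top sequentially"
proof -
  have a1: "a < 1" using a0_star_less_1[OF assms(1)] assms(3) by linarith
  define c where "c = ln (up_slope N a) - ln (down_slope N a)"
  have c: "c > 0" using slope_bounds[OF assms(1,2)] down_slope_less_1[OF assms(1,3)]
    unfolding c_def by (smt (verit) ln_gt_zero ln_less_zero)
  define sl where "sl n = level_slope N a n (odd_count (2 * N + 1) x n)" for n
  define E where "E n = real (odd_count (2 * N + 1) x n) - real n * phi N a" for n
  have pos: "sl n > 0" for n unfolding sl_def by (rule level_slope_pos[OF assms(1,2) a1])
  have "ln (sl n) = - c * E n" for n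
    unfolding sl_def c_def E_def odd_count_def by (intro ln_level_slope assms odd_digits_le)
  hence sl: "sl n = exp (- (c * E n))" for n using pos[of n] by (metis exp_ln mult_minus_left)
  have "x \<in> D0 N a \<longleftrightarrow> sl \<longlonglongrightarrow> 0"
    unfolding sl_def by (rule D0_iff_slopes_tendsto_0[OF assms(1,2) a1 assms(4,5)])
  also have "\<dots> \<longleftrightarrow> filterlim E at_top sequentially"
  proof
    assume "filterlim E at_top sequentially"
    hence "filterlim (\<lambda>n. c * E n) at_top sequentially"
      using c by (intro filterlim_tendsto_pos_mult_at_top[OF tendsto_const])
    hence "filterlim (\<lambda>n. - (c * E n)) at_bot sequentially" by (simp add: filterlim_uminus_at_top)
    thus "sl \<longlonglongrightarrow> 0" unfolding sl by (rule filterlim_compose[OF exp_at_bot])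
  next
    assume *: "sl \<longlonglongrightarrow> 0"
    show "filterlim E at_top sequentially"
      unfolding filterlim_at_top
    proof
      fix Z :: real
      have "\<forall>\<^sub>F n in sequentially. sl n < exp (- (c * Z))"
        using * by (rule order_tendstoD) simp
      thus "\<forall>\<^sub>F n in sequentially. Z \<le> E n"
        by eventually_elim (use c in \<open>simp add: sl\<close>)
    qed
  qed
  finally show ?thesis by (simp only: E_def[abs_def])
qed

lemma entropy_isCont:
  assumes "N \<ge> 1" "0 < p" "p < 1"
  shows "isCont (entropy N) p"
  unfolding entropy_def using assms by (intro continuous_intros) auto

lemma exists_rational_above:
  assumes "N \<ge> 1" "0 < p" "p < 1" "h < entropy N p"
  obtains q where "q \<in> \<rat>" "p < q" "q < 1" "h < entropy N q"
proof -
  have "\<forall>\<^sub>F q in at p. h < entropy N q"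
    using entropy_isCont[OF assms(1-3)] assms(4) unfolding isCont_def by (rule order_tendstoD)
  then obtain e where e: "e > 0" "\<And>q. q \<noteq> p \<Longrightarrow> dist q p < e \<Longrightarrow> h < entropy N q"
    unfolding eventually_at by blast
  obtain q where q: "q \<in> \<rat>" "p < q" "q < min 1 (p + e)"
    using Rats_dense_in_real[of p "min 1 (p + e)"] assms e(1) by auto
  thus ?thesis using that[of q] e(2)[of q] by (auto simp: dist_real_def)
qed

lemma exists_rational_below:
  assumes "N \<ge> 1" "0 < p" "p < 1" "h < entropy N p"
  obtains q where "q \<in> \<rat>" "0 < q" "q < p" "h < entropy N q"
proof -
  have "\<forall>\<^sub>F q in at p. h < entropy N q"
    using entropy_isCont[OF assms(1-3)] assms(4) unfolding isCont_def by (rule order_tendstoD)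
  then obtain e where e: "e > 0" "\<And>q. q \<noteq> p \<Longrightarrow> dist q p < e \<Longrightarrow> h < entropy N q"
    unfolding eventually_at by blast
  obtain q where q: "q \<in> \<rat>" "max 0 (p - e) < q" "q < p"
    using Rats_dense_in_real[of "max 0 (p - e)" p] assms e(1) by auto
  thus ?thesis using that[of q] e(2)[of q] by (auto simp: dist_real_def)
qed

text \<open>Upper bound for both.\<close>

text \<open>The hypothesis treats both sides of \<open>N/(2N+1)\<close> at once: for \<open>p\<close> above this value it asks for at least
  \<open>np\<close> odd digits up to a constant, for \<open>p\<close> below it for at most \<open>np\<close>, in either case for infinitely many
  \<open>n\<close>. Such digit counts have mass at least \<open>d\<^bsup>-n h(p)\<^esup>\<close> up to a constant factor, which any exponent
  \<open>t > h(p)\<close> absorbs.\<close>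

lemma hausdorff_measure_eq_0_odd_deviation:
  fixes S :: "real set"
  assumes N: "N \<ge> 1" and p: "0 < p" "p < 1" and s: "s > h_fun N p"
    and S: "\<And>x. x \<in> S \<Longrightarrow> 0 \<le> x \<and> x < 1"
    and freq: "\<And>x. x \<in> S \<Longrightarrow> \<exists>C. \<exists>\<^sub>F n in sequentially. 
      (real (odd_count (2 * N + 1) x n) - real n * p) * (p - real N / (2 * real N + 1)) \<ge> - C"
  shows "hausdorff_measure s S = 0"
proof -
  define D where "D = 2 * real N + 1"
  have D: "D > 1" "ln D > 0" using N by (auto simp: D_def)
  define u v where "u = p / real N" and "v = (1 - p) / (real N + 1)"
  have uv: "u > 0" "v > 0" "real N * u + (real N + 1) * v = 1" using p N by (auto simp: u_def v_def)
  have h: "entropy N p = h_fun N p * ln D" using D by (simp add: h_fun_eq_entropy D_def)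
  have h0: "h_fun N p > 0" using entropy_pos[OF N p] D by (simp add: h_fun_eq_entropy D_def)
  \<comment> \<open>Room on both sides of \<open>t\<close>: towards \<open>h_fun N p\<close> for the constant factors, towards \<open>s\<close> for summability.\<close>
  define t where "t = (h_fun N p + s) / 2"
  have t: "h_fun N p < t" "t < s" using s by (auto simp: t_def)
  define w where "w = ln u - ln v"
  \<comment> \<open>\<open>ln u - ln v\<close> and \<open>p - N/D\<close> have the same sign.\<close>
  have uvp: "u - v = (p - real N / D) * (D / (real N * (real N + 1)))"
    using N by (simp add: u_def v_def D_def divide_simps) (simp add: algebra_simps)
  obtain c where c: "c \<ge> 0" "w = c * (p - real N / D)"
  proof (cases "p = real N / D")
    case True
    thus ?thesis using that[of 0] uvp by (simp add: w_def)
  next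
    case False
    have "w / (p - real N / D) \<ge> 0"
    proof (cases "p > real N / D")
      case True
      hence "u - v > 0" unfolding uvp using N D by (intro mult_pos_pos divide_pos_pos) auto
      hence "w > 0" using uv by (simp add: w_def)
      thus ?thesis using True by simp
    next
      case F: False
      hence "u - v < 0" unfolding uvp using N D False by (intro mult_neg_pos divide_pos_pos mult_pos_pos) auto
      hence "w < 0" using uv by (simp add: w_def)
      thus ?thesis using F by (intro divide_nonpos_nonpos) auto
    qed
    thus ?thesis using that[of "w / (p - real N / D)"] False by simp
  qed
  show ?thesis
  proof (rule hausdorff_measure_eq_0_heavy_cylinders[OF N _ _ uv(3) _ t(2) S])
    show "u \<ge> 0" "v \<ge> 0" "0 < s" using uv h0 s by auto
    fix x assume x: "x \<in> S"
    obtain C where C: "\<exists>\<^sub>F n in sequentially. (real (odd_count (2 * N + 1) x n) - real n * p) * (p - real N / D) \<ge> - C"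
      using freq[OF x] unfolding D_def by blast
    have "(t - h_fun N p) * ln D > 0" using t D by simp
    hence ev: "\<forall>\<^sub>F n in sequentially. c * C \<le> real n * ((t - h_fun N p) * ln D)" by real_asymp
    have "\<exists>\<^sub>F n in sequentially. D powr (- real n * t) \<le> u ^ odd_count (2 * N + 1) x n * v ^ (n - odd_count (2 * N + 1) x n)"
      using frequently_eventually_frequently[OF C ev]
    proof (rule frequently_elim1)
      fix n
      define k where "k = odd_count (2 * N + 1) x n"
      assume "- C \<le> (real (odd_count (2 * N + 1) x n) - real n * p) * (p - real N / D) \<and>
         c * C \<le> real n * ((t - h_fun N p) * ln D)"
      hence a: "c * - C \<le> c * ((real k - real n * p) * (p - real N / D))" "c * C \<le> real n * ((t - h_fun N p) * ln D)"
        unfolding k_def using mult_left_mono[OF _ c(1)] by blast+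
      have kn: "k \<le> n" unfolding k_def odd_count_def by (rule odd_digits_le)
      have "- real n * (h_fun N p * ln D) = real n * (p * ln u + (1 - p) * ln v)"
        unfolding h[symmetric]
        by (simp only: entropy_def u_def v_def mult_minus_left mult_minus_right minus_minus)
      hence "- real n * t * ln D \<le> real n * (p * ln u + (1 - p) * ln v) - c * C" using a(2) by (simp add: algebra_simps)
      also have "\<dots> \<le> real n * (p * ln u + (1 - p) * ln v) + (real k - real n * p) * w"
        using a(1) unfolding c(2) by (simp add: algebra_simps)
      also have "\<dots> = real k * ln u + (real n - real k) * ln v" by (simp add: w_def algebra_simps)
      also have "\<dots> = ln (u ^ k * v ^ (n - k))" using uv kn by (simp add: ln_mult ln_realpow of_nat_diff)
      finally have "exp (- real n * t * ln D) \<le> exp (ln (u ^ k * v ^ (n - k)))" by simp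
      thus "D powr (- real n * t) \<le> u ^ odd_count (2 * N + 1) x n * v ^ (n - odd_count (2 * N + 1) x n)"
        unfolding k_def[symmetric] using uv D by (simp add: powr_def)
    qed
    thus "\<exists>\<^sub>F n in sequentially. (2 * real N + 1) powr (- real n * t) \<le> u ^ odd_count (2 * N + 1) x n * v ^ (n - odd_count (2 * N + 1) x n)"
      unfolding D_def .
  qed
qed

text \<open>Vanishing derivative forces an excess of odd digits over the frequency \<open>p \<ge> N/(2N+1)\<close>, and a frequency
  \<open>q > p\<close> attained up to a bounded error guarantees it.\<close>

lemma hausdorff_dim_D0:
  assumes N: "N \<ge> 1" and a: "a0_tilde N \<le> a" "a < a0_star N"
  shows "hausdorff_dim (D0 N a) = ereal (h_fun N (phi N a))"
proof (rule hausdorff_dim_eqI)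
  have am: "a_min N < a" using a0_tilde_bounds[OF N] a by linarith
  define p where "p = phi N a"
  have p: "0 < p" "p < 1" unfolding p_def using phi_bounds[OF N am a(2)] by auto
  have pN: "real N / (2 * real N + 1) \<le> p" unfolding p_def by (rule phi_ge[OF N a])
  have L: "ln (2 * real N + 1) > 0" using N by simp
  show "h_fun N (phi N a) \<ge> 0" using entropy_pos[OF N p] L by (simp add: h_fun_eq_entropy p_def)
  have D0: "0 < x \<and> x < 1" if "x \<in> D0 N a" for x using that by (simp add: D0_def)
  note iff = D0_iff_odd_excess[OF N am a(2), folded p_def]
  show "hausdorff_measure s (D0 N a) = 0" if s: "s > h_fun N (phi N a)" for s
  proof (rule hausdorff_measure_eq_0_odd_deviation[OF N p s[folded p_def]])
    fix x assume x: "x \<in> D0 N a"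
    show "0 \<le> x \<and> x < 1" using D0[OF x] by simp
    have "filterlim (\<lambda>n. real (odd_count (2 * N + 1) x n) - real n * p) at_top sequentially"
      using iff[of x] D0[OF x] x by blast
    hence "\<forall>\<^sub>F n in sequentially. 0 \<le> real (odd_count (2 * N + 1) x n) - real n * p"
      unfolding filterlim_at_top by blast
    hence "\<forall>\<^sub>F n in sequentially. (real (odd_count (2 * N + 1) x n) - real n * p) * (p - real N / (2 * real N + 1)) \<ge> - 0"
      by eventually_elim (use pN in simp)
    hence "\<exists>\<^sub>F n in sequentially. (real (odd_count (2 * N + 1) x n) - real n * p) * (p - real N / (2 * real N + 1)) \<ge> - 0"
      by (rule eventually_frequently[OF sequentially_bot])
    thus "\<exists>C. \<exists>\<^sub>F n in sequentially. (real (odd_count (2 * N + 1) x n) - real n * p) * (p - real N / (2 * real N + 1)) \<ge> - C" 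
      by blast
  qed
  show "hausdorff_measure s (D0 N a) \<noteq> 0" if s: "0 \<le> s" "s < h_fun N (phi N a)" for s
  proof -
    have "s * ln (2 * real N + 1) < entropy N p" using s(2) L by (simp add: h_fun_eq_entropy p_def field_simps)
    then obtain q where q: "q \<in> \<rat>" "p < q" "q < 1" "s * ln (2 * real N + 1) < entropy N q"
      using exists_rational_above[OF N p] by blast
    show ?thesis
    proof (rule hausdorff_measure_frequency_set_nonzero[OF N q(1) _ q(3) s(1) q(4)])
      show "0 < q" using p q by simp
      fix x C :: real
      assume x: "0 < x" "x < 1" and b: "\<And>n. \<bar>real (odd_count (2 * N + 1) x n) - real n * q\<bar> \<le> C"
      have "filterlim (\<lambda>n. real n * (q - p) - C) at_top sequentially" using q by real_asymp
      hence "filterlim (\<lambda>n. real (odd_count (2 * N + 1) x n) - real n * p) at_top sequentially"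
      proof (rule filterlim_at_top_mono, intro always_eventually allI)
        show "real n * (q - p) - C \<le> real (odd_count (2 * N + 1) x n) - real n * p" for n
          using b[of n] by (simp add: algebra_simps abs_le_iff)
      qed
      thus "x \<in> D0 N a" using iff[OF x] by blast
    qed
  qed
qed

text \<open>If the excess of odd digits does not tend to infinity, it is bounded above along a subsequence; this
  happens in particular for a frequency \<open>q < p\<close> attained up to a bounded error.\<close>

lemma hausdorff_dim_compl_D0:
  assumes N: "N \<ge> 1" and a: "a_min N < a" "a \<le> a0_tilde N"
  shows "hausdorff_dim ({0<..<1} - D0 N a) = ereal (h_fun N (phi N a))"
proof (rule hausdorff_dim_eqI)
  have as: "a < a0_star N" using a0_tilde_bounds[OF N] a by linarith
  define p where "p = phi N a"
  have p: "0 < p" "p < 1" unfolding p_def using phi_bounds[OF N a(1) as] by auto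
  have pN: "p \<le> real N / (2 * real N + 1)" unfolding p_def by (rule phi_le[OF N a])
  have L: "ln (2 * real N + 1) > 0" using N by simp
  show "h_fun N (phi N a) \<ge> 0" using entropy_pos[OF N p] L by (simp add: h_fun_eq_entropy p_def)
  note iff = D0_iff_odd_excess[OF N a(1) as, folded p_def]
  show "hausdorff_measure s ({0<..<1} - D0 N a) = 0" if s: "s > h_fun N (phi N a)" for s
  proof (rule hausdorff_measure_eq_0_odd_deviation[OF N p s[folded p_def]])
    fix x assume x: "x \<in> {0<..<1} - D0 N a"
    show "0 \<le> x \<and> x < 1" using x by simp
    have "\<not> filterlim (\<lambda>n. real (odd_count (2 * N + 1) x n) - real n * p) at_top sequentially"
      using iff[of x] x by auto
    then obtain Z where "\<exists>\<^sub>F n in sequentially. real (odd_count (2 * N + 1) x n) - real n * p < Z"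
      unfolding filterlim_at_top frequently_def by (auto simp: not_less)
    hence "\<exists>\<^sub>F n in sequentially. (real (odd_count (2 * N + 1) x n) - real n * p) * (p - real N / (2 * real N + 1)) 
        \<ge> - (- (Z * (p - real N / (2 * real N + 1))))"
    proof (rule frequently_elim1)
      fix n assume "real (odd_count (2 * N + 1) x n) - real n * p < Z"
      thus "(real (odd_count (2 * N + 1) x n) - real n * p) * (p - real N / (2 * real N + 1)) 
        \<ge> - (- (Z * (p - real N / (2 * real N + 1))))"
        using pN by (simp add: mult_right_mono_neg)
    qed
    thus "\<exists>C. \<exists>\<^sub>F n in sequentially. (real (odd_count (2 * N + 1) x n) - real n * p) * (p - real N / (2 * real N + 1)) \<ge> - C" 
      by blast
  qed
  show "hausdorff_measure s ({0<..<1} - D0 N a) \<noteq> 0" if s: "0 \<le> s" "s < h_fun N (phi N a)" for s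
  proof -
    have "s * ln (2 * real N + 1) < entropy N p" using s(2) L by (simp add: h_fun_eq_entropy p_def field_simps)
    then obtain q where q: "q \<in> \<rat>" "0 < q" "q < p" "s * ln (2 * real N + 1) < entropy N q"
      using exists_rational_below[OF N p] by blast
    show ?thesis
    proof (rule hausdorff_measure_frequency_set_nonzero[OF N q(1,2) _ s(1) q(4)])
      show "q < 1" using p q by simp
      fix x C :: real
      assume x: "0 < x" "x < 1" and b: "\<And>n. \<bar>real (odd_count (2 * N + 1) x n) - real n * q\<bar> \<le> C"
      have "\<not> filterlim (\<lambda>n. real (odd_count (2 * N + 1) x n) - real n * p) at_top sequentially"
      proof
        assume "filterlim (\<lambda>n. real (odd_count (2 * N + 1) x n) - real n * p) at_top sequentially"
        hence "\<forall>\<^sub>F n in sequentially. C + 1 \<le> real (odd_count (2 * N + 1) x n) - real n * p"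
          unfolding filterlim_at_top by blast
        then obtain n where "C + 1 \<le> real (odd_count (2 * N + 1) x n) - real n * p"
          using eventually_happens'[OF sequentially_bot] by blast
        moreover have "real n * q \<le> real n * p" using q by (intro mult_left_mono) auto
        ultimately show False using b[of n] by linarith
      qed
      thus "x \<in> {0<..<1} - D0 N a" using iff[OF x] x by auto
    qed
  qed
qed

theorem theorem2p2:
  fixes N :: nat
  assumes "N \<ge> 1"
  shows
    "(\<forall>a. a0_tilde N \<le> a \<and> a < a0_star N \<longrightarrow>
        hausdorff_dim (D0 N a) = ereal (h_fun N (phi N a))) \<and>
     (\<forall>a. a_min N < a \<and> a \<le> a0_tilde N \<longrightarrow>
        hausdorff_dim ({0<..<1} - D0 N a) = ereal (h_fun N (phi N a))) \<and>
     concave_on {a_min N<..<a0_star N} (\<lambda>a. h_fun N (phi N a)) \<and>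
     a0_tilde N \<in> {a_min N<..<a0_star N} \<and>
     h_fun N (phi N (a0_tilde N)) = 1 \<and>
     (\<forall>a\<in>{a_min N<..<a0_star N}. h_fun N (phi N a) \<le> 1) \<and>
     ((\<lambda>a. h_fun N (phi N a)) \<longlongrightarrow> ln (real N + 1) / ln (2 * real N + 1)) (at_right (a_min N)) \<and>
     ((\<lambda>a. h_fun N (phi N a)) \<longlongrightarrow> ln (real N) / ln (2 * real N + 1)) (at_left (a0_star N))"
  using hausdorff_dim_D0[OF assms] hausdorff_dim_compl_D0[OF assms]
    dimension_function_shape[OF assms] a0_tilde_bounds[OF assms]
  by auto

end
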